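(* There exists a complex polynomial of degree at least $2$ that satisfies the Exponential Shrinking of components condition (ExpShrink) but does not satisfy the Recurrent Collet-Eckmann condition (RCE).
   Context: Let $R$ be a rational map of degree at least $2$ of the Riemann sphere $\overline{\mathbb C}$ (in particular, a polynomial), $J$ its Julia set and $\mathrm{Crit}$ its set of critical points. ExpShrink: there are $\lambda>1$ and $r>0$ such that for all $z\in J$, all $n>0$ and every connected component $W$ of $R^{-n}(B(z,r))$ one has $\operatorname{diam} W<\lambda^{-n}$ (balls and diameters with respect to the spherical distance). A critical point $c$ is Collet-Eckmann if there are constants $C>0$, $\lambda>1$ with $|(R^n)'(R(c))|>C\lambda^n$ for all $n>0$ (for polynomials, derivatives are taken with respect to the Euclidean metric). A critical point $c$ is recurrent if $c\in\omega(c)$, where $\omega(c)$ is the set of accumulation points of the orbit $(R^n(c))_{n>0}$. RCE: every recurrent critical point in the Julia set $J$ is Collet-Eckmann, and $R$ has no parabolic periodic orbits. *)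

theory Defs
  imports "HOL-Analysis.Analysis" "HOL-Computational_Algebra.Computational_Algebra"
    "HOL-Real_Asymp.Real_Asymp"
begin

datatype riemann_sphere = Fin complex | Infty

text \<open>Inverse stereographic projection onto the unit sphere of \<^typ>\<open>complex \<times> real\<close>.\<close>

fun stereo :: "riemann_sphere \<Rightarrow> complex \<times> real" where
  "stereo (Fin z) = ((2 / (1 + (cmod z)\<^sup>2)) *\<^sub>R z, ((cmod z)\<^sup>2 - 1) / ((cmod z)\<^sup>2 + 1))"
| "stereo Infty = (0, 1)"

lemma norm_stereo [simp]: "norm (stereo x) = 1"
proof (cases x)
  case (Fin z)
  define t where "t = (cmod z)\<^sup>2"
  have t: "1 + t > 0" by (simp add: t_def add_pos_nonneg)
  have "(norm (stereo x))\<^sup>2 = (2 / (1 + t) * cmod z)\<^sup>2 + ((t - 1) / (t + 1))\<^sup>2"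
    using t by (simp add: Fin norm_Pair t_def power_divide)
  also have "\<dots> = (4 * t + (t - 1)\<^sup>2) / (t + 1)\<^sup>2"
    by (simp add: power_mult_distrib power_divide t_def add_divide_distrib add.commute)
  also have "4 * t + (t - 1)\<^sup>2 = (t + 1)\<^sup>2"
    by (simp add: power2_eq_square algebra_simps)
  finally have "(norm (stereo x))\<^sup>2 = 1" using t by simp
  thus ?thesis
    by (smt (verit) norm_ge_zero power2_eq_1_iff)
qed simp

lemma stereo_inject: "stereo x = stereo y \<longleftrightarrow> x = y"
proof
  assume eq: "stereo x = stereo y"
  have ne: "stereo (Fin z) \<noteq> stereo Infty" for z
  proof -
    have "(cmod z)\<^sup>2 + 1 > 0" by (simp add: add_nonneg_pos)
    thus ?thesis by (simp add: field_simps)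
  qed
  show "x = y"
  proof (cases x; cases y)
    fix z w assume xy: "x = Fin z" "y = Fin w"
    define s t where "s = (cmod z)\<^sup>2" and "t = (cmod w)\<^sup>2"
    have pos: "1 + s > 0" "1 + t > 0" by (simp_all add: s_def t_def add_pos_nonneg)
    have "(s - 1) / (s + 1) = (t - 1) / (t + 1)"
      using eq by (simp add: xy s_def t_def)
    hence "(s - 1) * (t + 1) = (t - 1) * (s + 1)"
      using pos by (simp add: divide_simps add.commute)
    hence "s = t" by (simp add: algebra_simps)
    moreover have "(2 / (1 + s)) *\<^sub>R z = (2 / (1 + t)) *\<^sub>R w"
      using eq by (simp add: xy s_def t_def)
    ultimately show "x = y" using pos by (simp add: xy)
  qed (use eq ne in metis)+
qed simp

lemma inner_unit_bounds:
  fixes u v :: "'a::real_inner"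
  assumes "norm u = 1" "norm v = 1"
  shows "-1 \<le> inner u v" "inner u v \<le> 1"
  using Cauchy_Schwarz_ineq2[of u v] assms by (simp_all add: abs_le_iff)

lemma arccos_inner_triangle:
  fixes u v w :: "'a::real_inner"
  assumes u: "norm u = 1" and v: "norm v = 1" and w: "norm w = 1"
  shows "arccos (inner u w) \<le> arccos (inner u v) + arccos (inner v w)"
proof -
  define a b where "a = arccos (inner u v)" and "b = arccos (inner v w)"
  have ca: "cos a = inner u v" and cb: "cos b = inner v w"
    using inner_unit_bounds[OF u v] inner_unit_bounds[OF v w]
    by (simp_all add: a_def b_def)
  have a: "0 \<le> a" "a \<le> pi" and b: "0 \<le> b" "b \<le> pi"
    using inner_unit_bounds[OF u v] inner_unit_bounds[OF v w]
    by (simp_all add: a_def b_def arccos_lbound arccos_ubound)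
  define p q where "p = u - cos a *\<^sub>R v" and "q = w - cos b *\<^sub>R v"
  have uu: "inner u u = 1" "inner v v = 1" "inner w w = 1"
    using u v w by (simp_all add: norm_eq_1)
  have "(norm p)\<^sup>2 = 1 - (cos a)\<^sup>2"
    unfolding p_def power2_norm_eq_inner
    by (simp add: inner_diff_left inner_diff_right uu ca inner_commute[of v u] power2_eq_square)
  hence np: "norm p = sin a"
    using a by (metis sin_squared_eq norm_ge_zero sin_ge_zero power2_eq_iff_nonneg)
  have "(norm q)\<^sup>2 = 1 - (cos b)\<^sup>2"
    unfolding q_def power2_norm_eq_inner
    by (simp add: inner_diff_left inner_diff_right uu cb inner_commute[of w v] power2_eq_square)
  hence nq: "norm q = sin b"
    using b by (metis sin_squared_eq norm_ge_zero sin_ge_zero power2_eq_iff_nonneg)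
  have "inner u w = cos a * cos b + inner p q"
    unfolding p_def q_def
    by (simp add: inner_diff_left inner_diff_right uu ca cb)
  moreover have "- (sin a * sin b) \<le> inner p q"
    using Cauchy_Schwarz_ineq2[of p q] np nq by (simp add: abs_le_iff)
  ultimately have ge: "cos (a + b) \<le> inner u w" by (simp add: cos_add)
  show ?thesis
  proof (cases "a + b \<le> pi")
    case True
    have "arccos (inner u w) \<le> arccos (cos (a + b))"
      using ge inner_unit_bounds[OF u w] by (intro arccos_le_arccos) auto
    also have "\<dots> = a + b" using True a b by (simp add: arccos_cos)
    finally show ?thesis by (simp add: a_def b_def)
  next
    case False
    thus ?thesis
      using arccos_ubound[OF inner_unit_bounds[OF u w]] by (simp add: a_def b_def)
  qed
qed

text \<open>
  The distance is the geodesic (great circle) distance on the unit sphere, that is, the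
  distance of the Riemannian metric $2|dz|/(1+|z|^2)$.
\<close>

instantiation riemann_sphere :: metric_space
begin

definition dist_riemann_sphere :: "riemann_sphere \<Rightarrow> riemann_sphere \<Rightarrow> real" where
  "dist_riemann_sphere x y = arccos (inner (stereo x) (stereo y))"

definition uniformity_riemann_sphere :: "(riemann_sphere \<times> riemann_sphere) filter" where
  "uniformity_riemann_sphere = (INF e\<in>{0<..}. principal {(x, y). dist x y < e})"

definition open_riemann_sphere :: "riemann_sphere set \<Rightarrow> bool" where
  "open_riemann_sphere U \<longleftrightarrow> (\<forall>x\<in>U. \<forall>\<^sub>F (x', y) in uniformity. x' = x \<longrightarrow> y \<in> U)"

instance
proof
  fix x y z :: riemann_sphere
  show "dist x y = 0 \<longleftrightarrow> x = y"
  proof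
    assume "dist x y = 0"
    hence "inner (stereo x) (stereo y) = 1"
      using cos_arccos[OF inner_unit_bounds[OF norm_stereo norm_stereo, of x y]]
      by (simp add: dist_riemann_sphere_def)
    hence "(norm (stereo x - stereo y))\<^sup>2 = 0"
      by (simp add: power2_norm_eq_inner inner_diff_left inner_diff_right
          inner_commute[of "stereo y" "stereo x"] norm_eq_1[THEN iffD1, OF norm_stereo])
    thus "x = y" by (simp add: stereo_inject)
  qed (simp add: dist_riemann_sphere_def norm_eq_1[THEN iffD1, OF norm_stereo])
  show "dist x y \<le> dist x z + dist y z"
    using arccos_inner_triangle[of "stereo x" "stereo z" "stereo y"]
    by (simp add: dist_riemann_sphere_def inner_commute[of "stereo z" "stereo y"])
qed (simp_all add: uniformity_riemann_sphere_def open_riemann_sphere_def)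

end

text \<open>The extension of a nonconstant polynomial to the sphere.\<close>

fun sphere_map :: "complex poly \<Rightarrow> riemann_sphere \<Rightarrow> riemann_sphere" where
  "sphere_map p (Fin z) = Fin (poly p z)"
| "sphere_map p Infty = Infty"

definition normal_family_on ::
    "'a::topological_space set \<Rightarrow> ('a \<Rightarrow> 'b::metric_space) set \<Rightarrow> bool" where
  "normal_family_on U F \<longleftrightarrow>
    (\<forall>g :: nat \<Rightarrow> 'a \<Rightarrow> 'b. range g \<subseteq> F \<longrightarrow>
      (\<exists>(\<sigma> :: nat \<Rightarrow> nat) h. strict_mono \<sigma> \<and>
        (\<forall>K. compact K \<and> K \<subseteq> U \<longrightarrow> uniform_limit K (\<lambda>k. g (\<sigma> k)) h sequentially)))"

definition fatou_set :: "('a::metric_space \<Rightarrow> 'a) \<Rightarrow> 'a set" where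
  "fatou_set f = {x. \<exists>U. open U \<and> x \<in> U \<and> normal_family_on U (range (\<lambda>n. f ^^ n))}"

definition julia_set :: "('a::metric_space \<Rightarrow> 'a) \<Rightarrow> 'a set" where
  "julia_set f = - fatou_set f"

definition exp_shrink :: "('a::metric_space \<Rightarrow> 'a) \<Rightarrow> bool" where
  "exp_shrink f \<longleftrightarrow>
    (\<exists>\<theta>>1. \<exists>r>0. \<forall>z\<in>julia_set f. \<forall>n>0. \<forall>W\<in>components ((f ^^ n) -` ball z r).
      diameter W < 1 / \<theta> ^ n)"

text \<open>Accumulation points of the sequence \<^term>\<open>\<lambda>n. (f ^^ n) x\<close>, counting repeated values.\<close>

definition omega_limit :: "('a::topological_space \<Rightarrow> 'a) \<Rightarrow> 'a \<Rightarrow> 'a set" where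
  "omega_limit f x = {y. \<forall>U. open U \<and> y \<in> U \<longrightarrow> (\<exists>\<^sub>F n in sequentially. (f ^^ n) x \<in> U)}"

definition recurrent :: "('a::topological_space \<Rightarrow> 'a) \<Rightarrow> 'a \<Rightarrow> bool" where
  "recurrent f x \<longleftrightarrow> x \<in> omega_limit f x"

definition critical_point :: "complex poly \<Rightarrow> complex \<Rightarrow> bool" where
  "critical_point p c \<longleftrightarrow> deriv (poly p) c = 0"

definition collet_eckmann :: "complex poly \<Rightarrow> complex \<Rightarrow> bool" where
  "collet_eckmann p c \<longleftrightarrow>
    (\<exists>C>0. \<exists>\<theta>>1. \<forall>n>0. cmod (deriv (poly p ^^ n) (poly p c)) > C * \<theta> ^ n)"

text \<open>
  A periodic point is parabolic if its multiplier is a root of unity. Replacing the exact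
  period by a multiple replaces the multiplier by a power, so \<open>n\<close> may be any period.
\<close>

definition parabolic_periodic :: "complex poly \<Rightarrow> complex \<Rightarrow> bool" where
  "parabolic_periodic p z \<longleftrightarrow>
    (\<exists>n>0. (poly p ^^ n) z = z \<and> (\<exists>k>0. deriv (poly p ^^ n) z ^ k = 1))"

text \<open>
  For a polynomial of degree at least 2 the point \<^term>\<open>Infty\<close> is a superattracting fixed
  point: it is not parabolic, and it is a critical point outside the Julia set (see
  \<open>Infty_notin_julia_set\<close> below). So both conditions only involve finite points.
\<close>

definition recurrent_collet_eckmann :: "complex poly \<Rightarrow> bool" where
  "recurrent_collet_eckmann p \<longleftrightarrow>
    (\<forall>c. critical_point p c \<and> Fin c \<in> julia_set (sphere_map p) \<and> recurrent (sphere_map p) (Fin c)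
       \<longrightarrow> collet_eckmann p c) \<and>
    (\<nexists>z. parabolic_periodic p z)"

lemma dist_Fin_Infty: "dist (Fin z) Infty = arccos (((cmod z)\<^sup>2 - 1) / ((cmod z)\<^sup>2 + 1))"
  by (simp add: dist_riemann_sphere_def)

lemma dist_Infty_less_iff:
  assumes "R \<ge> 0"
  shows "dist (Fin z) Infty < arccos ((R\<^sup>2 - 1) / (R\<^sup>2 + 1)) \<longleftrightarrow> cmod z > R"
proof -
  have b: "\<bar>(t\<^sup>2 - 1) / (t\<^sup>2 + 1)\<bar> \<le> 1" for t :: real
    by (simp add: abs_le_iff divide_simps add_nonneg_pos)
  have "dist (Fin z) Infty < arccos ((R\<^sup>2 - 1) / (R\<^sup>2 + 1)) \<longleftrightarrow>
      (R\<^sup>2 - 1) / (R\<^sup>2 + 1) < ((cmod z)\<^sup>2 - 1) / ((cmod z)\<^sup>2 + 1)"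
    unfolding dist_Fin_Infty using b by (intro arccos_less_mono) auto
  also have "\<dots> \<longleftrightarrow> (R\<^sup>2 - 1) * ((cmod z)\<^sup>2 + 1) < ((cmod z)\<^sup>2 - 1) * (R\<^sup>2 + 1)"
    using add_nonneg_pos[OF zero_le_power2 zero_less_one, of R]
      add_nonneg_pos[OF zero_le_power2 zero_less_one, of "cmod z"]
    by (simp add: divide_simps)
  also have "\<dots> \<longleftrightarrow> R\<^sup>2 < (cmod z)\<^sup>2" by (simp add: algebra_simps)
  also have "\<dots> \<longleftrightarrow> R < cmod z"
    using assms by (meson norm_ge_zero power2_less_imp_less power_strict_mono zero_less_numeral)
  finally show ?thesis .
qed

lemma poly_doubles_near_infinity:
  fixes p :: "complex poly"
  assumes "degree p \<ge> 2"
  obtains R where "R > 0" "\<And>z. cmod z \<ge> R \<Longrightarrow> cmod (poly p z) \<ge> 2 * cmod z"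
proof -
  obtain a q where p: "p = pCons a q" by (cases p)
  obtain b q' where q: "q = pCons b q'" by (cases q)
  have "q' \<noteq> 0" using assms by (auto simp: p q split: if_splits)
  then obtain r where r: "\<And>z. r \<le> cmod z \<Longrightarrow> 3 \<le> cmod (poly q z)"
    using poly_infinity[of q' 3 b] by (auto simp: q)
  show ?thesis
  proof (rule that[of "max 1 (max r (cmod a))"])
    fix z assume z: "max 1 (max r (cmod a)) \<le> cmod z"
    have "cmod (z * poly q z) \<ge> cmod z * 3"
      unfolding norm_mult using z r[of z] by (intro mult_left_mono) auto
    moreover have "cmod (poly p z) \<ge> cmod (z * poly q z) - cmod a"
      using norm_diff_ineq[of "z * poly q z" a] by (simp add: p add.commute)
    ultimately show "2 * cmod z \<le> cmod (poly p z)" using z by simp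
  qed simp
qed

lemma uniform_limit_imp_normal_family:
  assumes lim: "uniform_limit U F h sequentially"
  shows "normal_family_on U (range F)"
  unfolding normal_family_on_def
proof (intro allI impI)
  fix g :: "nat \<Rightarrow> 'a \<Rightarrow> 'b" assume "range g \<subseteq> range F"
  hence "\<forall>k. \<exists>n. g k = F n" by blast
  then obtain m where m: "\<And>k. g k = F (m k)" by metis
  show "\<exists>(\<sigma> :: nat \<Rightarrow> nat) h. strict_mono \<sigma> \<and>
      (\<forall>K. compact K \<and> K \<subseteq> U \<longrightarrow> uniform_limit K (\<lambda>k. g (\<sigma> k)) h sequentially)"
  proof (cases "\<exists>v. infinite {k. m k = v}")
    case True
    then obtain v where v: "infinite {k. m k = v}" by blast
    define \<sigma> where "\<sigma> = enumerate {k. m k = v}"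
    have mono: "strict_mono \<sigma>" unfolding \<sigma>_def by (rule strict_mono_enumerate[OF v])
    have "m (\<sigma> k) = v" for k using enumerate_in_set[OF v, of k] by (simp add: \<sigma>_def)
    hence const: "(\<lambda>k. g (\<sigma> k)) = (\<lambda>_. F v)" by (simp add: m)
    have "uniform_limit K (\<lambda>k. g (\<sigma> k)) (F v) sequentially" for K
      unfolding const by (rule uniform_limit_const)
    thus ?thesis using mono by blast
  next
    case False
    have "filterlim m at_top sequentially"
      unfolding filterlim_at_top
    proof
      fix N
      have "{k. m k < N} = (\<Union>v<N. {k. m k = v})" by auto
      hence "finite {k. \<not> N \<le> m k}" using False by (simp add: not_le)
      thus "\<forall>\<^sub>F k in sequentially. N \<le> m k"
        by (simp add: cofinite_eq_sequentially[symmetric] eventually_cofinite)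
    qed
    hence "uniform_limit U (\<lambda>k. g k) h sequentially"
      unfolding m using filterlim_compose[OF lim] by blast
    hence "uniform_limit K (\<lambda>k. g (id k)) h sequentially" if "K \<subseteq> U" for K
      using uniform_limit_on_subset[OF _ that] by simp
    moreover have "strict_mono (id :: nat \<Rightarrow> nat)" by (rule strict_mono_id)
    ultimately show ?thesis by blast
  qed
qed

lemma Infty_notin_julia_set:
  assumes "degree p \<ge> 2"
  shows "Infty \<notin> julia_set (sphere_map p)"
proof -
  obtain R where R: "R > 0" and dbl: "\<And>z. cmod z \<ge> R \<Longrightarrow> cmod (poly p z) \<ge> 2 * cmod z"
    using poly_doubles_near_infinity[OF assms] by blast
  define d :: "real \<Rightarrow> real" where "d = (\<lambda>t. arccos ((t\<^sup>2 - 1) / (t\<^sup>2 + 1)))"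
  have inf_pow: "(sphere_map p ^^ n) Infty = Infty" for n by (induction n) auto
  have fin_pow: "\<exists>w. (sphere_map p ^^ n) (Fin z) = Fin w \<and> cmod w \<ge> 2 ^ n * R"
    if "cmod z > R" for n z
  proof (induction n)
    case (Suc n)
    then obtain w where w: "(sphere_map p ^^ n) (Fin z) = Fin w" "cmod w \<ge> 2 ^ n * R" by blast
    have "1 * R \<le> 2 ^ n * R" using R by (intro mult_right_mono) auto
    hence "cmod (poly p w) \<ge> 2 * cmod w" using w by (intro dbl) simp
    thus ?case using w by auto
  qed (use that in auto)
  define U where "U = ball Infty (d R)"
  have "(R\<^sup>2 - 1) / (R\<^sup>2 + 1) < 1" by (simp add: divide_simps add_nonneg_pos)
  moreover have "-1 \<le> (R\<^sup>2 - 1) / (R\<^sup>2 + 1)"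
    using add_nonneg_pos[OF zero_le_power2 zero_less_one, of R] by (simp add: divide_simps)
  ultimately have "arccos 1 < d R" unfolding d_def by (subst arccos_less_mono) auto
  hence "Infty \<in> U" by (simp add: U_def)
  have "uniform_limit U (\<lambda>n. sphere_map p ^^ n) (\<lambda>_. Infty) sequentially"
  proof (rule uniform_limitI)
    fix e :: real assume "e > 0"
    define e' where "e' = min e pi"
    have e': "0 < e'" "e' \<le> pi" "e' \<le> e" using \<open>e > 0\<close> by (auto simp: e'_def)
    have "cos e' < 1" using cos_monotone_0_pi[of 0 e'] e' by simp
    moreover have "(\<lambda>n. ((2 ^ n * R)\<^sup>2 - 1) / ((2 ^ n * R)\<^sup>2 + 1)) \<longlonglongrightarrow> 1"
      using R by real_asymp
    ultimately have ev: "\<forall>\<^sub>F n in sequentially. cos e' < ((2 ^ n * R)\<^sup>2 - 1) / ((2 ^ n * R)\<^sup>2 + 1)"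
      by (intro order_tendstoD(1))
    show "\<forall>\<^sub>F n in sequentially. \<forall>x\<in>U. dist ((sphere_map p ^^ n) x) Infty < e"
      using ev
    proof eventually_elim
      case (elim n)
      have "((2 ^ n * R)\<^sup>2 - 1) / ((2 ^ n * R)\<^sup>2 + 1) \<le> 1"
        by (simp add: divide_le_eq_1 add_nonneg_pos)
      hence less: "arccos (((2 ^ n * R)\<^sup>2 - 1) / ((2 ^ n * R)\<^sup>2 + 1)) < e'"
        using arccos_less_arccos[OF cos_ge_minus_one elim] e' arccos_cos[of e'] by simp
      show ?case
      proof
        fix x assume x: "x \<in> U"
        show "dist ((sphere_map p ^^ n) x) Infty < e"
        proof (cases x)
          case (Fin z)
          hence "cmod z > R"
            using x R dist_Infty_less_iff[of R z] by (simp add: U_def d_def dist_commute)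
          then obtain w where w: "(sphere_map p ^^ n) x = Fin w" "cmod w \<ge> 2 ^ n * R"
            using fin_pow Fin by blast
          have "\<not> dist (Fin z') Infty > arccos (((2 ^ n * R)\<^sup>2 - 1) / ((2 ^ n * R)\<^sup>2 + 1))"
            if "cmod z' \<ge> 2 ^ n * R" for z'
            using that R dist_Infty_less_iff[of "cmod z'" "of_real (2 ^ n * R)"]
            by (auto simp: dist_Fin_Infty norm_mult norm_power)
          thus ?thesis using w less e' by fastforce
        qed (use \<open>e > 0\<close> inf_pow in simp)
      qed
    qed
  qed
  hence "normal_family_on U (range (\<lambda>n. sphere_map p ^^ n))"
    by (rule uniform_limit_imp_normal_family)
  thus ?thesis
    using \<open>Infty \<in> U\<close> unfolding julia_set_def fatou_set_def U_def by blast
qed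

end

theory Submission
  imports Defs
begin

text \<open>
Write \<open>s = (z\<^sup>2 - 1)\<^sup>2\<close> and consider the polynomial \<open>p(z) = s (\<lambda> (s - 1) + v)\<close> of degree 8, with a
huge constant \<open>\<lambda>\<close> and a real parameter \<open>v\<close> near \<open>\<surd>2\<close>. The points 1 and 0 are critical, and
\<open>1 \<mapsto> 0 \<mapsto> v\<close>. Because the critical value \<open>p(1) = 0\<close> is itself critical, every derivative
\<open>(p\<^sup>n)'(p(1))\<close> vanishes, so 1 is not Collet-Eckmann. Hence RCE fails as soon as 1 is recurrent and
lies in the Julia set, and it remains to choose \<open>v\<close> such that this happens and the preimages of
small balls nevertheless shrink exponentially.

Why they shrink. As \<open>\<lambda>\<close> is huge, a point that stays in the disc of radius 2 is near one of
\<open>0, \<plusminus>1, \<plusminus>\<surd>2\<close> at each time (\<open>in_piece\<close>). Near \<open>\<plusminus>\<surd>2\<close> the map expands by a factor of order \<open>\<lambda>\<close>;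
expansion is lost only at the folds near \<open>\<plusminus>1\<close> and 0. A connected set that passes these folds and
then reaches distance \<open>D\<close> from \<open>v\<close> has had its diameter multiplied by at least a constant times
\<open>D powr (3/4)\<close> (\<open>passage_0\<close>, \<open>passage_1\<close>; the exponent reflects the local degree 4 of \<open>p \<circ> p\<close> at 1).
Afterwards it shadows the orbit of \<open>v\<close>. While it does, its distance from that orbit and its
diameter are multiplied by comparable factors, and shadowing ends only when the distance is no
longer small. So the diameter gains about \<open>1/D\<close>, and fold and shadowing together gain
\<open>D powr (-1/4)\<close>, which outweighs the distortion constants if the orbit of \<open>v\<close> expands
exponentially and approaches the critical points slowly (\<open>binding\<close>). If time runs out before
shadowing ends, then \<open>D\<close>, and with it the set, was exponentially small from the start. An induction
on time then bounds the diameter of every connected set whose first \<open>n\<close> images stay in the disc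
(\<open>shrink\<close>). The geometric input is an elementary estimate for the square map on connected sets
(\<open>square_spread\<close>).

Why such a \<open>v\<close> exists. The itinerary of \<open>v\<close> is prescribed by words over four letters, one for each
of the real positions near \<open>\<surd>2\<close>, \<open>-\<surd>2\<close>, 1 and 0. Each visit to the folds is followed by a copy of
the beginning of the itinerary, of some length \<open>m\<close>; these lengths are unbounded, which makes 1
recurrent. The copy ends by a deviation at time \<open>m\<close>, so the visit cannot be deeper than
\<open>C powr (-m)\<close>, and before it the orbit spends a far longer time near \<open>-\<surd>2\<close>, so that all losses
together remain a small part of the gain.
For finite words a parameter \<open>v\<close> is obtained from the intermediate value theorem, applied to a
composition of real inverse branches (\<open>real_orbit_of_word\<close>), and compactness gives one \<open>v\<close> for all
words.
\<close>

section \<open>The family and its expansion away from the folds\<close>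

text \<open>
  A sixteenth power makes the roots of \<open>lam\<close> that occur below integral powers of 1000. What matters is
  that a small root of \<open>lam\<close> still exceeds the distortion constants of one iteration, such as 130 in
  \<open>binding\<close>.
\<close>

definition lam :: real where "lam = 1000 ^ 16"

lemma lam_ge: "lam \<ge> 10000000000" by (simp add: lam_def)
lemma lam_pos: "lam > 0" by (simp add: lam_def)

definition fam :: "'a::real_normed_field \<Rightarrow> 'a \<Rightarrow> 'a" where
  "fam v z = (z\<^sup>2 - 1)\<^sup>2 * (of_real lam * ((z\<^sup>2 - 1)\<^sup>2 - 1) + v)"

lemma fam_diff:
  "fam v z - fam v w =
     (z - w) * (z + w) * (z\<^sup>2 + w\<^sup>2 - 2) * (of_real lam * ((z\<^sup>2 - 1)\<^sup>2 + (w\<^sup>2 - 1)\<^sup>2 - 1) + v)"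
  unfolding fam_def by algebra

lemma fam_simps [simp]: "fam v 0 = v" "fam v 1 = 0"
  by (simp_all add: fam_def)

lemma fam_of_real: "fam (of_real v) (of_real x) = (of_real (fam v x) :: 'a::real_normed_field)"
  by (simp add: fam_def)

text \<open>Seven quarters lies above \<open>\<surd>2\<close> and below 2: the Julia set is confined to the smaller disc, while the
  estimates below hold on the larger one. The gap leaves room for small balls around Julia points.\<close>

lemma fam_escape:
  fixes v z :: "'a::real_normed_field"
  assumes v: "norm v \<le> 2" and z: "norm z \<ge> 7/4"
  shows "norm (fam v z) \<ge> 2 * norm z"
proof -
  define s where "s = (z\<^sup>2 - 1)\<^sup>2"
  have a: "(norm z)\<^sup>2 - 1 \<le> norm (z\<^sup>2 - 1)"
    using norm_triangle_ineq2[of "z\<^sup>2" 1] by (simp add: norm_power)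
  have b: "(norm z)\<^sup>2 \<ge> 7/4 * norm z"
    using mult_right_mono[OF z, of "norm z"] by (simp add: power2_eq_square)
  have c: "norm (z\<^sup>2 - 1) \<ge> norm z" "norm (z\<^sup>2 - 1) \<ge> 33/16" using a b z by linarith+
  have d: "norm s \<ge> norm (z\<^sup>2 - 1)"
    using mult_right_mono[of 1 "norm (z\<^sup>2-1)" "norm (z\<^sup>2-1)"] c
    by (simp add: s_def norm_power) (simp add: power2_eq_square)
  have "norm (s - 1) \<ge> 1" using norm_triangle_ineq2[of s 1] c d by simp
  hence "lam * norm (s - 1) \<ge> lam * 1" using lam_pos by (intro mult_left_mono) auto
  moreover have "norm (of_real lam * (s - 1) + v) \<ge> lam * norm (s - 1) - norm v"
    using norm_diff_ineq[of "of_real lam * (s - 1)" v] lam_pos by (simp add: norm_mult)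
  ultimately have "norm (of_real lam * (s - 1) + v) \<ge> 2" using v lam_ge by linarith
  hence "norm s * norm (of_real lam * (s - 1) + v) \<ge> norm z * 2"
    using c d by (intro mult_mono) auto
  thus ?thesis by (simp add: fam_def s_def[symmetric] norm_mult)
qed

text \<open>
  For \<open>c = 0, 1, 2\<close> these are neighbourhoods of \<open>{0}\<close>, \<open>{1, -1}\<close> and \<open>{\<surd>2, -\<surd>2}\<close>. Working with
  \<open>z\<^sup>2\<close> avoids distinguishing the two signs.
\<close>

definition piece :: "'a::real_normed_field \<Rightarrow> 'a set" where
  "piece c = {z. norm (z\<^sup>2 - c) \<le> 1/100}"

lemma small_factor:
  fixes a b :: "'a::real_normed_field"
  assumes ab: "norm a * norm b \<le> e" and d: "norm (a - b) \<ge> 1"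
  shows "norm a \<le> 2 * e \<or> norm b \<le> 2 * e"
proof (cases "norm a \<ge> 1/2")
  case True
  have "1/2 * norm b \<le> norm a * norm b" by (intro mult_right_mono True) auto
  thus ?thesis using ab by simp
next
  case False
  have "norm b \<ge> 1/2" using d False norm_triangle_ineq4[of a b] by linarith
  hence "norm a * (1/2) \<le> norm a * norm b" by (intro mult_left_mono) auto
  thus ?thesis using ab by simp
qed

text \<open>A bounded value forces \<open>s (s - 1)\<close> to be of order \<open>1/\<lambda>\<close>, so \<open>s\<close> is near 0 or near 1; in the second
  case \<open>s - 1 = z\<^sup>2 (z\<^sup>2 - 2)\<close> splits once more.\<close>

lemma in_piece:
  fixes v z :: "'a::real_normed_field"
  assumes v: "norm v \<le> 2" and z: "norm z \<le> 2" and f: "norm (fam v z) \<le> 2"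
  shows "z \<in> piece 0 \<or> z \<in> piece 1 \<or> z \<in> piece 2"
proof -
  define s where "s = (z\<^sup>2 - 1)\<^sup>2"
  have z2: "norm (z\<^sup>2) \<le> 4" using power_mono[OF z, of 2] by (simp add: norm_power)
  have y: "norm (z\<^sup>2 - 1) \<le> 5" using norm_triangle_ineq4[of "z\<^sup>2" 1] z2 by simp
  have s: "norm s \<le> 25" using power_mono[OF y, of 2] by (simp add: norm_power s_def)
  have "fam v z - s * v = of_real lam * (s * (s - 1))"
    by (simp add: fam_def s_def[symmetric] algebra_simps)
  hence "lam * (norm s * norm (s - 1)) = norm (fam v z - s * v)"
    using lam_pos by (simp add: norm_mult)
  also have "\<dots> \<le> 2 + 25 * 2"
    using norm_triangle_ineq4[of "fam v z" "s * v"] f mult_mono[OF s v] by (simp add: norm_mult)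
  finally have "norm s * norm (s - 1) \<le> 52 / lam" using lam_pos by (simp add: field_simps)
  also have "52 / lam \<le> 1/10^6" using lam_ge lam_pos by (simp add: field_simps)
  finally have "norm s * norm (s - 1) \<le> 1/10^6" .
  from small_factor[OF this] have "norm s \<le> 2/10^6 \<or> norm (s - 1) \<le> 2/10^6" by simp
  thus ?thesis
  proof
    assume "norm s \<le> 2/10^6"
    hence "(norm (z\<^sup>2 - 1))\<^sup>2 \<le> (1/100)\<^sup>2" by (simp add: s_def norm_power power_divide)
    hence "norm (z\<^sup>2 - 1) \<le> 1/100" by (rule power2_le_imp_le) simp
    thus ?thesis by (simp add: piece_def)
  next
    assume "norm (s - 1) \<le> 2/10^6"
    moreover have "s - 1 = z\<^sup>2 * (z\<^sup>2 - 2)" unfolding s_def by algebra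
    ultimately have "norm (z\<^sup>2) * norm (z\<^sup>2 - 2) \<le> 2/10^6" by (simp add: norm_mult)
    from small_factor[OF this] show ?thesis by (auto simp: piece_def)
  qed
qed

text \<open>The last factor of \<open>fam_diff\<close> is nearly \<open>\<plusminus>\<lambda>\<close> when both values of \<open>s\<close> are near the same point of
  \<open>{0, 1}\<close>; hence near the pieces the distances change like those under \<open>z \<mapsto> (z\<^sup>2 - 1)\<^sup>2\<close>, up to the scale \<open>\<lambda>\<close>.\<close>

lemma fam_factor_bounds:
  fixes v z w c :: "'a::real_normed_field"
  assumes v: "norm v \<le> 2" and c: "norm (s - c) + norm (t - c) \<le> 1/12" "c = 0 \<or> c = 1"
  shows "9/10 * lam \<le> norm (of_real lam * (s + t - 1) + v)"
    "norm (of_real lam * (s + t - 1) + v) \<le> 11/10 * lam"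
proof -
  define e where "e = 2 * c - 1"
  have e: "norm e = 1" using c(2) by (auto simp: e_def)
  define r where "r = of_real lam * ((s - c) + (t - c)) + v"
  have "norm r \<le> norm (of_real lam * ((s - c) + (t - c))) + norm v"
    unfolding r_def by (rule norm_triangle_ineq)
  also have "\<dots> \<le> lam * (1/12) + 2"
    using norm_triangle_ineq[of "s - c" "t - c"] c v lam_pos
    by (auto simp: norm_mult intro!: add_mono mult_left_mono)
  also have "\<dots> \<le> lam / 10" using lam_ge by simp
  finally have r: "norm r \<le> lam / 10" .
  have eq: "of_real lam * (s + t - 1) + v = of_real lam * e + r"
    by (simp add: r_def e_def algebra_simps)
  have n: "norm (of_real lam * e) = lam" using e lam_pos by (simp add: norm_mult)
  show "9/10 * lam \<le> norm (of_real lam * (s + t - 1) + v)"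
    using norm_diff_ineq[of "of_real lam * e" r] r n unfolding eq by simp
  show "norm (of_real lam * (s + t - 1) + v) \<le> 11/10 * lam"
    using norm_triangle_ineq[of "of_real lam * e" r] r n unfolding eq by simp
qed

lemma piece_s:
  fixes z c :: "'a::real_normed_field"
  assumes "z \<in> piece c" "c = 0 \<or> c = 1 \<or> c = 2"
  shows "norm ((z\<^sup>2 - 1)\<^sup>2 - (if c = 1 then 0 else 1)) \<le> 1/40"
proof (cases "c = 1")
  case True
  hence "norm (z\<^sup>2 - 1) \<le> 1/100" using assms by (simp add: piece_def)
  from power_mono[OF this, of 2] show ?thesis using True by (simp add: norm_power power_divide)
next
  case False
  have eq: "(z\<^sup>2 - 1)\<^sup>2 - 1 = z\<^sup>2 * (z\<^sup>2 - 2)" by algebra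
  have "norm (z\<^sup>2) * norm (z\<^sup>2 - 2) \<le> 1/40"
  proof (cases "c = 0")
    case True
    hence a: "norm (z\<^sup>2) \<le> 1/100" using assms by (simp add: piece_def)
    moreover have "norm (z\<^sup>2 - 2) \<le> 201/100" using a norm_triangle_ineq4[of "z\<^sup>2" 2] by simp
    ultimately have "norm (z\<^sup>2) * norm (z\<^sup>2 - 2) \<le> 1/100 * (201/100)" by (intro mult_mono) auto
    thus ?thesis by simp
  next
    case c: False
    hence a: "norm (z\<^sup>2 - 2) \<le> 1/100" using assms False by (auto simp: piece_def)
    moreover have "norm (z\<^sup>2) \<le> 201/100" using a norm_triangle_ineq[of "z\<^sup>2 - 2" 2] by simp
    ultimately have "norm (z\<^sup>2) * norm (z\<^sup>2 - 2) \<le> 201/100 * (1/100)" by (intro mult_mono) auto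
    thus ?thesis by simp
  qed
  thus ?thesis using False by (simp add: eq norm_mult)
qed

lemma piece_factor:
  fixes v z w c :: "'a::real_normed_field"
  assumes v: "norm v \<le> 2" and zw: "z \<in> piece c" "w \<in> piece c" and c: "c = 0 \<or> c = 1 \<or> c = 2"
  shows "9/10 * lam \<le> norm (of_real lam * ((z\<^sup>2 - 1)\<^sup>2 + (w\<^sup>2 - 1)\<^sup>2 - 1) + v)"
    "norm (of_real lam * ((z\<^sup>2 - 1)\<^sup>2 + (w\<^sup>2 - 1)\<^sup>2 - 1) + v) \<le> 11/10 * lam"
proof -
  have "norm ((z\<^sup>2 - 1)\<^sup>2 - (if c = 1 then 0 else 1)) + norm ((w\<^sup>2 - 1)\<^sup>2 - (if c = 1 then 0 else 1)) \<le> 1/12"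
    using piece_s[OF zw(1) c] piece_s[OF zw(2) c] by linarith
  from fam_factor_bounds[OF v this]
  show "9/10 * lam \<le> norm (of_real lam * ((z\<^sup>2 - 1)\<^sup>2 + (w\<^sup>2 - 1)\<^sup>2 - 1) + v)"
    "norm (of_real lam * ((z\<^sup>2 - 1)\<^sup>2 + (w\<^sup>2 - 1)\<^sup>2 - 1) + v) \<le> 11/10 * lam"
    by auto
qed

lemma piece_size:
  fixes z :: "'a::real_normed_field"
  shows "z \<in> piece 0 \<Longrightarrow> norm z \<le> 1/10" "z \<in> piece 0 \<Longrightarrow> norm (z\<^sup>2 - 1) \<ge> 9/10"
    "z \<in> piece 0 \<Longrightarrow> norm (z\<^sup>2 - 1) \<le> 11/10" "z \<in> piece 0 \<Longrightarrow> norm (z\<^sup>2 - 2) \<le> 3"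
    "z \<in> piece 0 \<Longrightarrow> norm (z\<^sup>2 - 2) \<ge> 1"
    "z \<in> piece 1 \<Longrightarrow> norm z \<ge> 9/10" "z \<in> piece 1 \<Longrightarrow> norm z \<le> 3/2"
    "z \<in> piece 2 \<Longrightarrow> norm z \<ge> 7/5" "z \<in> piece 2 \<Longrightarrow> norm z \<le> 3/2"
    "z \<in> piece 2 \<Longrightarrow> norm (z\<^sup>2 - 1) \<ge> 9/10" "z \<in> piece 2 \<Longrightarrow> norm (z\<^sup>2 - 1) \<le> 11/10"
proof -
  have up: "norm z \<le> r" if "norm (z\<^sup>2) \<le> r\<^sup>2" "r \<ge> 0" for r
    using that by (simp add: norm_power) 
  have lo: "norm z \<ge> r" if "norm (z\<^sup>2) \<ge> r\<^sup>2" for r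
    using that by (metis norm_power norm_ge_zero power2_le_imp_le)
  {
    assume "z \<in> piece 0"
    hence a: "norm (z\<^sup>2) \<le> 1/100" by (simp add: piece_def)
    show "norm z \<le> 1/10" by (rule up) (use a in \<open>auto simp: power_divide\<close>)
    show "norm (z\<^sup>2 - 1) \<ge> 9/10" "norm (z\<^sup>2 - 1) \<le> 11/10"
      using norm_triangle_ineq4[of "z\<^sup>2" 1] norm_triangle_ineq3[of "z\<^sup>2" 1] a by auto
    show "norm (z\<^sup>2 - 2) \<ge> 1" "norm (z\<^sup>2 - 2) \<le> 3"
      using norm_triangle_ineq4[of "z\<^sup>2" 2] norm_triangle_ineq3[of "z\<^sup>2" 2] a by auto
  next
    assume "z \<in> piece 1"
    hence "norm (z\<^sup>2 - 1) \<le> 1/100" by (simp add: piece_def)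
    hence a: "norm (z\<^sup>2) \<le> 101/100" "norm (z\<^sup>2) \<ge> 99/100"
      using norm_triangle_ineq[of "z\<^sup>2 - 1" 1] norm_triangle_ineq3[of "z\<^sup>2" 1] by auto
    show "norm z \<ge> 9/10" by (rule lo) (use a in \<open>auto simp: power_divide\<close>)
    show "norm z \<le> 3/2" by (rule up) (use a in \<open>auto simp: power_divide\<close>)
  next
    assume "z \<in> piece 2"
    hence b: "norm (z\<^sup>2 - 2) \<le> 1/100" by (simp add: piece_def)
    hence a: "norm (z\<^sup>2) \<le> 201/100" "norm (z\<^sup>2) \<ge> 199/100"
      using norm_triangle_ineq[of "z\<^sup>2 - 2" 2] norm_triangle_ineq3[of "z\<^sup>2" 2] by auto
    show "norm z \<ge> 7/5" by (rule lo) (use a in \<open>auto simp: power_divide\<close>)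
    show "norm z \<le> 3/2" by (rule up) (use a in \<open>auto simp: power_divide\<close>)
    show "norm (z\<^sup>2 - 1) \<ge> 9/10" "norm (z\<^sup>2 - 1) \<le> 11/10"
      using norm_triangle_ineq[of "z\<^sup>2 - 2" 1] norm_diff_ineq[of 1 "z\<^sup>2 - 2"] b
      by (auto simp: algebra_simps)
  }
qed

text \<open>The values of \<open>Re (z\<^sup>2)\<close> on the three pieces are separated, and they fill an interval on a connected set.\<close>

lemma connected_in_piece:
  fixes v :: complex
  assumes X: "connected X" and v: "norm v \<le> 2"
    and b: "\<And>z. z \<in> X \<Longrightarrow> norm z \<le> 2" "\<And>z. z \<in> X \<Longrightarrow> norm (fam v z) \<le> 2"
  obtains c where "c = 0 \<or> c = 1 \<or> c = 2" "X \<subseteq> piece c"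
proof (cases "X = {}")
  case False
  then obtain x where x: "x \<in> X" by auto
  have conn: "connected ((\<lambda>z. Re (z\<^sup>2)) ` X)"
    by (intro connected_continuous_image continuous_intros X)
  have cov: "\<And>z. z \<in> X \<Longrightarrow> z \<in> piece 0 \<or> z \<in> piece 1 \<or> z \<in> piece 2" using b in_piece[OF v] by blast
  have re: "\<bar>Re (z\<^sup>2) - c\<bar> \<le> 1/100" if "z \<in> piece (of_real c)" for z c
    using abs_Re_le_cmod[of "z\<^sup>2 - of_real c"] that by (simp add: piece_def)
  have "y \<in> piece c" if xc: "x \<in> piece c" "c \<in> {0,1,2}" and yX: "y \<in> X" for c y
  proof (rule ccontr)
    assume "y \<notin> piece c"
    then obtain c' where c': "c' \<in> {0,1,2}" "c' \<noteq> c" "y \<in> piece c'" using cov[OF yX] by blast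
    define a b where "a = Re c" and "b = Re c'"
    have ab: "c = of_real a" "c' = of_real b" "a \<in> {0,1,2}" "b \<in> {0,1,2}" "a \<noteq> b"
      using xc c' by (auto simp: a_def b_def)
    have r: "\<bar>Re (x\<^sup>2) - a\<bar> \<le> 1/100" "\<bar>Re (y\<^sup>2) - b\<bar> \<le> 1/100" using re xc c' ab by auto
    have "(Re (x\<^sup>2) \<le> 1/2 \<and> 1/2 \<le> Re (y\<^sup>2) \<or> Re (y\<^sup>2) \<le> 1/2 \<and> 1/2 \<le> Re (x\<^sup>2)) \<or>
        (Re (x\<^sup>2) \<le> 3/2 \<and> 3/2 \<le> Re (y\<^sup>2) \<or> Re (y\<^sup>2) \<le> 3/2 \<and> 3/2 \<le> Re (x\<^sup>2))"
      using r ab(3-5) unfolding abs_le_iff insert_iff empty_iff by argo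
    then obtain t where t: "t \<in> {1/2, 3/2}"
      "Re (x\<^sup>2) \<le> t \<and> t \<le> Re (y\<^sup>2) \<or> Re (y\<^sup>2) \<le> t \<and> t \<le> Re (x\<^sup>2)" by blast
    have "t \<in> (\<lambda>z. Re (z\<^sup>2)) ` X"
      using conn[unfolded connected_iff_interval] t(2) x yX by blast
    then obtain z where z: "z \<in> X" "t = Re (z\<^sup>2)" by blast
    have "\<bar>t - 0\<bar> \<le> 1/100 \<or> \<bar>t - 1\<bar> \<le> 1/100 \<or> \<bar>t - 2\<bar> \<le> 1/100"
      using cov[OF z(1)] re[of z 0] re[of z 1] re[of z 2] z by auto
    thus False using t(1) by (auto simp: abs_le_iff)
  qed
  thus ?thesis using cov[OF x] that by blast
qed (use that in auto)

text \<open>This plays the role of a distortion theorem for the square map, which is branched at 0. Fix \<open>z\<close> in \<open>X\<close> and put \<open>h = norm z\<close>. If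
  \<open>h\<^sup>2 > d\<close>, no point of \<open>X\<close> can be equidistant from \<open>z\<close> and \<open>-z\<close>, since there both factors of
  \<open>w\<^sup>2 - z\<^sup>2\<close> are at least \<open>h\<close>. So the connected set \<open>X\<close> stays on the side of \<open>z\<close>, where
  \<open>norm (w + z) \<ge> h\<close>. If \<open>h\<^sup>2 \<le> d\<close>, all of \<open>X\<close> lies within \<open>sqrt (2 * d)\<close> of 0.\<close>

lemma square_spread:
  fixes X :: "'a::real_normed_field set"
  assumes X: "connected X" and d: "\<And>x y. x \<in> X \<Longrightarrow> y \<in> X \<Longrightarrow> norm (x\<^sup>2 - y\<^sup>2) \<le> d"
    and z: "z \<in> X" and xy: "x \<in> X" "y \<in> X"
  shows "norm z * norm (x - y) \<le> 3 * d"
proof -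
  define h where "h = norm z"
  have d0: "d \<ge> 0" using d[OF z z] by simp
  have fac: "norm (w - z) * norm (w + z) \<le> d" if "w \<in> X" for w
    using d[OF that z] by (simp add: norm_mult[symmetric] power2_eq_square algebra_simps)
  show ?thesis
  proof (cases "h\<^sup>2 > d")
    case True
    hence h: "h > 0" using d0 by (auto simp: h_def)
    have tri: "2 * h \<le> norm (w - z) + norm (w + z)" for w
      using norm_triangle_ineq4[of "w + z" "w - z"] by (simp add: h_def norm_mult)
    define f where "f w = norm (w + z) - norm (w - z)" for w
    have "connected (f ` X)" unfolding f_def
      by (intro connected_continuous_image continuous_intros X)
    moreover have "0 \<notin> f ` X"
    proof
      assume "0 \<in> f ` X"
      then obtain w where w: "w \<in> X" "norm (w + z) = norm (w - z)" by (auto simp: f_def)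
      hence "norm (w - z) \<ge> h" using tri[of w] by simp
      hence "h * h \<le> norm (w - z) * norm (w + z)" using w h by (intro mult_mono) auto
      thus False using fac[OF w(1)] True by (simp add: power2_eq_square)
    qed
    moreover have "f z \<in> f ` X" "f z > 0"
      using z h norm_mult[of 2 z] by (simp, simp add: f_def h_def)
    ultimately have pos: "f w > 0" if "w \<in> X" for w
      using that unfolding connected_iff_interval
      by (metis imageI linorder_not_less less_eq_real_def)
    have near: "norm (w - z) \<le> d / h" if "w \<in> X" for w
    proof -
      have "norm (w + z) \<ge> h" using pos[OF that] tri[of w] by (simp add: f_def)
      hence "norm (w - z) * h \<le> norm (w - z) * norm (w + z)" by (intro mult_left_mono) auto
      thus ?thesis using fac[OF that] h by (simp add: field_simps)
    qed
    have "norm (x - y) \<le> d / h + d / h"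
      using near[OF xy(1)] near[OF xy(2)] norm_triangle_ineq4[of "x - z" "y - z"] by simp
    hence "norm (x - y) * h \<le> 2 * d" using h by (simp add: field_simps)
    thus ?thesis using d0 by (simp add: h_def mult.commute)
  next
    case False
    have b: "norm w \<le> sqrt (2 * d)" if "w \<in> X" for w
    proof (rule real_le_rsqrt)
      show "(norm w)\<^sup>2 \<le> 2 * d"
        using d[OF that z] norm_triangle_ineq[of "w\<^sup>2 - z\<^sup>2" "z\<^sup>2"] False
        by (simp add: norm_power h_def)
    qed
    have "norm (x - y) \<le> 2 * sqrt (2 * d)"
      using b[OF xy(1)] b[OF xy(2)] norm_triangle_ineq4[of x y] by simp
    moreover have "h \<le> sqrt d" using False by (intro real_le_rsqrt) auto
    ultimately have "h * norm (x - y) \<le> sqrt d * (2 * sqrt (2 * d))"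
      using d0 by (intro mult_mono) (auto simp: h_def)
    also have "\<dots> = 2 * sqrt 2 * d" using d0 by (simp add: real_sqrt_mult)
    also have "\<dots> \<le> 3 * d"
      using d0 real_le_lsqrt[of "3/2" 2] by (intro mult_right_mono) (auto simp: power2_eq_square)
    finally show ?thesis by (simp add: h_def)
  qed
qed

text \<open>Apply \<open>square_spread\<close> to both squarings in \<open>(z\<^sup>2 - 1)\<^sup>2\<close>; the witnesses \<open>z0\<close> and \<open>z1\<close> may be any
  points of \<open>X\<close>, so a single point far from the critical points makes the whole set expand.\<close>

lemma piece_expansion:
  fixes X :: "'a::real_normed_field set"
  assumes X: "connected X" "X \<subseteq> piece c" and c: "c = 0 \<or> c = 1 \<or> c = 2" and v: "norm v \<le> 2"
    and d: "\<And>x y. x \<in> X \<Longrightarrow> y \<in> X \<Longrightarrow> norm (fam v x - fam v y) \<le> d"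
    and z: "z0 \<in> X" "z1 \<in> X" and xy: "x \<in> X" "y \<in> X"
  shows "lam / 10 * norm z0 * norm (z1\<^sup>2 - 1) * norm (x - y) \<le> d"
proof -
  define Y where "Y = (\<lambda>z. z\<^sup>2 - 1) ` X"
  have Y: "connected Y" unfolding Y_def by (intro connected_continuous_image continuous_intros X)
  have 1: "norm (p\<^sup>2 - q\<^sup>2) \<le> d / (9/10 * lam)" if pq: "p \<in> Y" "q \<in> Y" for p q
  proof -
    obtain a b where ab: "a \<in> X" "b \<in> X" "p = a\<^sup>2 - 1" "q = b\<^sup>2 - 1" using pq by (auto simp: Y_def)
    have "fam v a - fam v b = (p\<^sup>2 - q\<^sup>2) * (of_real lam * (p\<^sup>2 + q\<^sup>2 - 1) + v)"
      unfolding ab fam_def by algebra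
    hence "norm (p\<^sup>2 - q\<^sup>2) * norm (of_real lam * (p\<^sup>2 + q\<^sup>2 - 1) + v) \<le> d"
      using d[OF ab(1,2)] by (simp add: norm_mult)
    moreover have "norm (p\<^sup>2 - q\<^sup>2) * (9/10 * lam) \<le>
        norm (p\<^sup>2 - q\<^sup>2) * norm (of_real lam * (p\<^sup>2 + q\<^sup>2 - 1) + v)"
      using piece_factor(1)[OF v _ _ c, of a b] ab X(2) by (intro mult_left_mono) auto
    ultimately show ?thesis using lam_pos by (simp add: field_simps)
  qed
  have "norm (z1\<^sup>2 - 1) * norm (p - q) \<le> 3 * (d / (9/10 * lam))" if "p \<in> Y" "q \<in> Y" for p q
    by (rule square_spread[OF Y 1 _ that]) (use z in \<open>auto simp: Y_def\<close>)
  note 2 = this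
  have 2: "norm (z1\<^sup>2 - 1) * norm (a\<^sup>2 - b\<^sup>2) \<le> 3 * (d / (9/10 * lam))" if "a \<in> X" "b \<in> X" for a b
    using 2[of "a\<^sup>2 - 1" "b\<^sup>2 - 1"] that by (simp add: Y_def)
  have d0: "d \<ge> 0" using d[OF z(1) z(1)] by simp
  show ?thesis
  proof (cases "z1\<^sup>2 - 1 = 0")
    case False
    hence n: "norm (z1\<^sup>2 - 1) > 0" by simp
    have 3: "norm (a\<^sup>2 - b\<^sup>2) \<le> 3 * (d / (9/10 * lam)) / norm (z1\<^sup>2 - 1)"
      if "a \<in> X" "b \<in> X" for a b
      using 2[OF that] n by (simp only: pos_le_divide_eq mult.commute)
    have "norm z0 * norm (x - y) \<le> 3 * (3 * (d / (9/10 * lam)) / norm (z1\<^sup>2 - 1))"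
      by (rule square_spread[OF X(1) 3 z(1) xy])
    thus ?thesis using n lam_pos by (simp add: field_simps)
  qed (use d0 in simp)
qed

section \<open>Expansion compared along two orbits, and passages through the folds\<close>

lemma piece_size_upper:
  fixes w :: "'a::real_normed_field"
  assumes "w \<in> piece c" "c = 0 \<or> c = 1 \<or> c = 2"
  shows "norm w \<le> 3/2" "norm (w\<^sup>2 - 1) \<le> 11/10"
proof -
  have "norm (w\<^sup>2 - 1) \<le> 1/100" if "w \<in> piece 1" using that by (simp add: piece_def)
  thus "norm w \<le> 3/2" "norm (w\<^sup>2 - 1) \<le> 11/10"
    using assms piece_size[of w] by force+
qed

text \<open>
  Up to constants and the scale \<open>\<lambda>\<close> this is the modulus of the derivative of \<^term>\<open>fam v\<close> on the pieces, and it
  measures the distance to the critical points 0, 1 and -1.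
\<close>

definition crit_dist :: "'a::real_normed_field \<Rightarrow> real" where
  "crit_dist w = norm w * norm (w\<^sup>2 - 1)"

lemma crit_dist_nonneg: "crit_dist w \<ge> 0" by (simp add: crit_dist_def)

text \<open>Within a thousandth of \<^const>\<open>crit_dist\<close>, every factor of \<open>fam_diff\<close> is comparable to its value at
  \<open>w\<close>. The last two conclusions say that \<open>z\<close> is then a good witness for \<open>piece_expansion\<close>.\<close>

lemma near_distortion:
  fixes v w z c :: "'a::real_normed_field"
  assumes v: "norm v \<le> 2" and w: "w \<in> piece c" and c: "c = 0 \<or> c = 1 \<or> c = 2"
    and near: "norm (z - w) \<le> crit_dist w / 1000"
  shows "norm (fam v z - fam v w) \<le> 5 * (lam * crit_dist w) * norm (z - w)"
    "norm (fam v z - fam v w) \<ge> 3 * (lam * crit_dist w) * norm (z - w)"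
    "norm z \<ge> 9/10 * norm w" "norm (z\<^sup>2 - 1) \<ge> 9/10 * norm (w\<^sup>2 - 1)"
proof -
  define A B e where "A = norm w" and "B = norm (w\<^sup>2 - 1)" and "e = norm (z - w)"
  have AB: "0 \<le> A" "A \<le> 3/2" "0 \<le> B" "B \<le> 11/10" "0 \<le> e"
    using piece_size_upper[OF w c] by (auto simp: A_def B_def e_def)
  have e: "e \<le> A * B / 1000" using near by (simp add: A_def B_def e_def crit_dist_def)
  have eA: "e \<le> A / 500" using e mult_left_mono[OF AB(4) AB(1)] AB by simp
  have 1: "norm (z + w) \<le> 201/100 * A" "norm (z + w) \<ge> 199/100 * A"
  proof -
    have eq: "z + w = 2 * w + (z - w)" by simp
    show "norm (z + w) \<le> 201/100 * A" "norm (z + w) \<ge> 199/100 * A"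
      unfolding eq using norm_triangle_ineq[of "2 * w" "z - w"] norm_diff_ineq[of "2 * w" "z - w"] eA AB
      by (simp_all add: norm_mult A_def[symmetric] e_def[symmetric])
  qed
  have "norm (z\<^sup>2 - w\<^sup>2) = e * norm (z + w)"
    by (simp add: e_def norm_mult[symmetric] power2_eq_square algebra_simps)
  also have "\<dots> \<le> A * B / 1000 * (201/100 * (3/2))"
    using e 1 AB by (intro mult_mono) auto
  also have "\<dots> \<le> B / 200"
    using mult_right_mono[OF AB(2) AB(3)] AB by simp
  finally have 2: "norm (z\<^sup>2 - w\<^sup>2) \<le> B / 200" .
  have eq3: "z\<^sup>2 + w\<^sup>2 - 2 = 2 * (w\<^sup>2 - 1) + (z\<^sup>2 - w\<^sup>2)" by simp
  have "norm (2 * (w\<^sup>2 - 1)) = 2 * B" by (simp add: norm_mult B_def del: right_diff_distrib_numeral)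
  hence 3: "norm (z\<^sup>2 + w\<^sup>2 - 2) \<le> 201/100 * B" "norm (z\<^sup>2 + w\<^sup>2 - 2) \<ge> 199/100 * B"
    unfolding eq3 using norm_triangle_ineq[of "2 * (w\<^sup>2 - 1)" "z\<^sup>2 - w\<^sup>2"]
      norm_diff_ineq[of "2 * (w\<^sup>2 - 1)" "z\<^sup>2 - w\<^sup>2"] 2 AB by linarith+
  \<comment> \<open>The value of \<open>s\<close> at the exact point of the piece.\<close>
  define k :: 'a where "k = (if c = 1 then 0 else 1)"
  have t: "norm ((w\<^sup>2 - 1)\<^sup>2 - k) \<le> 1/40" using piece_s[OF w c] by (simp add: k_def)
  have eq4: "(z\<^sup>2 - 1)\<^sup>2 - k = ((w\<^sup>2 - 1)\<^sup>2 - k) + (z\<^sup>2 - w\<^sup>2) * (z\<^sup>2 + w\<^sup>2 - 2)" by algebra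
  have "norm ((z\<^sup>2 - 1)\<^sup>2 - k) \<le> 1/40 + norm (z\<^sup>2 - w\<^sup>2) * norm (z\<^sup>2 + w\<^sup>2 - 2)"
    unfolding eq4 norm_mult[symmetric]
    using norm_triangle_ineq[of "(w\<^sup>2 - 1)\<^sup>2 - k" "(z\<^sup>2 - w\<^sup>2) * (z\<^sup>2 + w\<^sup>2 - 2)"] t
    by linarith
  also have "norm (z\<^sup>2 - w\<^sup>2) * norm (z\<^sup>2 + w\<^sup>2 - 2) \<le> (11/10/200) * (201/100 * (11/10))"
    using 2 3 AB by (intro mult_mono) auto
  finally have s: "norm ((z\<^sup>2 - 1)\<^sup>2 - k) + norm ((w\<^sup>2 - 1)\<^sup>2 - k) \<le> 1/12" using t by simp
  define Q where "Q = norm (of_real lam * ((z\<^sup>2 - 1)\<^sup>2 + (w\<^sup>2 - 1)\<^sup>2 - 1) + v)"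
  have Q: "9/10 * lam \<le> Q" "Q \<le> 11/10 * lam"
    using fam_factor_bounds[OF v s] by (auto simp: Q_def k_def)
  have eq: "norm (fam v z - fam v w) = e * (norm (z + w) * norm (z\<^sup>2 + w\<^sup>2 - 2) * Q)"
    by (simp add: fam_diff norm_mult e_def Q_def)
  have "norm (z + w) * norm (z\<^sup>2 + w\<^sup>2 - 2) * Q \<le> 201/100 * A * (201/100 * B) * (11/10 * lam)"
    using 1 3 Q AB by (intro mult_mono) (auto simp: Q_def)
  also have "\<dots> \<le> 5 * (lam * (A * B))" using AB lam_pos by simp
  finally show "norm (fam v z - fam v w) \<le> 5 * (lam * crit_dist w) * norm (z - w)"
    unfolding eq e_def[symmetric] crit_dist_def A_def[symmetric] B_def[symmetric]
    by (subst mult.commute[of _ e]) (rule mult_left_mono[OF _ AB(5)])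
  have "3 * (lam * (A * B)) \<le> 199/100 * A * (199/100 * B) * (9/10 * lam)"
    using AB lam_pos by simp
  also have "\<dots> \<le> norm (z + w) * norm (z\<^sup>2 + w\<^sup>2 - 2) * Q"
    using 1 3 Q AB lam_pos by (intro mult_mono) auto
  finally show "norm (fam v z - fam v w) \<ge> 3 * (lam * crit_dist w) * norm (z - w)"
    unfolding eq e_def[symmetric] crit_dist_def A_def[symmetric] B_def[symmetric]
    by (subst mult.commute[of _ e]) (rule mult_left_mono[OF _ AB(5)])
  show "norm z \<ge> 9/10 * norm w"
  proof -
    have "norm w - norm (z - w) \<le> norm z" using norm_diff_ineq[of w "z - w"] by simp
    thus ?thesis using eA AB unfolding A_def e_def by linarith
  qed
  show "norm (z\<^sup>2 - 1) \<ge> 9/10 * norm (w\<^sup>2 - 1)"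
  proof -
    have "norm (w\<^sup>2 - 1) - norm (z\<^sup>2 - w\<^sup>2) \<le> norm (z\<^sup>2 - 1)"
      using norm_diff_ineq[of "w\<^sup>2 - 1" "z\<^sup>2 - w\<^sup>2"] by simp
    thus ?thesis using 2 AB unfolding B_def by linarith
  qed
qed

lemma continuous_on_fam [continuous_intros]:
  fixes f g :: "'b::topological_space \<Rightarrow> 'a::real_normed_field"
  assumes "continuous_on S f" "continuous_on S g"
  shows "continuous_on S (\<lambda>x. fam (f x) (g x))"
  unfolding fam_def by (intro continuous_intros assms)

lemma continuous_on_fam_iter [continuous_intros]:
  fixes f g :: "'b::topological_space \<Rightarrow> 'a::real_normed_field"
  assumes "continuous_on S f" "continuous_on S g"
  shows "continuous_on S (\<lambda>x. (fam (f x) ^^ n) (g x))"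
  by (induction n) (auto intro!: continuous_intros assms)

lemma mult_diameter_le:
  fixes X :: "'a::real_normed_vector set"
  assumes "k \<ge> 0" "d \<ge> 0" "X \<noteq> {}" "\<And>x y. x \<in> X \<Longrightarrow> y \<in> X \<Longrightarrow> k * norm (x - y) \<le> d"
  shows "k * diameter X \<le> d"
proof (cases "k = 0")
  case False
  hence "diameter X \<le> d / k"
    using assms by (intro diameter_le) (auto simp: field_simps)
  thus ?thesis using False assms(1) by (simp add: field_simps)
qed (use assms in simp)

lemma piece_expansion_diameter:
  fixes X :: "complex set"
  assumes X: "connected X" "compact X" "X \<subseteq> piece c" and c: "c = 0 \<or> c = 1 \<or> c = 2"
    and v: "norm v \<le> 2" and z: "z0 \<in> X" "z1 \<in> X"
    and k: "0 \<le> k" "k \<le> lam / 10 * norm z0 * norm (z1\<^sup>2 - 1)"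
  shows "k * diameter X \<le> diameter (fam v ` X)"
proof (rule mult_diameter_le)
  have b: "bounded (fam v ` X)"
    by (intro compact_imp_bounded compact_continuous_image continuous_intros X)
  have d: "norm (fam v x - fam v y) \<le> diameter (fam v ` X)" if "x \<in> X" "y \<in> X" for x y
    using diameter_bounded_bound[OF b] that by (auto simp: dist_norm)
  show "diameter (fam v ` X) \<ge> 0" using b by (rule diameter_ge_0)
  fix x y assume xy: "x \<in> X" "y \<in> X"
  have "k * norm (x - y) \<le> lam / 10 * norm z0 * norm (z1\<^sup>2 - 1) * norm (x - y)"
    using k by (intro mult_right_mono) auto
  also have "\<dots> \<le> diameter (fam v ` X)"
    by (rule piece_expansion[OF X(1,3) c v d z xy])
  finally show "k * norm (x - y) \<le> diameter (fam v ` X)" .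
qed (use k z in auto)

text \<open>From \<open>g ^ 4 = norm (fam v x - v)\<close>, which is about \<open>2 * lam * (norm x)\<^sup>2\<close>, one reads off how far \<open>x\<close> is
  from the critical point, hence how much \<open>X\<close> expands. The fourth power makes all exponents integral;
  the last conclusion has the exponent needed for two folds, which is weaker here since \<open>g\<close> is
  bounded.\<close>

lemma passage_0:
  fixes X :: "complex set"
  assumes X: "connected X" "compact X" "X \<subseteq> piece 0" and v: "norm v \<le> 2"
    and x: "x \<in> X" "norm (fam v x - v) = g ^ 4" and g: "0 \<le> g" "g \<le> 2"
  shows "g\<^sup>2 \<le> 2 * 1000 ^ 8 * norm x"
    "9/100 * lam * norm x * diameter X \<le> diameter (fam v ` X)"
    "g ^ 3 * 1000 ^ 7 * diameter X \<le> diameter (fam v ` X)"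
proof -
  have xp: "x \<in> piece 0" and z0: "(0::complex) \<in> piece 0" using X x by (auto simp: piece_def)
  define Q where "Q = norm (of_real lam * ((x\<^sup>2 - 1)\<^sup>2 + (0\<^sup>2 - 1)\<^sup>2 - 1) + v)"
  have Q: "Q \<le> 11/10 * lam" "0 \<le> Q" using piece_factor[OF v xp z0] by (auto simp: Q_def)
  have "g ^ 4 = norm (fam v x - fam v 0)" using x by simp
  also have "\<dots> = (norm x)\<^sup>2 * norm (x\<^sup>2 - 2) * Q"
    unfolding fam_diff norm_mult Q_def by (simp add: power2_eq_square)
  also have "\<dots> \<le> (norm x)\<^sup>2 * 3 * (11/10 * lam)"
    using piece_size(4)[OF xp] Q by (intro mult_mono) auto
  also have "\<dots> \<le> (norm x)\<^sup>2 * (4 * lam)" using lam_pos by (simp add: mult_left_mono)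
  also have "\<dots> = (2 * 1000 ^ 8 * norm x)\<^sup>2" by (simp add: lam_def power_mult_distrib)
  finally have "(g\<^sup>2)\<^sup>2 \<le> (2 * 1000 ^ 8 * norm x)\<^sup>2" by simp
  thus 1: "g\<^sup>2 \<le> 2 * 1000 ^ 8 * norm x" by (rule power2_le_imp_le) auto
  have "lam / 10 * norm x * (9/10) \<le> lam / 10 * norm x * norm (x\<^sup>2 - 1)"
    using piece_size(2)[OF xp] lam_pos by (intro mult_left_mono) auto
  thus 2: "9/100 * lam * norm x * diameter X \<le> diameter (fam v ` X)"
    using lam_pos by (intro piece_expansion_diameter[OF X _ v x(1) x(1)]) auto
  have "g ^ 3 = g * g\<^sup>2" by (simp add: power2_eq_square power3_eq_cube)
  also have "\<dots> \<le> 2 * g\<^sup>2" using g by (intro mult_right_mono) auto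
  also have "\<dots> \<le> 2 * (2 * 1000 ^ 8 * norm x)" using 1 by simp
  finally have "g ^ 3 * 1000 ^ 7 \<le> 2 * (2 * 1000 ^ 8 * norm x) * 1000 ^ 7" by (intro mult_right_mono) auto
  also have "\<dots> = 4 * 1000 ^ 15 * norm x" by simp
  also have "\<dots> \<le> 9/100 * lam * norm x" by (intro mult_right_mono) (auto simp: lam_def)
  finally have "g ^ 3 * 1000 ^ 7 \<le> 9/100 * lam * norm x" .
  hence "g ^ 3 * 1000 ^ 7 * diameter X \<le> 9/100 * lam * norm x * diameter X"
    using diameter_ge_0[OF compact_imp_bounded[OF X(2)]] by (intro mult_right_mono)
  thus "g ^ 3 * 1000 ^ 7 * diameter X \<le> diameter (fam v ` X)" using 2 by simp
qed

lemma fam_near_1: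
  fixes v x :: "'a::real_normed_field"
  assumes "norm v \<le> 2" "x \<in> piece 1"
  shows "norm (fam v x) \<le> 11/10 * lam * (norm (x\<^sup>2 - 1))\<^sup>2"
    "norm (fam v x) \<ge> 9/10 * lam * (norm (x\<^sup>2 - 1))\<^sup>2"
proof -
  have 1: "(1::'a) \<in> piece 1" by (simp add: piece_def)
  define Q where "Q = norm (of_real lam * ((x\<^sup>2 - 1)\<^sup>2 + (1\<^sup>2 - 1)\<^sup>2 - 1) + v)"
  have Q: "9/10 * lam \<le> Q" "Q \<le> 11/10 * lam" using piece_factor[OF assms(1,2) 1] by (auto simp: Q_def)
  have "norm (fam v x) = (norm (x\<^sup>2 - 1))\<^sup>2 * Q"
    by (simp add: fam_def Q_def norm_mult norm_power)
  thus "norm (fam v x) \<le> 11/10 * lam * (norm (x\<^sup>2 - 1))\<^sup>2"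
    "norm (fam v x) \<ge> 9/10 * lam * (norm (x\<^sup>2 - 1))\<^sup>2"
    using mult_left_mono[OF Q(1), of "(norm (x\<^sup>2 - 1))\<^sup>2"] mult_left_mono[OF Q(2), of "(norm (x\<^sup>2 - 1))\<^sup>2"]
    by (simp_all add: mult.commute)
qed

lemma fam_near_0:
  fixes v x :: "'a::real_normed_field"
  assumes "norm v \<le> 2" "x \<in> piece 0"
  shows "norm (fam v x - v) \<ge> 9/10 * lam * (norm x)\<^sup>2"
proof -
  have z: "(0::'a) \<in> piece 0" by (simp add: piece_def)
  have "norm (fam v x - fam v 0) = (norm x)\<^sup>2 *
      (norm (x\<^sup>2 - 2) * norm (of_real lam * ((x\<^sup>2 - 1)\<^sup>2 + (0\<^sup>2 - 1)\<^sup>2 - 1) + v))"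
    unfolding fam_diff norm_mult by (simp add: power2_eq_square)
  also have "\<dots> \<ge> (norm x)\<^sup>2 * (1 * (9/10 * lam))"
    using piece_size(5)[OF assms(2)] piece_factor(1)[OF assms(1,2) z] lam_pos
    by (intro mult_left_mono mult_mono) auto
  finally show ?thesis by (simp add: mult.commute)
qed

text \<open>The distance to \<open>v\<close> after both folds determines the distance to 0 after the first, and this the
  distance to 1 or -1 before. The two expansion factors are of order \<open>g\<close> and \<open>g\<^sup>2\<close>.\<close>

lemma passage_1:
  fixes X :: "complex set"
  assumes X: "connected X" "compact X" "X \<subseteq> piece 1" "fam v ` X \<subseteq> piece 0" and v: "norm v \<le> 2"
    and x: "x \<in> X" "norm (fam v (fam v x) - v) = g ^ 4" and g: "0 \<le> g" "g \<le> 2"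
  shows "g ^ 3 * 1000 ^ 7 * diameter X \<le> diameter (fam v ` fam v ` X)"
proof -
  define X' where "X' = fam v ` X"
  have X': "connected X'" "compact X'" "X' \<subseteq> piece 0"
    unfolding X'_def
    by (intro connected_continuous_image compact_continuous_image continuous_intros X)+
  define u b where "u = norm (fam v x)" and "b = norm (x\<^sup>2 - 1)"
  have ub: "u \<ge> 0" "b \<ge> 0" by (auto simp: u_def b_def)
  have xp: "x \<in> piece 1" using X x by auto
  note p0 = passage_0[OF X' v _ x(2) g]
  have x': "fam v x \<in> X'" using x by (auto simp: X'_def)
  have 1: "g\<^sup>2 \<le> 2 * 1000 ^ 8 * u" and 2: "9/100 * lam * u * diameter X' \<le> diameter (fam v ` X')"
    using p0[OF x'] by (auto simp: u_def)
  have 3: "u \<le> 11/10 * lam * b\<^sup>2" using fam_near_1(1)[OF v xp] by (simp add: u_def b_def)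
  have "g\<^sup>2 \<le> 2 * 1000 ^ 8 * (11/10 * lam * b\<^sup>2)" using 1 3 by simp
  also have "\<dots> \<le> (2 * 1000 ^ 12 * b)\<^sup>2" by (simp add: lam_def power_mult_distrib)
  finally have 4: "g \<le> 2 * 1000 ^ 12 * b" by (rule power2_le_imp_le) (use ub in auto)
  have "lam / 10 * (9/10) * b \<le> lam / 10 * norm x * norm (x\<^sup>2 - 1)"
    unfolding b_def using piece_size(6)[OF xp] lam_pos by (intro mult_right_mono mult_left_mono) auto
  hence 5: "9/100 * lam * b * diameter X \<le> diameter X'"
    unfolding X'_def using lam_pos ub
    by (intro piece_expansion_diameter[OF X(1-3) _ v x(1) x(1)]) auto
  have "g ^ 3 = g * g\<^sup>2" by (simp add: power2_eq_square power3_eq_cube)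
  also have "\<dots> \<le> (2 * 1000 ^ 12 * b) * (2 * 1000 ^ 8 * u)" using 1 4 g ub by (intro mult_mono) auto
  finally have "g ^ 3 * 1000 ^ 7 \<le> 4 * 1000 ^ 27 * (u * b)" by simp
  also have "\<dots> \<le> (9/100 * lam * u) * (9/100 * lam * b)" using mult_nonneg_nonneg[OF ub] mult_nonneg_nonneg[OF ub(2,1)] by (simp add: lam_def)
  finally have "g ^ 3 * 1000 ^ 7 * diameter X \<le> (9/100 * lam * u) * (9/100 * lam * b) * diameter X"
    using diameter_ge_0[OF compact_imp_bounded[OF X(2)]] by (intro mult_right_mono)
  also have "\<dots> = (9/100 * lam * u) * (9/100 * lam * b * diameter X)" by (simp only: mult.assoc)
  also have "\<dots> \<le> 9/100 * lam * u * diameter X'" using 5 lam_pos ub by (intro mult_left_mono) auto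
  also have "\<dots> \<le> diameter (fam v ` X')" by (rule 2)
  finally show ?thesis by (simp add: X'_def)
qed

section \<open>Exponential shrinking along a slowly recurrent critical orbit\<close>

text \<open>
  The derivative along the orbit of the critical value grows exponentially, and the orbit approaches
  the critical points at a rate that is negligible against this growth: the base \<open>1000\<close> enters
  \<open>growth\<close> with exponent \<open>8 * n\<close>, but \<open>depth\<close> only with \<open>n + 1\<close>.
\<close>

locale slow_critical_orbit =
  fixes v :: complex
  assumes orbit_bound: "\<And>n. norm ((fam v ^^ n) v) \<le> 2"
    and depth: "\<And>n. 1 / 1000 ^ (n + 1) \<le> crit_dist ((fam v ^^ n) v)"
    and growth: "\<And>n. 1000 ^ (8 * n) \<le> (\<Prod>i<n. lam * crit_dist ((fam v ^^ i) v))"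
begin

abbreviation F :: "nat \<Rightarrow> complex \<Rightarrow> complex" where "F n \<equiv> fam v ^^ n"

lemma v_bound: "norm v \<le> 2" using orbit_bound[of 0] by simp

lemma orbit_in_piece:
  obtains c where "c = 0 \<or> c = 1 \<or> c = 2" "F n v \<in> piece c"
  using in_piece[OF v_bound orbit_bound[of n]] orbit_bound[of "Suc n"] by auto

lemma compact_connected_F:
  assumes "compact Y" "connected Y"
  shows "compact (F n ` Y)" "connected (F n ` Y)"
  by (intro compact_continuous_image connected_continuous_image continuous_intros assms)+

lemma shadow_lower:
  assumes "\<And>j. j < i \<Longrightarrow> norm (F j y - F j v) \<le> crit_dist (F j v) / 1000"
  shows "(\<Prod>j<i. lam * crit_dist (F j v)) * norm (y - v) \<le> norm (F i y - F i v)"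
  using assms
proof (induction i)
  case (Suc i)
  obtain c where c: "c = 0 \<or> c = 1 \<or> c = 2" "F i v \<in> piece c" by (rule orbit_in_piece)
  have IH: "(\<Prod>j<i. lam * crit_dist (F j v)) * norm (y - v) \<le> norm (F i y - F i v)"
    using Suc by simp
  have k: "0 \<le> lam * crit_dist (F i v)" using lam_pos by (simp add: crit_dist_nonneg)
  have "(\<Prod>j<Suc i. lam * crit_dist (F j v)) * norm (y - v) \<le>
      lam * crit_dist (F i v) * norm (F i y - F i v)"
    using mult_left_mono[OF IH k] by (simp add: mult_ac)
  also have "\<dots> \<le> 3 * (lam * crit_dist (F i v)) * norm (F i y - F i v)"
    using k by (intro mult_right_mono) auto
  also have "\<dots> \<le> norm (F (Suc i) y - F (Suc i) v)"
    using near_distortion(2)[OF v_bound c(2,1) Suc.prems[OF lessI]] by simp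
  finally show ?case .
qed simp

lemma shadow_upper:
  assumes "\<And>j. j < i \<Longrightarrow> norm (F j y - F j v) \<le> crit_dist (F j v) / 1000"
  shows "norm (F i y - F i v) \<le> 5 ^ i * (\<Prod>j<i. lam * crit_dist (F j v)) * norm (y - v)"
  using assms
proof (induction i)
  case (Suc i)
  obtain c where c: "c = 0 \<or> c = 1 \<or> c = 2" "F i v \<in> piece c" by (rule orbit_in_piece)
  have IH: "norm (F i y - F i v) \<le> 5 ^ i * (\<Prod>j<i. lam * crit_dist (F j v)) * norm (y - v)"
    using Suc by simp
  have k: "0 \<le> 5 * (lam * crit_dist (F i v))" using lam_pos by (simp add: crit_dist_nonneg)
  have "norm (F (Suc i) y - F (Suc i) v) \<le> 5 * (lam * crit_dist (F i v)) * norm (F i y - F i v)"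
    using near_distortion(1)[OF v_bound c(2,1) Suc.prems[OF lessI]] by simp
  also have "\<dots> \<le> 5 * (lam * crit_dist (F i v)) *
      (5 ^ i * (\<Prod>j<i. lam * crit_dist (F j v)) * norm (y - v))"
    by (rule mult_left_mono[OF IH k])
  finally show ?case by (simp add: mult_ac)
qed simp

lemma shadow_diameter:
  assumes Y: "compact Y" "connected Y" "y0 \<in> Y"
    and b: "\<And>i y. i \<le> m \<Longrightarrow> y \<in> Y \<Longrightarrow> norm (F i y) \<le> 2"
    and near: "\<And>i. i < m \<Longrightarrow> norm (F i y0 - F i v) \<le> crit_dist (F i v) / 1000"
  shows "(\<Prod>j<m. lam * crit_dist (F j v)) * diameter Y \<le> 13 ^ m * diameter (F m ` Y)"
  using b near
proof (induction m)
  case (Suc m)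
  obtain c where c: "c = 0 \<or> c = 1 \<or> c = 2" "F m v \<in> piece c" by (rule orbit_in_piece)
  have IH: "(\<Prod>j<m. lam * crit_dist (F j v)) * diameter Y \<le> 13 ^ m * diameter (F m ` Y)"
    using Suc by simp
  note nd = near_distortion(3,4)[OF v_bound c(2,1) Suc.prems(2)[OF lessI]]
  have bm: "norm z \<le> 2" "norm (fam v z) \<le> 2" if "z \<in> F m ` Y" for z
    using that Suc.prems(1)[of m] Suc.prems(1)[of "Suc m"] by auto
  obtain c' where c': "c' = 0 \<or> c' = 1 \<or> c' = 2" "F m ` Y \<subseteq> piece c'"
    using connected_in_piece[OF compact_connected_F(2)[OF Y(1,2)] v_bound bm] by blast
  define k where "k = lam * crit_dist (F m v)"
  have k: "0 \<le> k" using lam_pos by (simp add: crit_dist_nonneg k_def)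
  have "(9/10 * norm (F m v)) * (9/10 * norm ((F m v)\<^sup>2 - 1)) \<le> norm (F m y0) * norm ((F m y0)\<^sup>2 - 1)"
    by (intro mult_mono nd) auto
  hence "lam * ((9/10 * norm (F m v)) * (9/10 * norm ((F m v)\<^sup>2 - 1))) \<le>
      lam * (norm (F m y0) * norm ((F m y0)\<^sup>2 - 1))"
    using lam_pos by (intro mult_left_mono) auto
  hence k': "k / 13 \<le> lam / 10 * norm (F m y0) * norm ((F m y0)\<^sup>2 - 1)"
    using k unfolding k_def crit_dist_def by (simp add: mult_ac)
  have "k / 13 * diameter (F m ` Y) \<le> diameter (fam v ` F m ` Y)"
    by (rule piece_expansion_diameter[OF compact_connected_F(2,1)[OF Y(1,2)] c'(2,1) v_bound _ _ _ k'])
      (use Y k in auto)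
  also have "fam v ` F m ` Y = F (Suc m) ` Y" by (simp add: image_image)
  finally have 1: "k * diameter (F m ` Y) \<le> 13 * diameter (F (Suc m) ` Y)" by simp
  have "(\<Prod>j<Suc m. lam * crit_dist (F j v)) * diameter Y \<le> k * (13 ^ m * diameter (F m ` Y))"
    using mult_left_mono[OF IH k] by (simp add: k_def mult_ac)
  also have "\<dots> = 13 ^ m * (k * diameter (F m ` Y))" by simp
  also have "\<dots> \<le> 13 ^ m * (13 * diameter (F (Suc m) ` Y))" using 1 by (intro mult_left_mono) auto
  finally show ?case by simp
qed simp

text \<open>Shadowing for time \<open>j\<close> forces the starting point to be exponentially close to \<open>v\<close>, because the orbit of \<open>v\<close>
  expands.\<close>

lemma shadow_small:
  assumes near: "\<And>i. i < j \<Longrightarrow> norm (F i y - F i v) \<le> crit_dist (F i v) / 1000"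
    and g: "norm (y - v) = g ^ 4" "0 \<le> g" and b: "norm (F j y) \<le> 2"
  shows "g * 1000 ^ (2 * j) \<le> 2"
proof -
  have "(g * 1000 ^ (2 * j)) ^ 4 = 1000 ^ (8 * j) * norm (y - v)"
    by (simp add: g(1) power_mult_distrib power_mult[symmetric] mult.commute)
  also have "\<dots> \<le> (\<Prod>i<j. lam * crit_dist (F i v)) * norm (y - v)"
    by (intro mult_right_mono growth) auto
  also have "\<dots> \<le> norm (F j y - F j v)" by (rule shadow_lower[OF near])
  also have "\<dots> \<le> 2 ^ 4" using norm_triangle_ineq4[of "F j y" "F j v"] b orbit_bound[of j] by simp
  finally show ?thesis using g(2) power_mono_iff[of "g * 1000 ^ (2 * j)" 2 4] by simp
qed

text \<open>Let \<open>m\<close> be the first time at which some point of \<open>Y\<close> stops shadowing \<open>v\<close>. Its distance from the orbit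
  of \<open>v\<close> has then grown from at most \<open>g ^ 4\<close> to \<open>crit_dist / 1000\<close>, and by \<open>shadow_upper\<close> and
  \<open>shadow_diameter\<close> the diameter of \<open>Y\<close> has grown by at least the same factor, up to \<open>65 ^ m\<close>. This
  gives \<open>g ^ 4\<close> in place of \<open>g ^ 3\<close>. The surplus factor \<open>g\<close> is exponentially small in \<open>m\<close> by
  \<open>shadow_small\<close>; it pays for \<open>65 ^ m\<close>, for the depth of the orbit at time \<open>m\<close> and for the gain
  \<open>(1/2) ^ m\<close>. If there is no such time up to \<open>n\<close>, the first alternative holds.\<close>

lemma binding:
  assumes Y: "compact Y" "connected Y" "y0 \<in> Y"
    and b: "\<And>i y. i \<le> n \<Longrightarrow> y \<in> Y \<Longrightarrow> norm (F i y) \<le> 2"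
    and g: "0 \<le> g" "norm (y0 - v) = g ^ 4" and far: "\<And>y. y \<in> Y \<Longrightarrow> norm (y - v) \<le> g ^ 4"
  shows "g \<le> 2 * (1/2) ^ n \<or>
    (\<exists>m\<le>n. diameter Y \<le> g ^ 3 * 1000 ^ 4 * (1/2) ^ m * diameter (F m ` Y))"
proof (cases "\<forall>i<n. \<forall>y\<in>Y. norm (F i y - F i v) \<le> crit_dist (F i v) / 1000")
  case True
  have "g * 1000 ^ (2 * n) \<le> 2"
    by (rule shadow_small[of _ y0]) (use True Y g b in auto)
  moreover have "g * 2 ^ n \<le> g * 1000 ^ (2 * n)"
    using g power_mono[of 2 "1000 ^ 2 :: real" n] by (intro mult_left_mono) (auto simp: power_mult)
  ultimately have "g * 2 ^ n \<le> 2" by linarith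
  thus ?thesis by (simp add: power_divide field_simps)
next
  case False
  define P where "P i \<longleftrightarrow> i < n \<and> \<not> (\<forall>y\<in>Y. norm (F i y - F i v) \<le> crit_dist (F i v) / 1000)" for i
  define m where "m = (LEAST i. P i)"
  have "P m" unfolding m_def by (rule LeastI_ex) (use False in \<open>auto simp: P_def\<close>)
  then obtain y1 where m: "m < n" and y1: "y1 \<in> Y" "norm (F m y1 - F m v) > crit_dist (F m v) / 1000"
    by (auto simp: P_def not_le)
  have near: "norm (F i y - F i v) \<le> crit_dist (F i v) / 1000" if "i < m" "y \<in> Y" for i y
    using not_less_Least[of i P] that m by (auto simp: P_def m_def)
  define G where "G = (\<Prod>j<m. lam * crit_dist (F j v))"
  define d d' where "d = diameter Y" and "d' = diameter (F m ` Y)"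
  have d: "d \<ge> 0" "d' \<ge> 0"
    unfolding d_def d'_def by (intro diameter_ge_0 compact_imp_bounded compact_connected_F Y)+
  have G: "G \<ge> 0" unfolding G_def by (intro prod_nonneg) (use lam_pos in \<open>simp add: crit_dist_nonneg\<close>)
  have "crit_dist (F m v) / 1000 \<le> 5 ^ m * G * norm (y1 - v)"
    using shadow_upper[of m y1] near y1 by (simp add: G_def)
  also have "\<dots> \<le> 5 ^ m * G * g ^ 4" using far[OF y1(1)] G by (intro mult_left_mono) auto
  finally have 1: "crit_dist (F m v) \<le> 1000 * 5 ^ m * G * g ^ 4" by simp
  have 2: "G * d \<le> 13 ^ m * d'"
    unfolding G_def d_def d'_def by (rule shadow_diameter[OF Y]) (use b near Y m in auto)
  have "d * (1 / 1000 ^ (m + 1)) \<le> d * crit_dist (F m v)" by (intro mult_left_mono depth d)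
  also have "\<dots> \<le> d * (1000 * 5 ^ m * G * g ^ 4)" by (intro mult_left_mono 1 d)
  also have "\<dots> = 1000 * 5 ^ m * g ^ 4 * (G * d)" by simp
  also have "\<dots> \<le> 1000 * 5 ^ m * g ^ 4 * (13 ^ m * d')" using 2 by (intro mult_left_mono) auto
  also have "\<dots> = 1000 * 65 ^ m * g ^ 4 * d'"
    by (simp add: power_mult_distrib[symmetric])
  finally have 3: "d \<le> 1000 ^ (m + 1) * (1000 * 65 ^ m * g ^ 4 * d')" by (simp add: field_simps)
  \<comment> \<open>The set still shadows up to time \<open>m - 1\<close>, so \<open>g\<close> is at most of order \<open>1000 ^ (- 2 * (m - 1))\<close>; 130 is \<open>65 * 2\<close>.\<close>
  have 4: "g * 1000 ^ m * 130 ^ m \<le> 1000\<^sup>2"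
  proof (cases m)
    case 0
    have "g * 1000 ^ (2 * 0) \<le> 2" by (rule shadow_small[of _ y0]) (use g b[of 0 y0] Y in auto)
    thus ?thesis using 0 by simp
  next
    case (Suc k)
    have "g * 1000 ^ (2 * k) \<le> 2"
      by (rule shadow_small[of _ y0]) (use g b[of k y0] Y near Suc m in auto)
    moreover have "g * (1000 ^ k * 130 ^ k) \<le> g * 1000 ^ (2 * k)"
      unfolding mult_2 power_add using g by (intro mult_left_mono power_mono) auto
    ultimately have "g * (1000 ^ k * 130 ^ k) \<le> 2" by linarith
    thus ?thesis using Suc by (simp add: mult_ac)
  qed
  have h: "(65::real) ^ m * 2 ^ m = 130 ^ m" by (simp add: power_mult_distrib[symmetric])
  have "d * 2 ^ m \<le> 1000 ^ (m + 1) * (1000 * 65 ^ m * g ^ 4 * d') * 2 ^ m"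
    using 3 by (intro mult_right_mono) auto
  also have "\<dots> = 1000\<^sup>2 * g ^ 3 * d' * (g * 1000 ^ m * (65 ^ m * 2 ^ m))"
    by (simp add: power2_eq_square power3_eq_cube power4_eq_xxxx)
  also have "\<dots> = 1000\<^sup>2 * g ^ 3 * d' * (g * 1000 ^ m * 130 ^ m)" by (simp only: h)
  also have "\<dots> \<le> 1000\<^sup>2 * g ^ 3 * d' * 1000\<^sup>2" using 4 g d by (intro mult_left_mono) auto
  finally have "d * 2 ^ m \<le> g ^ 3 * 1000 ^ 4 * d'" by simp
  hence "d \<le> g ^ 3 * 1000 ^ 4 * (1/2) ^ m * d'" by (simp add: power_divide field_simps)
  thus ?thesis using m unfolding d_def d'_def by (intro disjI2 exI[of _ m]) auto
qed

end

context slow_critical_orbit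
begin

lemma F_add_image: "F m ` F j ` X = F (m + j) ` X"
  by (simp add: image_image funpow_add)

lemma diameter_finite_connected:
  assumes X: "connected X" "finite X" "x \<in> X"
  shows "diameter X = 0"
  using connected_finite_iff_sing[OF X(1)] X by auto

text \<open>One step of the induction for a set that passes the folds in \<open>j\<close> iterates. The factor \<open>g ^ 3\<close> lost in
  the passage cancels against the one gained in \<open>binding\<close>; in the first alternative of \<open>binding\<close> the
  image has diameter at most \<open>2 * g ^ 4\<close>, which leaves one factor \<open>g\<close> after the cancellation. The case
  \<open>g = 0\<close> means that the image is \<open>{v}\<close>.\<close>

lemma shrink_step_passage:
  assumes X: "connected X" "compact X" "X \<noteq> {}" and j: "j = 1 \<or> j = 2" "j \<le> n"
    and b: "\<And>i x. i \<le> n \<Longrightarrow> x \<in> X \<Longrightarrow> norm (F i x) \<le> 2"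
    and passage: "\<And>x g. x \<in> X \<Longrightarrow> norm (F j x - v) = g ^ 4 \<Longrightarrow> 0 \<le> g \<Longrightarrow> g \<le> 2 \<Longrightarrow>
      g ^ 3 * 1000 ^ 7 * diameter X \<le> diameter (F j ` X)"
    and fin: "finite {x\<in>X. F j x = v}"
    and IH: "\<And>m. m \<le> n - j \<Longrightarrow> diameter (F (m + j) ` X) \<le> 16 * (1/2) ^ (n - j - m)"
  shows "diameter X \<le> 16 * (1/2) ^ n"
proof -
  define Y where "Y = F j ` X"
  have Y: "compact Y" "connected Y" "Y \<noteq> {}"
    unfolding Y_def using X by (auto intro: compact_connected_F)
  have "continuous_on Y (\<lambda>y. norm (y - v))" by (intro continuous_intros)
  then obtain y0 where y0: "y0 \<in> Y" "\<And>y. y \<in> Y \<Longrightarrow> norm (y - v) \<le> norm (y0 - v)"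
    using continuous_attains_sup[OF Y(1,3)] by blast
  define g where "g = root 4 (norm (y0 - v))"
  have g: "0 \<le> g" "norm (y0 - v) = g ^ 4" by (simp_all add: g_def)
  have Yb: "norm (F i y) \<le> 2" if "i \<le> n - j" "y \<in> Y" for i y
    using that b[of "i + j"] j(2) by (auto simp: Y_def funpow_add)
  have "norm (y0 - v) \<le> 2 ^ 4"
    using Yb[of 0 y0] y0 norm_triangle_ineq4[of y0 v] v_bound by simp
  hence g2: "g \<le> 2" unfolding g(2) using power_mono_iff[of g 2 4] g(1) by simp
  obtain x0 where x0: "x0 \<in> X" "y0 = F j x0" using y0 by (auto simp: Y_def)
  have pass: "g ^ 3 * 1000 ^ 7 * diameter X \<le> diameter Y"
    unfolding Y_def by (rule passage[OF x0(1) _ g(1) g2]) (use g x0 in simp)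
  have j2: "(2::real) ^ j \<le> 4" using j by auto
  have split: "(1/2::real) ^ (n - j - m) = 2 ^ j * 2 ^ m * (1/2) ^ n" if "m \<le> n - j" for m
  proof -
    have "n = (n - j - m) + j + m" using that j(2) by simp
    hence e: "(1/2::real) ^ n = (1/2) ^ (n - j - m) * (1/2) ^ j * (1/2) ^ m" by (metis power_add)
    have h: "(1/2::real) ^ j * 2 ^ j = 1" "(1/2::real) ^ m * 2 ^ m = 1"
      by (simp_all add: power_mult_distrib[symmetric])
    have "2 ^ j * 2 ^ m * (1/2::real) ^ n =
        (1/2) ^ (n - j - m) * ((1/2) ^ j * 2 ^ j) * ((1/2) ^ m * 2 ^ m)" unfolding e by (simp only: mult_ac)
    also have "\<dots> = (1/2) ^ (n - j - m)"
      by (simp only: h mult_1_right)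
    finally show ?thesis by simp
  qed
  show ?thesis
  proof (cases "g = 0")
    case True
    hence "X = {x\<in>X. F j x = v}" using y0(2) g by (force simp: Y_def)
    hence "finite X" using fin by simp
    thus ?thesis using diameter_finite_connected[OF X(1)] X(3) by fastforce
  next
    case False
    hence gp: "g > 0" using g by simp
    have main: "diameter X * 1000 ^ 7 \<le> 16 * (1/2) ^ n * 1000 ^ 7"
    proof -
      have "g \<le> 2 * (1/2) ^ (n - j) \<or> (\<exists>m\<le>n - j. diameter Y \<le>
          g ^ 3 * 1000 ^ 4 * (1/2) ^ m * diameter (F m ` Y))"
      proof (rule binding[OF Y(1,2) y0(1) _ g])
        show "norm (F i y) \<le> 2" if "i \<le> n - j" "y \<in> Y" for i y by (rule Yb[OF that])
        show "norm (y - v) \<le> g ^ 4" if "y \<in> Y" for y using y0(2)[OF that] by (simp only: g(2))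
      qed
      thus ?thesis
    proof (elim disjE exE conjE)
      assume a: "g \<le> 2 * (1/2) ^ (n - j)"
      have "diameter Y \<le> 2 * g ^ 4"
      proof (rule diameter_le)
        fix x y assume "x \<in> Y" "y \<in> Y"
        thus "norm (x - y) \<le> 2 * g ^ 4"
          using y0(2)[of x] y0(2)[of y] g norm_triangle_ineq4[of "x - v" "y - v"] by simp
      qed (use Y in auto)
      moreover have "g ^ 3 * (diameter X * 1000 ^ 7) = g ^ 3 * 1000 ^ 7 * diameter X" "2 * g ^ 4 = g ^ 3 * (2 * g)"
        by (simp_all only: power3_eq_cube power4_eq_xxxx mult_ac)
      ultimately have "g ^ 3 * (diameter X * 1000 ^ 7) \<le> g ^ 3 * (2 * g)"
        using pass by linarith
      hence "diameter X * 1000 ^ 7 \<le> 2 * g" using gp mult_le_cancel_left_pos[of "g ^ 3"] by auto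
      also have "\<dots> \<le> 4 * (1/2) ^ (n - j - 0)" using a by simp
      also have "\<dots> = 4 * (2 ^ j * (1/2) ^ n)" by (subst split) simp_all
      also have "\<dots> \<le> 4 * (4 * (1/2) ^ n)" using j2 by (intro mult_left_mono mult_right_mono) auto
      also have "\<dots> \<le> 16 * (1/2) ^ n * 1000 ^ 7" by simp
      finally show ?thesis .
    next
      fix m assume m: "m \<le> n - j"
        and a: "diameter Y \<le> g ^ 3 * 1000 ^ 4 * (1/2) ^ m * diameter (F m ` Y)"
      have "diameter (F m ` Y) \<le> 16 * (2 ^ j * 2 ^ m * (1/2) ^ n)"
        using IH[OF m] split[OF m] by (simp add: Y_def F_add_image)
      also have "\<dots> \<le> 16 * (4 * 2 ^ m * (1/2) ^ n)"
        using j2 by (intro mult_left_mono mult_right_mono) auto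
      finally have "g ^ 3 * 1000 ^ 4 * (1/2) ^ m * diameter (F m ` Y) \<le>
          g ^ 3 * 1000 ^ 4 * (1/2) ^ m * (16 * (4 * 2 ^ m * (1/2) ^ n))"
        using gp by (intro mult_left_mono) auto
      also have "\<dots> = g ^ 3 * (16 * (1/2) ^ n * (4 * 1000 ^ 4)) * ((1/2) ^ m * 2 ^ m)" by (simp only: mult_ac)
      also have "(1/2 :: real) ^ m * 2 ^ m = 1" by (simp add: power_mult_distrib[symmetric])
      also have "g ^ 3 * (16 * (1/2) ^ n * (4 * 1000 ^ 4)) * 1 = g ^ 3 * (16 * (1/2) ^ n * (4 * 1000 ^ 4))" by simp
      also have "\<dots> \<le> g ^ 3 * (16 * (1/2) ^ n * 1000 ^ 7)" using gp by (intro mult_left_mono) auto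
      finally have "g ^ 3 * 1000 ^ 7 * diameter X \<le> g ^ 3 * (16 * (1/2) ^ n * 1000 ^ 7)"
        using pass a by linarith
      moreover have "g ^ 3 * 1000 ^ 7 * diameter X = g ^ 3 * (diameter X * 1000 ^ 7)" by (simp only: mult_ac)
      ultimately show ?thesis using gp mult_le_cancel_left_pos[of "g ^ 3"] by auto
    qed
    qed
    thus ?thesis by simp
  qed
qed

text \<open>Near \<open>\<plusminus>\<surd>2\<close> the set expands by a factor of order \<open>lam\<close> in one step, and so it does, by a factor of
  order \<open>sqrt lam\<close>, near \<open>\<plusminus>1\<close> if its image is not near 0. The two remaining cases are passages through
  the folds, treated by \<open>shrink_step_passage\<close>.\<close>

lemma shrink_compact:
  assumes "connected X" "compact X" "X \<noteq> {}"
    and "\<And>i x. i \<le> n \<Longrightarrow> x \<in> X \<Longrightarrow> norm (F i x) \<le> 2"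
  shows "diameter X \<le> 16 * (1/2) ^ n"
  using assms
proof (induction n arbitrary: X rule: less_induct)
  case (less n)
  note X = less.prems(1-3) and b = less.prems(4)
  have d4: "diameter X \<le> 4"
  proof (rule diameter_le)
    fix x y assume "x \<in> X" "y \<in> X"
    thus "norm (x - y) \<le> 4" using b[of 0 x] b[of 0 y] norm_triangle_ineq4[of x y] by simp
  qed simp
  show ?case
  \<comment> \<open>The constant 16 covers the first times, so that a passage of two steps fits into the others.\<close>
  proof (cases "n \<le> 2")
    case True
    have "(1/2::real) ^ 2 \<le> (1/2) ^ n" using True by (intro power_decreasing) auto
    thus ?thesis using d4 by (simp add: power2_eq_square)
  next
    case n: False
    have IH: "diameter (F j ` X) \<le> 16 * (1/2) ^ (n - j)" if "0 < j" "j \<le> n" for j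
    proof (rule less.IH)
      fix i x assume "i \<le> n - j" "x \<in> F j ` X"
      thus "norm (F i x) \<le> 2" using b[of "i + j"] that by (auto simp: funpow_add)
    qed (use that X n in \<open>auto intro: compact_connected_F\<close>)
    have step: ?thesis if "2 * diameter X \<le> diameter (fam v ` X)"
    proof -
      have "(1/2::real) ^ (n - 1) = 2 * (1/2) ^ n" using n by (cases n) auto
      thus ?thesis using IH[of 1] that n by simp
    qed
    have bj: "norm (F j x) \<le> 2" "norm (fam v (F j x)) \<le> 2" if "j < n" "x \<in> X" for x j
      using b[of j x] b[of "Suc j" x] that by auto
    obtain c where c: "c = 0 \<or> c = 1 \<or> c = 2" "X \<subseteq> piece c"
      using connected_in_piece[OF X(1) v_bound] bj[of 0] n by auto
    obtain x where x: "x \<in> X" using X by auto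
    have IH': "diameter (F (m + j) ` X) \<le> 16 * (1/2) ^ (n - j - m)" if "0 < j" "j \<le> n" "m \<le> n - j" for m j
      using IH[of "m + j"] that by (simp add: diff_diff_left add.commute)
    consider "c = 2" | "c = 0" | "c = 1" using c by blast
    thus ?thesis
    proof cases
      case 1
      have "(14/100) * (9/10) \<le> 1/10 * norm x * norm (x\<^sup>2 - 1)"
        using piece_size(8,10)[of x] c x 1 by (intro mult_mono) auto
      hence "lam * (14/100 * (9/10)) \<le> lam * (1/10 * norm x * norm (x\<^sup>2 - 1))"
        using lam_pos by (intro mult_left_mono) auto
      also have "lam * (1/10 * norm x * norm (x\<^sup>2 - 1)) = lam / 10 * norm x * norm (x\<^sup>2 - 1)" by simp
      finally have "2 \<le> lam / 10 * norm x * norm (x\<^sup>2 - 1)" using lam_ge by linarith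
      hence "2 * diameter X \<le> diameter (fam v ` X)"
        by (intro piece_expansion_diameter[OF X(1,2) c(2,1) v_bound x x]) auto
      thus ?thesis by (rule step)
    next
      case 2
      show ?thesis
      proof (rule shrink_step_passage[OF X, of 1])
        show "g ^ 3 * 1000 ^ 7 * diameter X \<le> diameter (F 1 ` X)"
          if "x \<in> X" "norm (F 1 x - v) = g ^ 4" "0 \<le> g" "g \<le> 2" for x g
          unfolding One_nat_def funpow.simps comp_id
        proof (rule passage_0(3)[OF X(1,2) _ v_bound that(1) _ that(3,4)])
          show "X \<subseteq> piece 0" using c(2) 2 by simp
          show "norm (fam v x - v) = g ^ 4" using that(2) unfolding One_nat_def funpow.simps comp_id .
        qed
        have "x = 0" if "x \<in> X" "F 1 x = v" for x
        proof -
          have "x \<in> piece 0" using that(1) c(2) 2 by blast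
          hence "lam * (norm x)\<^sup>2 \<le> 0" using fam_near_0[OF v_bound, of x] that(2) by simp
          thus ?thesis using lam_pos by (simp add: mult_le_0_iff)
        qed
        hence "{x \<in> X. F 1 x = v} \<subseteq> {0}" by blast
        thus "finite {x \<in> X. F 1 x = v}" by (rule finite_subset) simp
        show "norm (F i x) \<le> 2" if "i \<le> n" "x \<in> X" for i x by (rule b[OF that])
        show "diameter (F (m + 1) ` X) \<le> 16 * (1/2) ^ (n - 1 - m)" if "m \<le> n - 1" for m
          by (rule IH'[OF _ _ that]) (use n in auto)
      qed (use n in auto)
    next
      case 3
      have "connected (fam v ` X)" using compact_connected_F(2)[OF X(2,1), of 1] by simp
      then obtain c' where c': "c' = 0 \<or> c' = 1 \<or> c' = 2" "fam v ` X \<subseteq> piece c'"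
        by (rule connected_in_piece[OF _ v_bound]) (use bj[of 1] n in auto)
      show ?thesis
      proof (cases "c' = 0")
        case True
        have F2: "F 2 x = fam v (fam v x)" for x by (simp add: numeral_2_eq_2)
        show ?thesis
        proof (rule shrink_step_passage[OF X, of 2])
          show "g ^ 3 * 1000 ^ 7 * diameter X \<le> diameter (F 2 ` X)"
            if "x \<in> X" "norm (F 2 x - v) = g ^ 4" "0 \<le> g" "g \<le> 2" for x g
          proof -
            have "g ^ 3 * 1000 ^ 7 * diameter X \<le> diameter (fam v ` fam v ` X)"
            proof (rule passage_1[OF X(1,2) _ _ v_bound that(1) _ that(3,4)])
              show "X \<subseteq> piece 1" using c(2) 3 by simp
              show "fam v ` X \<subseteq> piece 0" using c'(2) True by simp
              show "norm (fam v (fam v x) - v) = g ^ 4" using that(2) unfolding F2 .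
            qed
            also have "fam v ` fam v ` X = F 2 ` X" unfolding image_image by (intro image_cong refl F2[symmetric])
            finally show ?thesis .
          qed
          have "x \<in> {1, -1}" if x: "x \<in> X" "F 2 x = v" for x
          proof -
            have "fam v x \<in> piece 0" using x(1) c'(2) True by blast
            hence "lam * (norm (fam v x))\<^sup>2 \<le> 0"
              using fam_near_0[OF v_bound, of "fam v x"] x(2) by (simp add: F2)
            hence f0: "fam v x = 0" using lam_pos by (simp add: mult_le_0_iff)
            have "x \<in> piece 1" using x(1) c(2) 3 by blast
            hence "lam * (norm (x\<^sup>2 - 1))\<^sup>2 \<le> 0" using fam_near_1(2)[OF v_bound, of x] f0 by simp
            hence "x\<^sup>2 = 1" using lam_pos by (simp add: mult_le_0_iff)
            thus ?thesis by (simp add: power2_eq_1_iff)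
          qed
          hence "{x \<in> X. F 2 x = v} \<subseteq> {1, -1}" by blast
          thus "finite {x \<in> X. F 2 x = v}" by (rule finite_subset) simp
          show "norm (F i x) \<le> 2" if "i \<le> n" "x \<in> X" for i x by (rule b[OF that])
          show "diameter (F (m + 2) ` X) \<le> 16 * (1/2) ^ (n - 2 - m)" if "m \<le> n - 2" for m
            by (rule IH'[OF _ _ that]) (use n in auto)
        qed (use n in auto)
      next
        case False
        \<comment> \<open>An image point of modulus at least \<open>9/10\<close> comes from a point at distance of order \<open>1 / sqrt lam\<close> from the fold.\<close>
        define d where "d = norm (x\<^sup>2 - 1)"
        have d: "d \<ge> 0" by (simp add: d_def)
        have xp: "x \<in> piece 1" using c 3 x by auto
        have "9/10 \<le> norm (fam v x)" using piece_size(6,8)[of "fam v x"] c' False x by force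
        also have "\<dots> \<le> 11/10 * lam * d\<^sup>2" using fam_near_1(1)[OF v_bound xp] by (simp add: d_def)
        finally have "8/10 \<le> lam * d\<^sup>2" by simp
        hence "lam * (8/10) \<le> lam * (lam * d\<^sup>2)" using lam_pos by (intro mult_left_mono) auto
        also have "\<dots> = (lam * d)\<^sup>2" by (simp add: power2_eq_square)
        finally have "lam * (8/10) \<le> (lam * d)\<^sup>2" .
        moreover have "100\<^sup>2 \<le> lam * (8/10)" using lam_ge by simp
        ultimately have "100 \<le> lam * d" using lam_pos d by (intro power2_le_imp_le[of 100]) auto
        moreover have "lam / 10 * (9/10) * d \<le> lam / 10 * norm x * norm (x\<^sup>2 - 1)"
          unfolding d_def using piece_size(6)[OF xp] lam_pos by (intro mult_right_mono mult_left_mono) auto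
        ultimately have "2 \<le> lam / 10 * norm x * norm (x\<^sup>2 - 1)" by simp
        hence "2 * diameter X \<le> diameter (fam v ` X)"
        by (intro piece_expansion_diameter[OF X(1,2) c(2,1) v_bound x x]) auto
      thus ?thesis by (rule step)
      qed
    qed
  qed
qed

theorem shrink:
  assumes X: "connected X" and b: "\<And>i x. i \<le> n \<Longrightarrow> x \<in> X \<Longrightarrow> norm (F i x) \<le> 2"
    and xy: "x \<in> X" "y \<in> X"
  shows "norm (x - y) \<le> 16 * (1/2) ^ n"
proof -
  have cl: "norm (F i z) \<le> 2" if i: "i \<le> n" and z: "z \<in> closure X" for i z
  proof -
    have "closed {z. norm (F i z) \<le> 2}" by (intro closed_Collect_le continuous_intros)
    thus ?thesis using closure_minimal[of X "{z. norm (F i z) \<le> 2}"] b[OF i] z by auto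
  qed
  have "bounded (closure X)" unfolding bounded_iff using cl[of 0] by auto
  hence c: "compact (closure X)" by (simp add: compact_eq_bounded_closed)
  have "norm (x - y) \<le> diameter (closure X)"
    using diameter_bounded_bound[OF compact_imp_bounded[OF c]] xy closure_subset[of X]
    by (auto simp: dist_norm)
  also have "\<dots> \<le> 16 * (1/2) ^ n"
    by (rule shrink_compact[OF _ c _ cl]) (use X xy in \<open>auto intro: connected_imp_connected_closure\<close>)
  finally show ?thesis .
qed

end

section \<open>Spherical and Euclidean distance\<close>

lemma half_sine_bound:
  fixes t :: real
  assumes "0 \<le> t" "t \<le> pi / 2"
  shows "t / 2 \<le> sin t"
proof -
  have t: "t < 16/10" using assms pi_less_4 pi_half_less_two pi_approx by simp
  have "\<bar>sin t - (\<Sum>m<3. sin_coeff m * t ^ m)\<bar> \<le> inverse (fact 3) * \<bar>t\<bar> ^ 3"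
    by (rule Maclaurin_sin_bound)
  moreover have "(\<Sum>m<3. sin_coeff m * t ^ m) = t"
    by (simp add: numeral_3_eq_3 sin_coeff_def)
  ultimately have "\<bar>sin t - t\<bar> \<le> t ^ 3 / 6" using assms by (simp add: fact_numeral)
  hence 1: "sin t \<ge> t - t ^ 3 / 6" by linarith
  have "t * t\<^sup>2 \<le> t * (16/10)\<^sup>2" using t assms by (intro mult_left_mono power_mono) auto
  hence "t ^ 3 \<le> t * (256/100)" by (simp add: power3_eq_cube power2_eq_square)
  thus ?thesis using 1 assms by simp
qed

lemma cos_deficit_bounds:
  fixes d :: real
  assumes "0 \<le> d" "d \<le> pi"
  shows "d\<^sup>2 \<le> 8 * (1 - cos d)" "1 - cos d \<le> d\<^sup>2 / 2"
proof -
  have eq: "1 - cos d = 2 * (sin (d/2))\<^sup>2" using cos_double_sin[of "d/2"] by simp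
  have "d/2/2 \<le> sin (d/2)" by (rule half_sine_bound) (use assms in auto)
  hence "(d/4)\<^sup>2 \<le> (sin (d/2))\<^sup>2" using assms by (intro power_mono) auto
  thus "d\<^sup>2 \<le> 8 * (1 - cos d)" unfolding eq by (simp add: power_divide)
  have "sin (d/2) \<le> d/2" using assms by (intro sin_x_le_x) auto
  moreover have "sin (d/2) \<ge> 0" using assms by (intro sin_ge_zero) auto
  ultimately have "(sin (d/2))\<^sup>2 \<le> (d/2)\<^sup>2" by (intro power_mono)
  thus "1 - cos d \<le> d\<^sup>2 / 2" unfolding eq by (simp add: power_divide)
qed

lemma dist_sphere_deficit:
  fixes x y :: riemann_sphere
  shows "(dist x y)\<^sup>2 \<le> 8 * (1 - inner (stereo x) (stereo y))"
    "1 - inner (stereo x) (stereo y) \<le> (dist x y)\<^sup>2 / 2"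
proof -
  note b = inner_unit_bounds[OF norm_stereo norm_stereo, of x y]
  have "cos (dist x y) = inner (stereo x) (stereo y)" "0 \<le> dist x y" "dist x y \<le> pi"
    using b by (simp_all add: dist_riemann_sphere_def arccos_lbound arccos_ubound)
  thus "(dist x y)\<^sup>2 \<le> 8 * (1 - inner (stereo x) (stereo y))"
    "1 - inner (stereo x) (stereo y) \<le> (dist x y)\<^sup>2 / 2"
    using cos_deficit_bounds[of "dist x y"] by auto
qed

lemma inner_stereo_Fin:
  "1 - inner (stereo (Fin x)) (stereo (Fin y)) =
     2 * (cmod (x - y))\<^sup>2 / ((1 + (cmod x)\<^sup>2) * (1 + (cmod y)\<^sup>2))"
proof -
  define a b where "a = (cmod x)\<^sup>2" and "b = (cmod y)\<^sup>2"
  have ab: "1 + a > 0" "1 + b > 0" by (simp_all add: a_def b_def add_pos_nonneg)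
  have n: "(cmod (x - y))\<^sup>2 = a + b - 2 * inner x y"
    by (simp add: a_def b_def power2_norm_eq_inner inner_diff_left inner_diff_right inner_commute)
  have "inner (stereo (Fin x)) (stereo (Fin y)) =
      2 / (1 + a) * (2 / (1 + b)) * inner x y + (a - 1) / (1 + a) * ((b - 1) / (1 + b))"
    by (simp add: a_def b_def add.commute)
  also have "\<dots> = (4 * inner x y + (a - 1) * (b - 1)) / ((1 + a) * (1 + b))"
    by (simp add: add_divide_distrib)
  also have "4 * inner x y + (a - 1) * (b - 1) =
      (1 + a) * (1 + b) - 2 * (a + b - 2 * inner x y)" by algebra
  also have "\<dots> / ((1 + a) * (1 + b)) = 1 - 2 * (a + b - 2 * inner x y) / ((1 + a) * (1 + b))"
    using ab by (simp add: diff_divide_distrib)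
  finally show ?thesis unfolding n by (simp add: a_def b_def)
qed

lemma dist_Fin_le: "dist (Fin x) (Fin y) \<le> 4 * cmod (x - y)"
proof -
  have "1 * 1 \<le> (1 + (cmod x)\<^sup>2) * (1 + (cmod y)\<^sup>2)" by (intro mult_mono) auto
  hence "2 * (cmod (x - y))\<^sup>2 / ((1 + (cmod x)\<^sup>2) * (1 + (cmod y)\<^sup>2)) \<le> 2 * (cmod (x - y))\<^sup>2 / 1"
    by (intro divide_left_mono) auto
  hence "(dist (Fin x) (Fin y))\<^sup>2 \<le> (4 * cmod (x - y))\<^sup>2"
    using dist_sphere_deficit(1)[of "Fin x" "Fin y"] unfolding inner_stereo_Fin
    by (simp add: power_mult_distrib)
  thus ?thesis by (rule power2_le_imp_le) simp
qed

text \<open>The spherical distance only bounds the Euclidean one when the points are away from \<^const>\<open>Infty\<close>. Here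
  the smallness of \<open>r\<close> relative to \<open>z\<close> keeps \<open>x\<close> away from it: the chord formula bounds the unknown
  \<open>cmod (x - z)\<close> by half of itself plus half of the right-hand side.\<close>

lemma cmod_le_dist_Fin:
  assumes d: "dist (Fin z) (Fin x) \<le> r" and r: "r * (1 + cmod z) \<le> 1"
  shows "cmod (x - z) \<le> r * (1 + cmod z)\<^sup>2"
proof -
  define D M where "D = cmod (x - z)" and "M = 1 + cmod z"
  have nn: "D \<ge> 0" "M \<ge> 1" "r \<ge> 0" using d zero_le_dist[of "Fin z" "Fin x"]
    by (auto simp: D_def M_def simp del: zero_le_dist)
  have x: "cmod x \<le> cmod z + D" using norm_triangle_ineq[of z "x - z"] by (simp add: D_def)
  have sq: "1 + t\<^sup>2 \<le> (1 + t)\<^sup>2" if "t \<ge> 0" for t :: real using that by (simp add: power2_eq_square algebra_simps)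
  have b1: "1 + (cmod z)\<^sup>2 \<le> M\<^sup>2" unfolding M_def by (rule sq) simp
  have "1 + (cmod x)\<^sup>2 \<le> (1 + cmod x)\<^sup>2" by (rule sq) simp
  also have "\<dots> \<le> (M + D)\<^sup>2" using x by (intro power_mono) (auto simp: M_def)
  finally have b2: "1 + (cmod x)\<^sup>2 \<le> (M + D)\<^sup>2" .
  have p: "0 < (1 + (cmod z)\<^sup>2) * (1 + (cmod x)\<^sup>2)" by (intro mult_pos_pos add_pos_nonneg) auto
  have "2 * D\<^sup>2 / ((1 + (cmod z)\<^sup>2) * (1 + (cmod x)\<^sup>2)) \<le> (dist (Fin z) (Fin x))\<^sup>2 / 2"
    using dist_sphere_deficit(2)[of "Fin z" "Fin x"] unfolding inner_stereo_Fin
    by (simp add: D_def norm_minus_commute)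
  also have "\<dots> \<le> r\<^sup>2 / 2" using d by (intro divide_right_mono power_mono) auto
  finally have "2 * D\<^sup>2 \<le> r\<^sup>2 / 2 * ((1 + (cmod z)\<^sup>2) * (1 + (cmod x)\<^sup>2))"
    using p by (simp only: pos_divide_le_eq)
  also have "\<dots> \<le> r\<^sup>2 / 2 * (M\<^sup>2 * (M + D)\<^sup>2)"
    using b1 b2 by (intro mult_left_mono mult_mono) auto
  also have "\<dots> = 2 * (r / 2 * (M * (M + D)))\<^sup>2" by (simp add: power_mult_distrib power_divide)
  finally have "D\<^sup>2 \<le> (r / 2 * (M * (M + D)))\<^sup>2" by simp
  hence "D \<le> r / 2 * (M * (M + D))" by (rule power2_le_imp_le) (use nn in auto)
  also have "\<dots> = r * M\<^sup>2 / 2 + (r * M) * D / 2" by (simp add: power2_eq_square algebra_simps)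
  also have "\<dots> \<le> r * M\<^sup>2 / 2 + 1 * D / 2"
    using r nn by (intro add_left_mono divide_right_mono mult_right_mono) (auto simp: M_def)
  finally show ?thesis by (simp add: D_def M_def)
qed

lemma dist_Fin_Infty_le: "w \<noteq> 0 \<Longrightarrow> dist (Fin w) Infty \<le> 4 / cmod w"
proof -
  assume w: "w \<noteq> 0"
  have p: "1 + (cmod w)\<^sup>2 > 0" by (simp add: add_pos_nonneg)
  have "1 - inner (stereo (Fin w)) (stereo Infty) = 2 / (1 + (cmod w)\<^sup>2)"
    using p by (simp add: field_simps)
  hence "(dist (Fin w) Infty)\<^sup>2 \<le> 16 / (1 + (cmod w)\<^sup>2)"
    using dist_sphere_deficit(1)[of "Fin w" Infty] by simp
  also have "\<dots> \<le> 16 / (cmod w)\<^sup>2" using w p by (intro divide_left_mono mult_pos_pos) auto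
  also have "\<dots> = (4 / cmod w)\<^sup>2" by (simp add: power_divide)
  finally show ?thesis by (rule power2_le_imp_le) simp
qed

lemma dist_Fin_Infty_ge:
  assumes "cmod w \<le> 2"
  shows "dist (Fin w) Infty \<ge> 1/2"
proof -
  have p: "1 + (cmod w)\<^sup>2 > 0" by (simp add: add_pos_nonneg)
  have q: "1 + (cmod w)\<^sup>2 \<le> 5" using power_mono[OF assms, of 2] by simp
  have "2 / 5 \<le> 2 / (1 + (cmod w)\<^sup>2)" using p q by (intro divide_left_mono) auto
  also have "\<dots> = 1 - inner (stereo (Fin w)) (stereo Infty)"
    using p by (simp add: field_simps)
  also have "\<dots> \<le> (dist (Fin w) Infty)\<^sup>2 / 2" by (rule dist_sphere_deficit)
  finally have "(1/2)\<^sup>2 \<le> (dist (Fin w) Infty)\<^sup>2" by (simp add: power2_eq_square)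
  thus ?thesis by (rule power2_le_imp_le) simp
qed

lemma continuous_on_Fin: "continuous_on S Fin"
proof (rule continuous_onI)
  fix x e assume "x \<in> S" "(e::real) > 0"
  have "dist (Fin x') (Fin x) \<le> e" if "dist x' x < e / 4" for x'
    using dist_Fin_le[of x' x] that by (simp add: dist_norm)
  thus "\<exists>d>0. \<forall>x'\<in>S. dist x' x < d \<longrightarrow> dist (Fin x') (Fin x) \<le> e"
    using \<open>e > 0\<close> by (intro exI[of _ "e/4"]) auto
qed

lemma inj_Fin: "inj Fin" by (auto simp: inj_def)

lemma inv_Fin [simp]: "inv Fin (Fin x) = x" by (simp add: inj_Fin)

lemma Fin_local_inverse:
  assumes "e > 0"
  obtains d where "d > 0" "\<And>x. dist (Fin z) x < d \<Longrightarrow> \<exists>w. x = Fin w \<and> cmod (w - z) < e"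
proof -
  define M where "M = 1 + cmod z"
  have M: "M \<ge> 1" by (simp add: M_def)
  define d where "d = min (dist (Fin z) Infty) (min (1 / M) (e / (2 * M\<^sup>2)))"
  have "d > 0" using M assms by (simp add: d_def)
  moreover have "\<exists>w. x = Fin w \<and> cmod (w - z) < e" if x: "dist (Fin z) x < d" for x
  proof (cases x)
    case (Fin w)
    have "d * M \<le> 1 / M * M" using M by (intro mult_right_mono) (auto simp: d_def)
    hence "d * M \<le> 1" using M by simp
    hence "cmod (w - z) \<le> d * M\<^sup>2"
      using cmod_le_dist_Fin[of z w d] x by (simp add: Fin M_def)
    also have "\<dots> \<le> e / (2 * M\<^sup>2) * M\<^sup>2" by (intro mult_right_mono) (auto simp: d_def)
    also have "\<dots> < e" using M assms by simp
    finally show ?thesis using Fin by blast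
  qed (use x in \<open>auto simp: d_def\<close>)
  ultimately show ?thesis using that by blast
qed

lemma open_Fin_image:
  assumes "open V"
  shows "open (Fin ` V)"
  unfolding open_dist
proof
  fix x assume "x \<in> Fin ` V"
  then obtain z where z: "z \<in> V" "x = Fin z" by blast
  obtain e where e: "e > 0" "ball z e \<subseteq> V" using assms z(1) openE by blast
  obtain d where d: "d > 0" "\<And>x. dist (Fin z) x < d \<Longrightarrow> \<exists>w. x = Fin w \<and> cmod (w - z) < e"
    using Fin_local_inverse[OF e(1)] by blast
  show "\<exists>d>0. \<forall>y. dist y x < d \<longrightarrow> y \<in> Fin ` V"
    using d e(2) z(2) by (intro exI[of _ d]) (force simp: dist_commute dist_norm norm_minus_commute)
qed

lemma continuous_on_inv_Fin: "continuous_on (range Fin) (inv Fin)"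
proof (rule continuous_onI)
  fix x e assume x: "x \<in> range Fin" and e: "(e::real) > 0"
  then obtain z where z: "x = Fin z" by blast
  obtain d where d: "d > 0" "\<And>x. dist (Fin z) x < d \<Longrightarrow> \<exists>w. x = Fin w \<and> cmod (w - z) < e"
    using Fin_local_inverse[OF e] by blast
  show "\<exists>d>0. \<forall>x'\<in>range Fin. dist x' x < d \<longrightarrow> dist (inv Fin x') (inv Fin x) \<le> e"
    using d z by (intro exI[of _ d]) (force simp: dist_commute dist_norm norm_minus_commute)
qed

section \<open>The polynomials on the sphere\<close>

definition fam_poly :: "complex \<Rightarrow> complex poly" where
  "fam_poly v = [:-1, 0, 1:]\<^sup>2 * (smult (of_real lam) ([:-1, 0, 1:]\<^sup>2 - 1) + [:v:])"

lemma poly_fam_poly: "poly (fam_poly v) = fam v"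
  by (rule ext) (simp add: fam_poly_def fam_def power2_eq_square algebra_simps)

lemma sphere_iter_Fin: "(sphere_map (fam_poly v) ^^ n) (Fin z) = Fin ((fam v ^^ n) z)"
  by (induction n) (auto simp: poly_fam_poly)

lemma sphere_iter_Infty: "(sphere_map p ^^ n) Infty = Infty"
  by (induction n) auto

lemma degree_fam_poly:
  assumes v: "norm v \<le> 2"
  shows "degree (fam_poly v) \<ge> 2"
proof -
  have ne: "fam_poly v \<noteq> 0"
  proof
    assume "fam_poly v = 0"
    hence "fam v 2 = 0" using poly_fam_poly[of v] by (metis poly_0)
    thus False using fam_escape[OF v, of 2] by simp
  qed
  have "{1, -1} \<subseteq> {x. poly (fam_poly v) x = 0}" by (auto simp: poly_fam_poly fam_def)
  hence "card {1, -1 :: complex} \<le> card {x. poly (fam_poly v) x = 0}"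
    by (intro card_mono poly_roots_finite ne)
  also have "\<dots> \<le> degree (fam_poly v)" by (rule card_poly_roots_bound[OF ne])
  finally show ?thesis by simp
qed

definition lip :: real where "lip = 1000 ^ 18"

lemma lip_ge_1: "lip \<ge> 1" by (simp add: lip_def)

lemma fam_lipschitz:
  fixes v x y :: "'a::real_normed_field"
  assumes v: "norm v \<le> 2" and x: "norm x \<le> 2" and y: "norm y \<le> 2"
  shows "norm (fam v x - fam v y) \<le> lip * norm (x - y)"
proof -
  have sq: "norm (z\<^sup>2) \<le> 4" "norm ((z\<^sup>2 - 1)\<^sup>2) \<le> 25" if "norm z \<le> 2" for z :: 'a
  proof -
    show a: "norm (z\<^sup>2) \<le> 4" using power_mono[OF that, of 2] by (simp add: norm_power)
    have "norm (z\<^sup>2 - 1) \<le> 5" using norm_triangle_ineq4[of "z\<^sup>2" 1] a by simp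
    from power_mono[OF this, of 2] show "norm ((z\<^sup>2 - 1)\<^sup>2) \<le> 25" by (simp add: norm_power)
  qed
  define s t where "s = (x\<^sup>2 - 1)\<^sup>2" and "t = (y\<^sup>2 - 1)\<^sup>2"
  have st: "norm s \<le> 25" "norm t \<le> 25" using sq x y by (auto simp: s_def t_def)
  have 1: "norm (x + y) \<le> 4" using norm_triangle_ineq[of x y] x y by simp
  have 2: "norm (x\<^sup>2 + y\<^sup>2 - 2) \<le> 10"
    using norm_triangle_ineq4[of "x\<^sup>2 + y\<^sup>2" 2] norm_triangle_ineq[of "x\<^sup>2" "y\<^sup>2"] sq(1)[OF x] sq(1)[OF y] by simp
  have "norm (s + t - 1) \<le> 51"
    using norm_triangle_ineq4[of "s + t" 1] norm_triangle_ineq[of s t] st by simp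
  hence "norm (of_real lam * (s + t - 1)) \<le> lam * 51"
    using lam_pos by (simp add: norm_mult)
  hence 3: "norm (of_real lam * (s + t - 1) + v) \<le> 52 * lam"
    using norm_triangle_ineq[of "of_real lam * (s + t - 1)" v] v lam_ge by linarith
  have "norm (fam v x - fam v y) \<le> norm (x - y) * 4 * 10 * (52 * lam)"
    unfolding fam_diff norm_mult s_def[symmetric] t_def[symmetric]
    using 1 2 3 by (intro mult_mono) auto
  also have "\<dots> = 2080 * lam * norm (x - y)" by simp
  also have "\<dots> \<le> lip * norm (x - y)" by (intro mult_right_mono) (auto simp: lam_def lip_def)
  finally show ?thesis .
qed

lemma escape_iter:
  fixes v z :: "'a::real_normed_field"
  assumes v: "norm v \<le> 2" and z: "norm z \<ge> 7/4"
  shows "norm ((fam v ^^ n) z) \<ge> 2 ^ n * norm z"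
proof (induction n)
  case (Suc n)
  have "1 * (7/4) \<le> 2 ^ n * norm z" using z by (intro mult_mono) auto
  hence "norm (fam v ((fam v ^^ n) z)) \<ge> 2 * norm ((fam v ^^ n) z)" using Suc by (intro fam_escape[OF v]) simp
  thus ?case using Suc by simp
qed simp

text \<open>Near an escaping point the iterates tend to \<^const>\<open>Infty\<close> uniformly.\<close>

lemma escape_fatou:
  assumes v: "norm v \<le> 2" and z: "norm ((fam v ^^ N) z) > 7/4"
  shows "Fin z \<in> fatou_set (sphere_map (fam_poly v))"
proof -
  let ?f = "sphere_map (fam_poly v)"
  define U where "U = Fin ` {x. 7/4 < norm ((fam v ^^ N) x)}"
  have "open U" unfolding U_def by (intro open_Fin_image open_Collect_less continuous_intros)
  moreover have "Fin z \<in> U" using z by (simp add: U_def)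
  moreover have "uniform_limit U (\<lambda>n. ?f ^^ n) (\<lambda>_. Infty) sequentially"
  proof (rule uniform_limitI)
    fix e :: real assume e: "e > 0"
    obtain k where k: "4 / e < 2 ^ k" using real_arch_pow[of 2 "4 / e"] by auto
    have "dist ((?f ^^ n) x) Infty < e" if n: "n \<ge> N + k" and x: "x \<in> U" for n x
    proof -
      obtain w where w: "x = Fin w" "7/4 < norm ((fam v ^^ N) w)" using x by (auto simp: U_def)
      have "n = (n - N) + N" using n by simp
      hence "(fam v ^^ n) w = (fam v ^^ (n - N)) ((fam v ^^ N) w)" by (metis funpow_add comp_apply)
      hence "norm ((fam v ^^ n) w) \<ge> 2 ^ (n - N) * norm ((fam v ^^ N) w)"
        using escape_iter[OF v, of "(fam v ^^ N) w" "n - N"] w by simp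
      moreover have "2 ^ k * 1 \<le> 2 ^ (n - N) * norm ((fam v ^^ N) w)"
        using n w by (intro mult_mono power_increasing) auto
      ultimately have big: "norm ((fam v ^^ n) w) > 4 / e" using k by simp
      moreover have "0 < 4 / e" using e by simp
      ultimately have pos: "norm ((fam v ^^ n) w) > 0" by linarith
      have "dist ((?f ^^ n) x) Infty \<le> 4 / norm ((fam v ^^ n) w)"
        unfolding w(1) sphere_iter_Fin using pos by (intro dist_Fin_Infty_le) auto
      also have "\<dots> < e" using big e pos by (simp add: field_simps)
      finally show ?thesis .
    qed
    thus "\<forall>\<^sub>F n in sequentially. \<forall>x\<in>U. dist ((?f ^^ n) x) Infty < e"
      by (auto simp: eventually_sequentially)
  qed
  ultimately show ?thesis
    using uniform_limit_imp_normal_family unfolding fatou_set_def by blast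
qed

lemma julia_bounded_orbit:
  assumes v: "norm v \<le> 2" and x: "x \<in> julia_set (sphere_map (fam_poly v))"
  obtains z where "x = Fin z" "\<And>n. norm ((fam v ^^ n) z) \<le> 7/4"
proof (cases x)
  case (Fin z)
  have "norm ((fam v ^^ n) z) \<le> 7/4" for n
    using escape_fatou[OF v, of n z] x Fin by (force simp: julia_set_def not_less[symmetric])
  thus ?thesis using that Fin by blast
next
  case Infty
  thus ?thesis using x Infty_notin_julia_set[OF degree_fam_poly[OF v]] by blast
qed

text \<open>A point very close to an orbit in the disc of radius \<open>7/4\<close> stays in the disc of radius 2 for a fixed
  number of steps.\<close>

lemma iter_near_bounded:
  fixes v x z :: "'a::real_normed_field"
  assumes v: "norm v \<le> 2" and z: "\<And>n. norm ((fam v ^^ n) z) \<le> 7/4"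
    and x: "norm (x - z) \<le> 1 / (4 * lip ^ k)" and j: "j \<le> k"
  shows "norm ((fam v ^^ j) x) \<le> 2"
proof -
  have near: "norm ((fam v ^^ j) x) \<le> 2"
    if "j \<le> k" "norm ((fam v ^^ j) x - (fam v ^^ j) z) \<le> lip ^ j * norm (x - z)" for j
  proof -
    have "lip ^ j * norm (x - z) \<le> lip ^ k * (1 / (4 * lip ^ k))"
      using that(1) lip_ge_1 x by (intro mult_mono power_increasing) (use lip_ge_1 in auto)
    also have "\<dots> = 1/4" using lip_ge_1 by simp
    finally show ?thesis
      using that(2) z[of j] norm_triangle_ineq[of "(fam v ^^ j) x - (fam v ^^ j) z" "(fam v ^^ j) z"] by simp
  qed
  have main: "norm ((fam v ^^ j) x - (fam v ^^ j) z) \<le> lip ^ j * norm (x - z)" if "j \<le> k" for j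
    using that
  proof (induction j)
    case (Suc j)
    have "norm (fam v ((fam v ^^ j) x) - fam v ((fam v ^^ j) z)) \<le>
        lip * norm ((fam v ^^ j) x - (fam v ^^ j) z)"
      using Suc near[of j] z[of j] by (intro fam_lipschitz[OF v]) auto
    also have "\<dots> \<le> lip * (lip ^ j * norm (x - z))" using Suc lip_ge_1 by (intro mult_left_mono) auto
    finally show ?case by (simp add: mult.assoc)
  qed simp
  show "norm ((fam v ^^ j) x) \<le> 2" using near[OF j main[OF j]] .
qed

lemma diameter_metric_le:
  assumes "S \<noteq> {}" "\<And>x y. x \<in> S \<Longrightarrow> y \<in> S \<Longrightarrow> dist x y \<le> d"
  shows "diameter S \<le> d"
  using assms by (auto simp: diameter_def intro!: cSUP_least)

context slow_critical_orbit
begin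

text \<open>The radius is so small that the images of the ball stay in the disc of radius 2 for seven more steps.
  Therefore \<open>shrink\<close> applies with \<open>n + 7\<close> in place of \<open>n\<close>, and the factor \<open>(1/2) ^ 7\<close> absorbs the
  constant 16 and the ratio 4 of the two distances, so that no constant is left in front of
  \<open>(1/2) ^ n\<close>.\<close>

lemma exp_shrink_fam: "exp_shrink (sphere_map (fam_poly v))"
proof -
  let ?f = "sphere_map (fam_poly v)"
  define r :: real where "r = 1 / (36 * lip ^ 7)"
  have r: "r > 0" "r \<le> 1/36" "9 * r \<le> 1/4" "9 * r \<le> 1 / (4 * lip ^ 7)"
  proof -
    have "lip ^ 7 \<ge> 1" by (rule one_le_power[OF lip_ge_1])
    thus "r > 0" "r \<le> 1/36" "9 * r \<le> 1/4" "9 * r \<le> 1 / (4 * lip ^ 7)"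
      using lip_ge_1 by (simp_all add: r_def divide_le_eq_1)
  qed
  have "diameter W < 1 / 2 ^ n"
    if \<zeta>: "\<zeta> \<in> julia_set ?f" and n: "n > 0" and W: "W \<in> components ((?f ^^ n) -` ball \<zeta> r)" for \<zeta> n W
  proof -
    obtain z where z: "\<zeta> = Fin z" and zb: "\<And>n. norm (F n z) \<le> 7/4"
      by (rule julia_bounded_orbit[OF v_bound \<zeta>]) blast
    have z2: "cmod z \<le> 2" using zb[of 0] by simp
    have fin: "\<exists>x. w = Fin x \<and> (\<forall>i\<le>n + 7. norm (F i x) \<le> 2)" if "w \<in> W" for w
    proof -
      have wb: "dist \<zeta> ((?f ^^ n) w) < r" using in_components_subset[OF W] that by auto
      show ?thesis
      proof (cases w)
        case (Fin x)
        define y where "y = F n x"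
        have "cmod (y - z) \<le> r * (1 + cmod z)\<^sup>2"
        proof (rule cmod_le_dist_Fin)
          show "dist (Fin z) (Fin y) \<le> r" using wb by (simp add: Fin z sphere_iter_Fin y_def)
          show "r * (1 + cmod z) \<le> 1" using mult_mono[OF r(2), of "1 + cmod z" 3] z2 by simp
        qed
        also have "\<dots> \<le> r * 3\<^sup>2" using z2 r by (intro mult_left_mono power_mono) auto
        finally have yz: "cmod (y - z) \<le> 9 * r" by simp
        have y2: "cmod y \<le> 2" using norm_triangle_ineq[of "y - z" z] yz r(3) zb[of 0] by simp
        have "norm (F i x) \<le> 2" if "i \<le> n + 7" for i
        proof (cases "i \<le> n")
          case True
          show ?thesis
          proof (rule ccontr)
            assume a: "\<not> norm (F i x) \<le> 2"
            have "y = F (n - i) (F i x)" using True funpow_add[of "n - i" i "fam v"] by (simp add: y_def)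
            hence "cmod y \<ge> 2 ^ (n - i) * norm (F i x)" using escape_iter[OF v_bound, of "F i x" "n - i"] a by simp
            moreover have "1 * norm (F i x) \<le> 2 ^ (n - i) * norm (F i x)" by (intro mult_right_mono) auto
            ultimately show False using a y2 by simp
          qed
        next
          case False
          hence "F i x = F (i - n) y" using funpow_add[of "i - n" n "fam v"] by (simp add: y_def)
          thus ?thesis using iter_near_bounded[OF v_bound zb, of y 7 "i - n"] yz r(4) \<open>i \<le> n + 7\<close> by simp
        qed
        thus ?thesis using Fin by blast
      next
        case Infty
        thus ?thesis using wb dist_Fin_Infty_ge[OF z2] r(2) by (simp add: z sphere_iter_Infty)
      qed
    qed
    define X where "X = inv Fin ` W"
    have WX: "W = Fin ` X" 
    proof (intro equalityI subsetI)
      fix w assume w: "w \<in> W"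
      then obtain x where x: "w = Fin x" using fin by blast
      hence "x = inv Fin w" by simp
      thus "w \<in> Fin ` X" using x w unfolding X_def by blast
    next
      fix w assume "w \<in> Fin ` X"
      then obtain w' where w': "w' \<in> W" "w = Fin (inv Fin w')" unfolding X_def by blast
      then obtain x where "w' = Fin x" using fin by blast
      thus "w \<in> W" using w' by simp
    qed
    have "connected X" unfolding X_def
      by (intro connected_continuous_image continuous_on_subset[OF continuous_on_inv_Fin]
          in_components_connected[OF W]) (use fin in auto)
    moreover have "norm (F i x) \<le> 2" if ix: "i \<le> n + 7" "x \<in> X" for i x
    proof -
      obtain x' where x': "Fin x = Fin x'" "\<forall>i\<le>n + 7. norm (F i x') \<le> 2"
        using fin[of "Fin x"] ix(2) unfolding WX by blast
      thus ?thesis using ix(1) by simp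
    qed
    ultimately have X: "norm (x - y) \<le> 16 * (1/2) ^ (n + 7)" if "x \<in> X" "y \<in> X" for x y
      using that by (rule shrink)
    have "diameter W \<le> 4 * (16 * (1/2) ^ (n + 7))"
    proof (rule diameter_metric_le)
      show "W \<noteq> {}" by (rule in_components_nonempty[OF W])
      fix a b assume "a \<in> W" "b \<in> W"
      then obtain x y where xy: "a = Fin x" "b = Fin y" "x \<in> X" "y \<in> X" by (auto simp: WX)
      show "dist a b \<le> 4 * (16 * (1/2) ^ (n + 7))"
        using dist_Fin_le[of x y] X[OF xy(3,4)] by (simp add: xy)
    qed
    also have "\<dots> = 1/2 * (1/2) ^ n" by (simp add: power_add power_divide)
    also have "\<dots> < 1 / 2 ^ n" by (simp add: power_divide field_simps)
    finally show ?thesis .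
  qed
  hence "\<forall>\<zeta>\<in>julia_set ?f. \<forall>n>0. \<forall>W\<in>components ((?f ^^ n) -` ball \<zeta> r). diameter W < 1 / 2 ^ n"
    by blast
  hence "\<exists>r>0. \<forall>\<zeta>\<in>julia_set ?f. \<forall>n>0. \<forall>W\<in>components ((?f ^^ n) -` ball \<zeta> r). diameter W < 1 / 2 ^ n"
    using r(1) by blast
  moreover have "(2::real) > 1" by simp
  ultimately show ?thesis unfolding exp_shrink_def by blast
qed

lemma one_orbit_bound: "norm (F n 1) \<le> 2"
proof (cases n)
  case (Suc k)
  show ?thesis
  proof (cases k)
    case (Suc m)
    have "F n 1 = F m v" using \<open>n = Suc k\<close> Suc by (simp only: funpow_Suc_right comp_apply fam_simps)
    thus ?thesis using orbit_bound by simp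
  qed (use Suc in simp)
qed simp

text \<open>The orbit of 1 is bounded, but by \<open>shrink\<close> every disc around 1 contains an escaping point. A locally
  uniform limit of iterates would take the value \<^const>\<open>Infty\<close> at the escaping points, while an iterate
  close to this limit is continuous at 1 and maps 1 into the disc of radius 2.\<close>

lemma one_in_julia: "Fin 1 \<in> julia_set (sphere_map (fam_poly v))"
proof -
  let ?f = "sphere_map (fam_poly v)"
  have False if "Fin 1 \<in> fatou_set ?f"
  proof -
    from that obtain U where U: "open U" "Fin 1 \<in> U" "normal_family_on U (range (\<lambda>n. ?f ^^ n))"
      by (auto simp: fatou_set_def)
    obtain e where e: "e > 0" "\<And>y. dist y (Fin 1) < e \<Longrightarrow> y \<in> U"
      using U(1,2) unfolding open_dist by blast
    define K where "K = Fin ` cball 1 (e / 8)"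
    have K: "compact K" unfolding K_def by (intro compact_continuous_image continuous_on_Fin) auto
    have "K \<subseteq> U"
    proof
      fix y assume "y \<in> K"
      then obtain x where x: "y = Fin x" "cmod (x - 1) \<le> e / 8" by (auto simp: K_def dist_norm norm_minus_commute)
      show "y \<in> U" using e dist_Fin_le[of x 1] x by (intro e(2)) simp
    qed
    have "\<exists>(\<sigma> :: nat \<Rightarrow> nat) h. strict_mono \<sigma> \<and> (\<forall>K. compact K \<and> K \<subseteq> U \<longrightarrow>
        uniform_limit K (\<lambda>k. ?f ^^ \<sigma> k) h sequentially)"
      by (rule U(3)[unfolded normal_family_on_def, rule_format]) (rule order_refl)
    then obtain \<sigma> h where \<sigma>: "strict_mono (\<sigma> :: nat \<Rightarrow> nat)" and
      lim_all: "\<forall>K. compact K \<and> K \<subseteq> U \<longrightarrow> uniform_limit K (\<lambda>k. ?f ^^ \<sigma> k) h sequentially"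
      by (elim exE conjE)
    have lim: "uniform_limit K (\<lambda>k. ?f ^^ \<sigma> k) h sequentially"
      using lim_all K \<open>K \<subseteq> U\<close> by simp
    \<comment> \<open>On the sphere, points of the disc of radius 2 are at distance at least \<open>1/2\<close> from \<^const>\<open>Infty\<close>; two errors of \<open>1/8\<close> stay below this.\<close>
    obtain k0 where k0: "\<And>k x. k \<ge> k0 \<Longrightarrow> x \<in> K \<Longrightarrow> dist ((?f ^^ \<sigma> k) x) (h x) < 1/8"
      using uniform_limitD[OF lim, of "1/8"] by (auto simp: eventually_sequentially)
    have cont: "continuous_on UNIV (\<lambda>x. Fin (F (\<sigma> k0) x))"
      by (intro continuous_on_compose2[OF continuous_on_Fin[of UNIV]] continuous_intros) auto
    have "\<exists>d>0. \<forall>x'\<in>UNIV. dist x' 1 < d \<longrightarrow> dist (Fin (F (\<sigma> k0) x')) (Fin (F (\<sigma> k0) 1)) < 1/8"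
      by (rule cont[unfolded continuous_on_iff, rule_format]) simp_all
    then obtain d where d: "d > 0" "\<And>x. dist x 1 < d \<Longrightarrow> dist (Fin (F (\<sigma> k0) x)) (Fin (F (\<sigma> k0) 1)) < 1/8"
      by blast
    define \<delta> where "\<delta> = min (d / 2) (e / 8)"
    have \<delta>: "\<delta> > 0" using d e by (simp add: \<delta>_def)
    have "\<exists>x\<in>cball 1 \<delta>. \<exists>N. norm (F N x) > 2"
    proof (rule ccontr)
      assume contr: "\<not> ?thesis"
      have b: "norm (F i x) \<le> 2" if "x \<in> cball 1 \<delta>" for i x
      proof (rule ccontr)
        assume "\<not> norm (F i x) \<le> 2"
        hence "norm (F i x) > 2" by simp
        thus False using contr that by blast
      qed
      obtain n where n: "16 / \<delta> < 2 ^ n" using real_arch_pow[of 2 "16 / \<delta>"] by auto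
      have "norm ((1 + of_real \<delta>) - 1 :: complex) \<le> 16 * (1/2) ^ n"
      proof (rule shrink[of "cball 1 \<delta>"])
        show "norm (F i x) \<le> 2" if "x \<in> cball 1 \<delta>" for i x by (rule b[OF that])
      qed (use \<delta> in \<open>auto simp: dist_norm\<close>)
      hence "\<delta> \<le> 16 / 2 ^ n" using \<delta> by (simp add: power_divide)
      thus False using n \<delta> by (simp add: field_simps)
    qed
    then obtain x N where x: "x \<in> cball 1 \<delta>" "norm (F N x) > 2" by blast
    have xK: "Fin x \<in> K" and xd: "dist x 1 < d" using x \<delta> d by (auto simp: K_def \<delta>_def dist_commute)
    have "h (Fin x) = Infty"
    proof (rule ccontr)
      assume "h (Fin x) \<noteq> Infty"
      hence pos: "dist (h (Fin x)) Infty > 0" by simp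
      define \<epsilon> where "\<epsilon> = dist (h (Fin x)) Infty / 2"
      have \<epsilon>: "\<epsilon> > 0" using pos by (simp add: \<epsilon>_def)
      obtain k1 where k1: "\<And>k. k \<ge> k1 \<Longrightarrow> dist ((?f ^^ \<sigma> k) (Fin x)) (h (Fin x)) < \<epsilon>"
        using uniform_limitD[OF lim \<epsilon>] xK by (auto simp: eventually_sequentially)
      obtain m where m: "4 / \<epsilon> < 2 ^ m" using real_arch_pow[of 2 "4 / \<epsilon>"] by auto
      define k where "k = max k1 (N + m)"
      have sk: "\<sigma> k \<ge> N + m" using seq_suble[OF \<sigma>, of k] by (simp add: k_def)
      have "F (\<sigma> k) x = F (\<sigma> k - N) (F N x)"
        using sk funpow_add[of "\<sigma> k - N" N "fam v"] by simp
      hence "norm (F (\<sigma> k) x) \<ge> 2 ^ (\<sigma> k - N) * norm (F N x)"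
        using escape_iter[OF v_bound, of "F N x" "\<sigma> k - N"] x by simp
      moreover have "2 ^ m * 1 \<le> 2 ^ (\<sigma> k - N) * norm (F N x)"
        using sk x by (intro mult_mono power_increasing) auto
      ultimately have big: "norm (F (\<sigma> k) x) > 4 / \<epsilon>" using m by simp
      moreover have "4 / \<epsilon> > 0" using \<epsilon> by simp
      ultimately have p: "norm (F (\<sigma> k) x) > 0" by linarith
      have "dist (Fin (F (\<sigma> k) x)) Infty \<le> 4 / norm (F (\<sigma> k) x)"
        using p by (intro dist_Fin_Infty_le) auto
      also have "\<dots> < \<epsilon>" using big \<epsilon> p by (simp add: field_simps)
      finally have "dist (h (Fin x)) Infty < \<epsilon> + \<epsilon>"
        using k1[of k] dist_triangle2[of "h (Fin x)" Infty "Fin (F (\<sigma> k) x)"]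
          dist_triangle[of "h (Fin x)" Infty "Fin (F (\<sigma> k) x)"]
        by (simp add: k_def sphere_iter_Fin dist_commute)
      thus False by (simp add: \<epsilon>_def)
    qed
    hence "dist (Fin (F (\<sigma> k0) x)) Infty < 1/8" using k0[OF order_refl xK] by (simp add: sphere_iter_Fin)
    hence "dist (Fin (F (\<sigma> k0) 1)) Infty < 1/8 + 1/8"
      using d(2)[OF xd] dist_triangle[of "Fin (F (\<sigma> k0) 1)" Infty "Fin (F (\<sigma> k0) x)"]
      by (simp add: dist_commute)
    thus False using dist_Fin_Infty_ge[OF one_orbit_bound[of "\<sigma> k0"]] by simp
  qed
  thus ?thesis by (auto simp: julia_set_def)
qed

end

lemma fam_deriv_critical:
  fixes v :: complex
  shows "deriv (fam v) 0 = 0" "deriv (fam v) 1 = 0"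
proof -
  have "(fam v has_field_derivative 0) (at 0)" "(fam v has_field_derivative 0) (at 1)"
    unfolding fam_def by (auto intro!: derivative_eq_intros)
  thus "deriv (fam v) 0 = 0" "deriv (fam v) 1 = 0" by (auto dest!: DERIV_imp_deriv)
qed

text \<open>Already the first derivative at the critical value \<open>fam v 1 = 0\<close> vanishes.\<close>

lemma one_not_collet_eckmann: "\<not> collet_eckmann (fam_poly v) 1"
proof
  assume "collet_eckmann (fam_poly v) 1"
  then obtain C \<theta> where C: "C > 0" "\<theta> > 1"
    and ce: "\<And>n. n > 0 \<Longrightarrow> cmod (deriv (fam v ^^ n) 0) > C * \<theta> ^ n"
    unfolding collet_eckmann_def poly_fam_poly fam_simps by blast
  have "fam v ^^ 1 = fam v" by (rule ext) simp
  hence "C * \<theta> < 0" using ce[of 1] by (simp add: fam_deriv_critical)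
  thus False using C by (simp add: mult_less_0_iff)
qed

section \<open>Itineraries\<close>

text \<open>
  A letter names the real position of an orbit point: near \<open>\<surd>2\<close>, near \<open>-\<surd>2\<close>, just below 1, or just below 0.
  The number in the last two is the time for which the orbit, after leaving the folds, repeats the
  beginning of the itinerary of \<open>v\<close>; it controls the depth of the visit.
\<close>

datatype letter = NearPlus | NearMinus | Near1 nat | Near0 nat

text \<open>By \<open>crit_dist_lower\<close>, the distance to the critical points is at least \<open>1000\<close> to minus this power.\<close>

fun loss :: "letter \<Rightarrow> nat" where
  "loss NearPlus = 0" | "loss NearMinus = 0" | "loss (Near1 m) = 9 * m + 14" | "loss (Near0 m) = 9 * m + 14"

text \<open>
  The new visit is followed by \<^term>\<open>word k\<close> and the letter for \<open>-\<surd>2\<close>, whereas the whole word starts with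
  \<^term>\<open>word k\<close> and the letter for \<open>\<surd>2\<close>. This is the deviation that keeps the orbit to the left of \<open>v\<close>
  after the visit, as the fold at 0 requires. The long block before the visit pays for it; its
  length is odd, so that each word contains an even number of letters for \<open>-\<surd>2\<close>, where the map
  reverses the orientation.
\<close>

fun word :: "nat \<Rightarrow> letter list" where
  "word 0 = [NearPlus]"
| "word (Suc k) = word k @ NearPlus # replicate (18 * length (word k) + 29) NearMinus @
     [Near1 (length (word k)), Near0 (length (word k))] @ word k @ [NearMinus]"

lemma word_prefix_le: "j \<le> k \<Longrightarrow> \<exists>zs. word k = word j @ zs"
  by (induction k rule: dec_induct) auto

lemma word_prefix_less: "j < k \<Longrightarrow> \<exists>zs. word k = word j @ NearPlus # zs"
  using word_prefix_le[of "Suc j" k] by auto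

lemma word_hd: "\<exists>zs. word k = NearPlus # zs"
  using word_prefix_le[of 0 k] by simp

lemma length_word: "length (word k) > k"
  by (induction k) auto

lemma even_NearMinus_word: "even (length (filter ((=) NearMinus) (word k)))"
  by (induction k) auto

definition loss_bounded :: "letter list \<Rightarrow> bool" where
  "loss_bounded ws \<longleftrightarrow> (\<forall>n. sum_list (map loss (take n ws)) \<le> n)"

lemma loss_bounded_total: "loss_bounded ws \<Longrightarrow> sum_list (map loss ws) \<le> length ws"
  unfolding loss_bounded_def by (drule spec[of _ "length ws"]) simp

lemma loss_bounded_append:
  assumes "loss_bounded xs" "loss_bounded ys"
  shows "loss_bounded (xs @ ys)"
  unfolding loss_bounded_def
proof
  fix n
  have "sum_list (map loss (take (n - length xs) ys)) \<le> n - length xs"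
    "sum_list (map loss (take n xs)) \<le> n"
    using assms unfolding loss_bounded_def by blast+
  thus "sum_list (map loss (take n (xs @ ys))) \<le> n"
    using loss_bounded_total[OF assms(1)] by (cases "n \<le> length xs") simp_all
qed

lemma loss_bounded_free: "\<forall>l\<in>set ws. loss l = 0 \<Longrightarrow> loss_bounded ws"
  unfolding loss_bounded_def
proof
  fix n assume "\<forall>l\<in>set ws. loss l = 0"
  hence "map loss (take n ws) = map (\<lambda>_. 0) (take n ws)" by (auto dest: in_set_takeD)
  thus "sum_list (map loss (take n ws)) \<le> n" by (simp only: sum_list_0)
qed

text \<open>A visit enters with two lossy letters; the letters before it have to pay for both in advance.\<close>

lemma loss_bounded_append_pair:
  assumes "loss_bounded xs" "sum_list (map loss xs) + loss a + loss b \<le> length xs + 1"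
  shows "loss_bounded (xs @ [a, b])"
  unfolding loss_bounded_def
proof
  fix n
  have xs: "sum_list (map loss (take n xs)) \<le> n" using assms(1) unfolding loss_bounded_def by blast
  consider "n \<le> length xs" | "n = length xs + 1" | "n \<ge> length xs + 2" by linarith
  thus "sum_list (map loss (take n (xs @ [a, b]))) \<le> n"
  proof cases
    case 3
    hence "take n (xs @ [a, b]) = xs @ [a, b]" by simp
    thus ?thesis using assms(2) 3 by simp
  qed (use xs assms(2) in auto)
qed

lemma loss_bounded_word: "loss_bounded (word k)"
proof (induction k)
  case (Suc k)
  define m where "m = length (word k)"
  define xs where "xs = word k @ NearPlus # replicate (18 * m + 29) NearMinus"
  have "loss_bounded xs" unfolding xs_def by (intro loss_bounded_append Suc loss_bounded_free) auto
  moreover have "sum_list (map loss xs) \<le> m"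
    using loss_bounded_total[OF Suc] by (simp add: xs_def m_def sum_list_replicate)
  moreover have "length xs = 19 * m + 30" by (simp add: xs_def m_def)
  ultimately have "loss_bounded (xs @ [Near1 m, Near0 m])" by (intro loss_bounded_append_pair) auto
  moreover have "loss_bounded [NearMinus]" by (intro loss_bounded_free) auto
  ultimately have "loss_bounded ((xs @ [Near1 m, Near0 m]) @ word k @ [NearMinus])"
    by (rule loss_bounded_append[OF _ loss_bounded_append[OF Suc]])
  thus ?case by (simp add: xs_def m_def)
next
  case 0
  show ?case by (rule loss_bounded_free) simp
qed

text \<open>
  Every visit to 1 continues at 0, and after 0 comes an earlier word with the deviation described
  above.
\<close>

fun admissible :: "nat \<Rightarrow> letter list \<Rightarrow> bool" where
  "admissible k [] = True"
| "admissible k (NearPlus # ws) = admissible k ws"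
| "admissible k (NearMinus # ws) = admissible k ws"
| "admissible k (Near1 m # ws) = ((\<exists>zs. ws = Near0 m # zs) \<and> admissible k ws)"
| "admissible k (Near0 m # ws) = ((\<exists>j<k. m = length (word j) \<and> (\<exists>zs. ws = word j @ NearMinus # zs)) \<and> admissible k ws)"

lemma admissible_append: "admissible k xs \<Longrightarrow> admissible k ys \<Longrightarrow> admissible k (xs @ ys)"
proof (induction k xs rule: admissible.induct)
  case (5 k m ws)
  then obtain j zs where "j < k" "m = length (word j)" "ws = word j @ NearMinus # zs"
    unfolding admissible.simps by blast
  hence "\<exists>j<k. m = length (word j) \<and> (\<exists>zs. ws @ ys = word j @ NearMinus # zs)"
    by (intro exI[of _ j] conjI exI[of _ "zs @ ys"]) simp_all
  thus ?case using 5 unfolding admissible.simps append_Cons by blast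
qed auto

lemma admissible_suffix: "admissible k (xs @ ys) \<Longrightarrow> admissible k ys"
  by (induction k xs rule: admissible.induct) auto

lemma admissible_mono: "admissible k xs \<Longrightarrow> k \<le> k' \<Longrightarrow> admissible k' xs"
proof (induction k xs rule: admissible.induct)
  case (5 k m ws)
  thus ?case unfolding admissible.simps using less_le_trans by blast
qed auto

lemma admissible_replicate_NearMinus: "admissible k (replicate n NearMinus)"
  by (induction n) auto

lemma admissible_word: "admissible k (word k)"
proof (induction k)
  case (Suc k)
  have u: "admissible (Suc k) (word k)" using admissible_mono[OF Suc, of "Suc k"] by simp
  have ul: "admissible (Suc k) (word k @ [NearMinus])" by (intro admissible_append u) simp
  have "admissible (Suc k) (Near1 (length (word k)) # Near0 (length (word k)) # word k @ [NearMinus])"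
  proof -
    have "\<exists>j<Suc k. length (word k) = length (word j) \<and> (\<exists>zs. word k @ [NearMinus] = word j @ NearMinus # zs)"
      by (intro exI[of _ k] conjI exI[of _ "[]"]) simp_all
    thus ?thesis unfolding admissible.simps using ul by blast
  qed
  hence "admissible (Suc k) (replicate (18 * length (word k) + 29) NearMinus @
      Near1 (length (word k)) # Near0 (length (word k)) # word k @ [NearMinus])"
    by (intro admissible_append admissible_replicate_NearMinus)
  hence "admissible (Suc k) (NearPlus # replicate (18 * length (word k) + 29) NearMinus @
      Near1 (length (word k)) # Near0 (length (word k)) # word k @ [NearMinus])" by simp
  from admissible_append[OF u this] show ?case by simp
qed simp

section \<open>Real parameters with prescribed itinerary\<close>

text \<open>
  \<open>root_hi\<close> and \<open>root_lo\<close> are the solutions near 1 and near 0 of the quadratic equation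
  \<open>s * (lam * (s - 1) + v) = y\<close>, and \<open>disc\<close> is its discriminant.
\<close>

definition disc :: "real \<Rightarrow> real \<Rightarrow> real" where "disc v y = (lam - v)\<^sup>2 + 4 * lam * y"
definition root_hi :: "real \<Rightarrow> real \<Rightarrow> real" where "root_hi v y = (lam - v + sqrt (disc v y)) / (2 * lam)"
definition root_lo :: "real \<Rightarrow> real \<Rightarrow> real" where "root_lo v y = (lam - v - sqrt (disc v y)) / (2 * lam)"

text \<open>
  The folds have real inverse branches only over \<open>y \<le> 0\<close> and \<open>y \<le> v\<close>. Truncating \<open>y\<close> makes all branches
  total, continuous and monotone; on the itineraries that are used here the truncation turns out
  to have no effect.
\<close>

fun branch :: "letter \<Rightarrow> real \<Rightarrow> real \<Rightarrow> real" where
  "branch NearPlus v y = sqrt (1 + sqrt (root_hi v y))"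
| "branch NearMinus v y = - sqrt (1 + sqrt (root_hi v y))"
| "branch (Near1 m) v y = sqrt (1 - sqrt (root_lo v (min y 0)))"
| "branch (Near0 m) v y = - sqrt (1 - sqrt (root_hi v (min y v)))"

fun cell :: "letter \<Rightarrow> real set" where
  "cell NearPlus = {6/5..2}" | "cell NearMinus = {-2..-6/5}" | "cell (Near1 m) = {1/2..1}" | "cell (Near0 m) = {-1/2..0}"

lemma closed_cell: "closed (cell l)" by (cases l) auto
lemma cell_bound: "x \<in> cell l \<Longrightarrow> \<bar>x\<bar> \<le> 2" by (cases l) auto

lemma continuous_on_branch [continuous_intros]:
  assumes "continuous_on S f" "continuous_on S g"
  shows "continuous_on S (\<lambda>x. branch l (f x) (g x))"
  by (cases l) (use lam_pos in \<open>auto simp: root_hi_def root_lo_def disc_def intro!: continuous_intros assms\<close>)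

lemma sqrt_disc_bounds:
  assumes "1 \<le> v" "v \<le> 2" "-2 \<le> y" "y \<le> 2"
  shows "lam - 10 \<le> sqrt (disc v y)" "sqrt (disc v y) \<le> lam + 10" "0 \<le> disc v y"
proof -
  have ly: "lam * y \<le> lam * 2" "lam * (-2) \<le> lam * y" 
    using mult_left_mono[OF assms(4), of lam] mult_left_mono[OF assms(3), of lam] lam_pos by auto
  have lv: "lam * v \<le> lam * 2" "lam * 0 \<le> lam * v" using assms lam_pos by (auto intro!: mult_left_mono)
  have v2: "v\<^sup>2 \<le> 4" using power_mono[of v 2 2] assms by simp
  have eq: "disc v y = lam\<^sup>2 - 2 * (lam * v) + v\<^sup>2 + 4 * (lam * y)"
    by (simp add: disc_def power2_eq_square algebra_simps)
  have "(lam - 10)\<^sup>2 = lam\<^sup>2 - 20 * lam + 100" by (simp add: power2_eq_square algebra_simps)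
  also have "\<dots> \<le> disc v y" using ly lv lam_ge zero_le_power2[of v] unfolding eq by linarith
  finally have lo: "(lam - 10)\<^sup>2 \<le> disc v y" .
  have "disc v y \<le> lam\<^sup>2 + 20 * lam + 100" using ly lv v2 lam_ge unfolding eq by linarith
  also have "\<dots> = (lam + 10)\<^sup>2" by (simp add: power2_eq_square algebra_simps)
  finally have hi: "disc v y \<le> (lam + 10)\<^sup>2" .
  show "lam - 10 \<le> sqrt (disc v y)" using lo by (rule real_le_rsqrt)
  show "sqrt (disc v y) \<le> lam + 10" using hi lam_pos by (intro real_le_lsqrt) auto
  show "0 \<le> disc v y" using lo zero_le_power2[of "lam - 10"] by linarith
qed

lemma root_equation:
  assumes "0 \<le> disc v y"
  shows "root_hi v y * (lam * (root_hi v y - 1) + v) = y"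
    "root_lo v y * (lam * (root_lo v y - 1) + v) = y"
proof -
  define b S where "b = lam - v" and "S = sqrt (disc v y)"
  have S: "S\<^sup>2 = b\<^sup>2 + 4 * lam * y" using assms by (simp add: S_def b_def disc_def)
  have gen: "s * (lam * (s - 1) + v) = y" if s: "2 * lam * s = b + e * S" and e: "e\<^sup>2 = 1" for s e
  proof -
    have "4 * lam * (s * (lam * (s - 1) + v)) = (2 * lam * s) * (2 * lam * s) - 2 * b * (2 * lam * s)"
      unfolding b_def by algebra
    also have "\<dots> = e\<^sup>2 * S\<^sup>2 - b\<^sup>2" unfolding s by algebra
    also have "\<dots> = 4 * lam * y" using e S by simp
    finally show ?thesis using lam_pos by simp
  qed
  show "root_hi v y * (lam * (root_hi v y - 1) + v) = y"
    by (rule gen[of _ 1]) (use lam_pos in \<open>auto simp: root_hi_def b_def S_def\<close>)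
  show "root_lo v y * (lam * (root_lo v y - 1) + v) = y"
    by (rule gen[of _ "-1"]) (use lam_pos in \<open>auto simp: root_lo_def b_def S_def\<close>)
qed

lemma root_bounds:
  assumes "1 \<le> v" "v \<le> 2" "-2 \<le> y" "y \<le> 2"
  shows "99/100 \<le> root_hi v y" "root_hi v y \<le> 101/100" "root_lo v y \<le> 1/100"
    "y \<le> v \<Longrightarrow> root_hi v y \<le> 1" "y \<le> 0 \<Longrightarrow> 0 \<le> root_lo v y"
proof -
  note b = sqrt_disc_bounds[OF assms]
  show "99/100 \<le> root_hi v y" "root_hi v y \<le> 101/100" "root_lo v y \<le> 1/100"
    using b lam_ge assms by (auto simp: root_hi_def root_lo_def field_simps)
  show "root_hi v y \<le> 1" if "y \<le> v"
  proof -
    have "disc v y \<le> (lam - v)\<^sup>2 + 4 * lam * v"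
      unfolding disc_def using that lam_pos by (intro add_left_mono mult_left_mono) auto
    also have "\<dots> = (lam + v)\<^sup>2" by algebra
    finally have "sqrt (disc v y) \<le> lam + v" using lam_pos assms by (intro real_le_lsqrt) auto
    thus ?thesis using lam_pos by (simp add: root_hi_def)
  qed
  show "0 \<le> root_lo v y" if "y \<le> 0"
  proof -
    have "lam * y \<le> 0" using that lam_pos by (simp add: mult_nonneg_nonpos)
    hence "disc v y \<le> (lam - v)\<^sup>2" unfolding disc_def by simp
    hence "sqrt (disc v y) \<le> lam - v" using lam_ge assms by (intro real_le_lsqrt) auto
    thus ?thesis using lam_pos by (simp add: root_lo_def)
  qed
qed

lemma sqrt_between: "0 \<le> a \<Longrightarrow> a\<^sup>2 \<le> x \<Longrightarrow> x \<le> b\<^sup>2 \<Longrightarrow> 0 \<le> b \<Longrightarrow> a \<le> sqrt x \<and> sqrt x \<le> b" for a b x :: real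
  by (auto intro: real_le_rsqrt real_le_lsqrt)

lemma branch_in_cell:
  assumes v: "1 \<le> v" "v \<le> 2" and y: "-2 \<le> y" "y \<le> 2"
  shows "branch l v y \<in> cell l"
proof (cases l)
  case NearPlus
  have "9/10 \<le> sqrt (root_hi v y) \<and> sqrt (root_hi v y) \<le> 11/10"
    by (rule sqrt_between) (use root_bounds[OF v y] in \<open>auto simp: power2_eq_square\<close>)
  hence "6/5 \<le> sqrt (1 + sqrt (root_hi v y)) \<and> sqrt (1 + sqrt (root_hi v y)) \<le> 2"
    by (intro sqrt_between) (auto simp: power2_eq_square)
  thus ?thesis using NearPlus by simp
next
  case NearMinus
  have "9/10 \<le> sqrt (root_hi v y) \<and> sqrt (root_hi v y) \<le> 11/10"
    by (rule sqrt_between) (use root_bounds[OF v y] in \<open>auto simp: power2_eq_square\<close>)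
  hence "6/5 \<le> sqrt (1 + sqrt (root_hi v y)) \<and> sqrt (1 + sqrt (root_hi v y)) \<le> 2"
    by (intro sqrt_between) (auto simp: power2_eq_square)
  thus ?thesis using NearMinus by simp
next
  case (Near1 m)
  have "0 \<le> sqrt (root_lo v (min y 0)) \<and> sqrt (root_lo v (min y 0)) \<le> 1/10"
    by (rule sqrt_between) (use root_bounds[OF v, of "min y 0"] y in \<open>auto simp: power2_eq_square\<close>)
  hence "1/2 \<le> sqrt (1 - sqrt (root_lo v (min y 0))) \<and> sqrt (1 - sqrt (root_lo v (min y 0))) \<le> 1"
    by (intro sqrt_between) (auto simp: power2_eq_square)
  thus ?thesis using Near1 by simp
next
  case (Near0 m)
  have mv: "min y v \<le> 2" "-2 \<le> min y v" "min y v \<le> v" using v y by auto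
  have "9/10 \<le> sqrt (root_hi v (min y v)) \<and> sqrt (root_hi v (min y v)) \<le> 1"
    by (rule sqrt_between) (use root_bounds(1,4)[OF v mv(2,1)] mv(3) in \<open>auto simp: power2_eq_square\<close>)
  hence "0 \<le> sqrt (1 - sqrt (root_hi v (min y v))) \<and> sqrt (1 - sqrt (root_hi v (min y v))) \<le> 1/2"
    by (intro sqrt_between) (auto simp: power2_eq_square)
  thus ?thesis using Near0 by simp
qed

lemma fam_branch:
  assumes v: "1 \<le> v" "v \<le> 2" and y: "-2 \<le> y" "y \<le> 2"
    and "\<And>m. l = Near1 m \<Longrightarrow> y \<le> 0" "\<And>m. l = Near0 m \<Longrightarrow> y \<le> v"
  shows "fam v (branch l v y) = y"
proof -
  note rb = root_bounds[OF v y] and re = root_equation[OF sqrt_disc_bounds(3)[OF v y]]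
  have hi: "fam v z = y" if "(z\<^sup>2 - 1)\<^sup>2 = root_hi v y" for z using re by (simp add: fam_def that)
  have lo: "fam v z = y" if "(z\<^sup>2 - 1)\<^sup>2 = root_lo v y" for z using re by (simp add: fam_def that)
  show ?thesis
  proof (cases l)
    case NearPlus
    show ?thesis by (rule hi) (use NearPlus rb in simp)
  next
    case NearMinus
    show ?thesis by (rule hi) (use NearMinus rb in simp)
  next
    case (Near1 m)
    hence y0: "y \<le> 0" using assms by blast
    have "sqrt (root_lo v y) \<le> 1" using rb by (intro real_le_lsqrt) auto
    thus ?thesis by (intro lo) (use Near1 rb(5)[OF y0] y0 in \<open>simp add: min_absorb1\<close>)
  next
    case (Near0 m)
    hence yv: "y \<le> v" using assms by blast
    have "sqrt (root_hi v y) \<le> 1" using rb(4)[OF yv] by (intro real_le_lsqrt) auto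
    thus ?thesis by (intro hi) (use Near0 rb yv in \<open>simp add: min_absorb1\<close>)
  qed
qed

lemma root_mono:
  assumes "y \<le> y'"
  shows "root_hi v y \<le> root_hi v y'" "root_lo v y' \<le> root_lo v y"
proof -
  have "disc v y \<le> disc v y'" unfolding disc_def using assms lam_pos by (intro add_left_mono mult_left_mono) auto
  hence "sqrt (disc v y) \<le> sqrt (disc v y')" by simp
  thus "root_hi v y \<le> root_hi v y'" "root_lo v y' \<le> root_lo v y"
    using lam_pos by (auto simp: root_hi_def root_lo_def intro!: divide_right_mono)
qed

lemma branch_mono:
  assumes "y \<le> y'"
  shows "l \<noteq> NearMinus \<Longrightarrow> branch l v y \<le> branch l v y'" "branch NearMinus v y' \<le> branch NearMinus v y"
proof -
  note r = root_mono[OF assms, of v]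
  have "root_lo v (min y' 0) \<le> root_lo v (min y 0)" "root_hi v (min y v) \<le> root_hi v (min y' v)"
    using assms by (auto intro!: root_mono)
  thus "l \<noteq> NearMinus \<Longrightarrow> branch l v y \<le> branch l v y'" "branch NearMinus v y' \<le> branch NearMinus v y"
    using r by (cases l; simp)+
qed

definition pull :: "letter list \<Rightarrow> real \<Rightarrow> real \<Rightarrow> real" where
  "pull ws v y = foldr (\<lambda>l. branch l v) ws y"

lemma pull_simps [simp]: "pull [] v y = y" "pull (l # ws) v y = branch l v (pull ws v y)"
  "pull (xs @ ys) v y = pull xs v (pull ys v y)"
  by (simp_all add: pull_def)

lemma pull_bound:
  assumes "1 \<le> v" "v \<le> 2" "\<bar>y\<bar> \<le> 2"
  shows "\<bar>pull ws v y\<bar> \<le> 2"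
proof (induction ws)
  case (Cons l ws)
  show ?case using cell_bound[OF branch_in_cell[OF assms(1,2), of "pull ws v y" l]] Cons by (simp add: abs_le_iff)
qed (use assms in simp)

lemma pull_mono:
  assumes "y \<le> y'"
  shows "if even (length (filter ((=) NearMinus) ws)) then pull ws v y \<le> pull ws v y' else pull ws v y' \<le> pull ws v y"
proof (induction ws)
  case (Cons l ws)
  thus ?case by (cases "l = NearMinus") (auto split: if_splits intro: branch_mono simp del: branch.simps)
qed (use assms in simp)

lemma continuous_on_pull: "continuous_on S (\<lambda>v. pull ws v y)"
  by (induction ws) (auto intro!: continuous_intros simp del: branch.simps)

text \<open>The map \<open>v \<mapsto> pull (word k) v 0\<close> sends \<open>[1, 2]\<close> into itself, so it has a fixed point. Its orbit has the
  itinerary \<^term>\<open>word k\<close> once no truncation occurs. At a letter for 0 the tail must be at most \<open>v\<close>. It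
  starts with some \<^term>\<open>word j\<close> followed by \<^const>\<open>NearMinus\<close>, while \<open>v\<close> itself starts with
  \<^term>\<open>word j\<close> followed by \<^const>\<open>NearPlus\<close>, and pulling back along \<^term>\<open>word j\<close> preserves the order.\<close>

lemma real_orbit_of_word:
  obtains v :: real where "1 \<le> v" "v \<le> 2" "\<And>i. i < length (word k) \<Longrightarrow> (fam v ^^ i) v \<in> cell (word k ! i)"
proof -
  obtain ws where ws: "word k = NearPlus # ws" using word_hd by blast
  have rng: "pull (word k) v 0 \<in> cell NearPlus" if "1 \<le> v" "v \<le> 2" for v
    using branch_in_cell[OF that, of "pull ws v 0" NearPlus] pull_bound[OF that, of 0 ws]
    unfolding ws by (simp add: abs_le_iff del: branch.simps cell.simps)
  have "\<exists>v. 1 \<le> v \<and> v \<le> 2 \<and> pull (word k) v 0 - v = 0"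
    by (rule IVT2') (use rng[of 1] rng[of 2] in \<open>auto intro!: continuous_intros continuous_on_pull\<close>)
  then obtain v where v: "1 \<le> v" "v \<le> 2" "pull (word k) v 0 = v" by auto
  have step: "(fam v ^^ length pre) v = pull suf v 0" if "word k = pre @ suf" for pre suf
    using that
  proof (induction pre arbitrary: suf rule: rev_induct)
    case Nil
    thus ?case using v by simp
  next
    case (snoc l pre)
    have "(fam v ^^ length pre) v = branch l v (pull suf v 0)" using snoc.IH[of "l # suf"] snoc.prems by simp
    moreover have "fam v (branch l v (pull suf v 0)) = pull suf v 0"
    proof (rule fam_branch[OF v(1,2)])
      have g: "admissible k (l # suf)" using admissible_word[of k] admissible_suffix[of k pre "l # suf"] snoc.prems by simp
      show "-2 \<le> pull suf v 0" "pull suf v 0 \<le> 2" using pull_bound[OF v(1,2), of 0 suf] by auto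
      show "pull suf v 0 \<le> 0" if l: "l = Near1 m" for m
      proof -
        obtain zs where "suf = Near0 m # zs" using g l by auto
        thus ?thesis using branch_in_cell[OF v(1,2), of "pull zs v 0" "Near0 m"] pull_bound[OF v(1,2), of 0 zs]
          by (simp add: abs_le_iff del: branch.simps)
      qed
      show "pull suf v 0 \<le> v" if l: "l = Near0 m" for m
      proof -
        obtain j zs where j: "j < k" "suf = word j @ NearMinus # zs" using g l unfolding l admissible.simps by blast
        obtain zs' where zs': "word k = word j @ NearPlus # zs'" using word_prefix_less[OF j(1)] by blast
        have "branch NearMinus v (pull zs v 0) \<le> branch NearPlus v (pull zs' v 0)"
          using branch_in_cell[OF v(1,2), of "pull zs v 0" NearMinus] pull_bound[OF v(1,2), of 0 zs]
            branch_in_cell[OF v(1,2), of "pull zs' v 0" NearPlus] pull_bound[OF v(1,2), of 0 zs']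
          by (simp add: abs_le_iff del: branch.simps)
        hence "pull suf v 0 \<le> pull (word k) v 0"
          using pull_mono[of _ _ "word j" v] even_NearMinus_word[of j] unfolding j(2) zs' pull_simps by simp
        thus ?thesis using v by simp
      qed
    qed
    ultimately show ?case by simp
  qed
  have "(fam v ^^ i) v \<in> cell (word k ! i)" if i: "i < length (word k)" for i
  proof -
    have e: "word k = take i (word k) @ (word k ! i) # drop (Suc i) (word k)" using id_take_nth_drop[OF i] .
    have "(fam v ^^ length (take i (word k))) v = pull (word k ! i # drop (Suc i) (word k)) v 0"
      by (rule step[OF e])
    hence "(fam v ^^ i) v = branch (word k ! i) v (pull (drop (Suc i) (word k)) v 0)" using i by simp
    thus ?thesis using branch_in_cell[OF v(1,2), of "pull (drop (Suc i) (word k)) v 0"]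
        pull_bound[OF v(1,2), of 0 "drop (Suc i) (word k)"] by (simp add: abs_le_iff)
  qed
  thus ?thesis using that v by blast
qed

lemma real_orbit_of_all_words:
  obtains v :: real where "1 \<le> v" "v \<le> 2"
    "\<And>k i. i < length (word k) \<Longrightarrow> (fam v ^^ i) v \<in> cell (word k ! i)"
proof -
  have "\<exists>v::real. v \<in> {1..2} \<and> (\<forall>i<length (word k). (fam v ^^ i) v \<in> cell (word k ! i))" for k
    using real_orbit_of_word[of k] by (metis atLeastAtMost_iff)
  then obtain V :: "nat \<Rightarrow> real" where V: "\<And>k. V k \<in> {1..2}"
    "\<And>k i. i < length (word k) \<Longrightarrow> (fam (V k) ^^ i) (V k) \<in> cell (word k ! i)" by metis
  obtain v \<sigma> where v: "v \<in> {1..2}" and \<sigma>: "strict_mono \<sigma>" and lim: "(V \<circ> \<sigma>) \<longlonglongrightarrow> v"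
    using compact_Icc[of "1::real" 2] V(1) unfolding compact_def by metis
  have "(fam v ^^ i) v \<in> cell (word k ! i)" if i: "i < length (word k)" for k i
  proof (rule Lim_in_closed_set[OF closed_cell])
    have "continuous_on UNIV (\<lambda>v::real. (fam v ^^ i) v)" by (intro continuous_intros)
    hence "isCont (\<lambda>v::real. (fam v ^^ i) v) v" by (simp add: continuous_on_eq_continuous_at)
    thus "((\<lambda>n. (fam (V (\<sigma> n)) ^^ i) (V (\<sigma> n))) \<longlongrightarrow> (fam v ^^ i) v) sequentially"
      using isCont_tendsto_compose[OF _ lim] by (simp add: comp_def)
    show "\<forall>\<^sub>F n in sequentially. (fam (V (\<sigma> n)) ^^ i) (V (\<sigma> n)) \<in> cell (word k ! i)"
      using eventually_ge_at_top[of k]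
    proof eventually_elim
      case (elim n)
      hence "k \<le> \<sigma> n" using seq_suble[OF \<sigma>, of n] by simp
      then obtain zs where "word (\<sigma> n) = word k @ zs" using word_prefix_le by blast
      thus ?case using V(2)[of i "\<sigma> n"] i by (simp add: nth_append)
    qed
  qed auto
  thus ?thesis using that v by auto
qed

section \<open>The orbit of the critical value\<close>

lemma fam_near_0_upper:
  fixes v x :: "'a::real_normed_field"
  assumes "norm v \<le> 2" "x \<in> piece 0"
  shows "norm (fam v x - v) \<le> 4 * lam * (norm x)\<^sup>2"
proof -
  have z: "(0::'a) \<in> piece 0" by (simp add: piece_def)
  have "norm (fam v x - fam v 0) = (norm x)\<^sup>2 *
      (norm (x\<^sup>2 - 2) * norm (of_real lam * ((x\<^sup>2 - 1)\<^sup>2 + (0\<^sup>2 - 1)\<^sup>2 - 1) + v))"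
    unfolding fam_diff norm_mult by (simp add: power2_eq_square)
  also have "\<dots> \<le> (norm x)\<^sup>2 * (3 * (11/10 * lam))"
    using piece_size(4)[OF assms(2)] piece_factor(2)[OF assms(1,2) z] lam_pos
    by (intro mult_left_mono mult_mono) auto
  also have "\<dots> \<le> (norm x)\<^sup>2 * (4 * lam)" using lam_pos by (intro mult_left_mono) auto
  finally show ?thesis by (simp add: mult.commute)
qed

lemma iter_lipschitz:
  fixes v x y :: "'a::real_normed_field"
  assumes v: "norm v \<le> 2"
    and b: "\<And>j. j < m \<Longrightarrow> norm ((fam v ^^ j) x) \<le> 2" "\<And>j. j < m \<Longrightarrow> norm ((fam v ^^ j) y) \<le> 2"
  shows "norm ((fam v ^^ m) x - (fam v ^^ m) y) \<le> lip ^ m * norm (x - y)"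
  using b
proof (induction m)
  case (Suc m)
  have "norm (fam v ((fam v ^^ m) x) - fam v ((fam v ^^ m) y)) \<le>
      lip * norm ((fam v ^^ m) x - (fam v ^^ m) y)"
    by (intro fam_lipschitz[OF v] Suc.prems lessI)
  also have "\<dots> \<le> lip * (lip ^ m * norm (x - y))"
    using Suc lip_ge_1 by (intro mult_left_mono) auto
  finally show ?case by (simp add: mult.assoc)
qed simp

lemma iter_of_real:
  "(fam (of_real v) ^^ n) (of_real x) = (of_real ((fam v ^^ n) x) :: 'a::real_normed_field)"
  by (induction n) (simp_all add: fam_of_real)

lemma crit_dist_of_real: "crit_dist (of_real x :: 'a::real_normed_field) = crit_dist x"
proof -
  have "(of_real x :: 'a)\<^sup>2 - 1 = of_real (x\<^sup>2 - 1)" by simp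
  thus ?thesis unfolding crit_dist_def by (metis norm_of_real real_norm_def)
qed

fun center :: "letter \<Rightarrow> real" where
  "center NearPlus = 2" | "center NearMinus = 2" | "center (Near1 m) = 1" | "center (Near0 m) = 0"

lemma cell_sq:
  assumes "x \<in> cell l"
  shows "l = NearPlus \<or> l = NearMinus \<Longrightarrow> x\<^sup>2 \<ge> 36/25" "l = Near1 m \<Longrightarrow> x\<^sup>2 \<ge> 1/4" "l = Near1 m \<Longrightarrow> x\<^sup>2 \<le> 1"
    "l = Near0 m \<Longrightarrow> x\<^sup>2 \<le> 1/4"
proof -
  have sq: "a\<^sup>2 \<le> x\<^sup>2" if "0 \<le> a" "a \<le> \<bar>x\<bar>" for a
    using power_mono[OF that(2,1), of 2] by simp
  have sq': "x\<^sup>2 \<le> a\<^sup>2" if "\<bar>x\<bar> \<le> a" for a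
    using power_mono[OF that, of 2] by simp
  show "l = NearPlus \<or> l = NearMinus \<Longrightarrow> x\<^sup>2 \<ge> 36/25" using sq[of "6/5"] assms by (auto simp: power2_eq_square)
  show "l = Near1 m \<Longrightarrow> x\<^sup>2 \<ge> 1/4" using sq[of "1/2"] assms by (auto simp: power2_eq_square)
  show "l = Near1 m \<Longrightarrow> x\<^sup>2 \<le> 1" using sq'[of 1] assms by auto
  show "l = Near0 m \<Longrightarrow> x\<^sup>2 \<le> 1/4" using sq'[of "1/2"] assms by (auto simp: power2_eq_square)
qed

lemma cell_piece:
  fixes v x :: real
  assumes v: "\<bar>v\<bar> \<le> 2" and x: "x \<in> cell l" and f: "\<bar>fam v x\<bar> \<le> 2"
  shows "x \<in> piece (center l)"
proof -
  have "x \<in> piece 0 \<or> x \<in> piece 1 \<or> x \<in> piece 2"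
    using in_piece[of v x] v f cell_bound[OF x] by simp
  hence p: "\<bar>x\<^sup>2\<bar> \<le> 1/100 \<or> \<bar>x\<^sup>2 - 1\<bar> \<le> 1/100 \<or> \<bar>x\<^sup>2 - 2\<bar> \<le> 1/100" by (simp add: piece_def)
  have "\<bar>x\<^sup>2 - center l\<bar> \<le> 1/100"
  proof (cases l)
    case NearPlus
    thus ?thesis using p cell_sq(1)[OF x] by (simp add: abs_le_iff)
  next
    case NearMinus
    thus ?thesis using p cell_sq(1)[OF x] by (simp add: abs_le_iff)
  next
    case (Near1 m)
    thus ?thesis using p cell_sq(2,3)[OF x, of m] by (simp add: abs_le_iff)
  next
    case (Near0 m)
    thus ?thesis using p cell_sq(4)[OF x, of m] by (simp add: abs_le_iff)
  qed
  thus ?thesis by (simp add: piece_def)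
qed

lemma between_in_cell_piece:
  fixes a b x :: real
  assumes "a \<in> cell l \<inter> piece (center l)" "b \<in> cell l \<inter> piece (center l)" "a \<le> x" "x \<le> b"
  shows "x \<in> cell l \<inter> piece (center l)"
proof -
  have c: "x \<in> cell l" using assms by (cases l) auto
  have "a\<^sup>2 \<le> x\<^sup>2 \<and> x\<^sup>2 \<le> b\<^sup>2 \<or> b\<^sup>2 \<le> x\<^sup>2 \<and> x\<^sup>2 \<le> a\<^sup>2"
  proof (cases "l = NearPlus \<or> (\<exists>m. l = Near1 m)")
    case True
    hence "0 \<le> a" using assms by auto
    thus ?thesis using assms by (auto intro!: power_mono)
  next
    case False
    hence "b \<le> 0" using assms by (cases l) auto
    thus ?thesis using power_mono[of "-b" "-x" 2] power_mono[of "-x" "-a" 2] assms by simp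
  qed
  moreover have "\<bar>a\<^sup>2 - center l\<bar> \<le> 1/100" "\<bar>b\<^sup>2 - center l\<bar> \<le> 1/100"
    using assms(1,2) by (auto simp: piece_def)
  ultimately have "\<bar>x\<^sup>2 - center l\<bar> \<le> 1/100" by linarith
  hence "x \<in> piece (center l)" by (simp add: piece_def)
  thus ?thesis using c by simp
qed

text \<open>The signs of the factors of \<open>fam_diff\<close> are constant on the real part of each piece that belongs to a letter.\<close>

lemma fam_mono_cell:
  fixes v a b :: real
  assumes v: "\<bar>v\<bar> \<le> 2" and a: "a \<in> cell l \<inter> piece (center l)" and b: "b \<in> cell l \<inter> piece (center l)"
    and ab: "a \<le> b"
  shows "if l = NearMinus then fam v b \<le> fam v a else fam v a \<le> fam v b"
proof -
  define Q where "Q = lam * ((b\<^sup>2 - 1)\<^sup>2 + (a\<^sup>2 - 1)\<^sup>2 - 1) + v"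
  have eq: "fam v b - fam v a = (b - a) * ((b + a) * ((b\<^sup>2 + a\<^sup>2 - 2) * Q))"
    by (simp add: fam_diff Q_def)
  have s: "norm ((z\<^sup>2 - 1)\<^sup>2 - (if center l = 1 then 0 else 1)) \<le> 1/40" if "z \<in> piece (center l)" for z :: real
    by (rule piece_s[OF that]) (cases l; simp)
  have ba: "b - a \<ge> 0" using ab by simp
  show ?thesis
  proof (cases "\<exists>m. l = Near1 m")
    case True
    then obtain m where l: "l = Near1 m" by blast
    have "(b\<^sup>2 - 1)\<^sup>2 + (a\<^sup>2 - 1)\<^sup>2 - 1 \<le> -9/10" using s[of a] s[of b] a b l by (auto simp: abs_le_iff)
    hence "lam * ((b\<^sup>2 - 1)\<^sup>2 + (a\<^sup>2 - 1)\<^sup>2 - 1) \<le> lam * (-9/10)" using lam_pos by (intro mult_left_mono) auto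
    hence "Q \<le> 0" using v lam_ge unfolding Q_def by linarith
    moreover have "b\<^sup>2 + a\<^sup>2 - 2 \<le> 0" using cell_sq(3)[of a l m] cell_sq(3)[of b l m] a b l by simp
    ultimately have "0 \<le> (b\<^sup>2 + a\<^sup>2 - 2) * Q" by (intro mult_nonpos_nonpos)
    moreover have "b + a \<ge> 0" using a b l by simp
    ultimately have "0 \<le> (b + a) * ((b\<^sup>2 + a\<^sup>2 - 2) * Q)" by (rule mult_nonneg_nonneg[rotated])
    hence "0 \<le> fam v b - fam v a" unfolding eq by (rule mult_nonneg_nonneg[OF ba])
    thus ?thesis using l by simp
  next
    case False
    hence c1: "center l \<noteq> 1" by (cases l) auto
    have "\<bar>(a\<^sup>2 - 1)\<^sup>2 - 1\<bar> \<le> 1/40" "\<bar>(b\<^sup>2 - 1)\<^sup>2 - 1\<bar> \<le> 1/40" using s[of a] s[of b] a b c1 by auto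
    hence "(b\<^sup>2 - 1)\<^sup>2 + (a\<^sup>2 - 1)\<^sup>2 - 1 \<ge> 9/10" by linarith
    hence "lam * ((b\<^sup>2 - 1)\<^sup>2 + (a\<^sup>2 - 1)\<^sup>2 - 1) \<ge> lam * (9/10)" using lam_pos by (intro mult_left_mono) auto
    hence Q: "Q \<ge> 0" using v lam_ge unfolding Q_def by linarith
    show ?thesis
    proof (cases l)
      case NearPlus
      have "b\<^sup>2 + a\<^sup>2 - 2 \<ge> 0" using cell_sq(1)[of a l] cell_sq(1)[of b l] a b NearPlus by simp
      moreover have "b + a \<ge> 0" using a b NearPlus by simp
      ultimately have "0 \<le> fam v b - fam v a" unfolding eq using ba Q by (intro mult_nonneg_nonneg)
      thus ?thesis using NearPlus by simp
    next
      case NearMinus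
      have "b\<^sup>2 + a\<^sup>2 - 2 \<ge> 0" using cell_sq(1)[of a l] cell_sq(1)[of b l] a b NearMinus by simp
      hence "(b\<^sup>2 + a\<^sup>2 - 2) * Q \<ge> 0" using Q by (intro mult_nonneg_nonneg)
      moreover have "b + a \<le> 0" using a b NearMinus by simp
      ultimately have "(b + a) * ((b\<^sup>2 + a\<^sup>2 - 2) * Q) \<le> 0" by (intro mult_nonpos_nonneg)
      hence "fam v b - fam v a \<le> 0" unfolding eq by (rule mult_nonneg_nonpos[OF ba])
      thus ?thesis using NearMinus by simp
    next
      case (Near1 m)
      thus ?thesis using False by simp
    next
      case (Near0 m)
      have "b\<^sup>2 + a\<^sup>2 - 2 \<le> 0" using cell_sq(4)[of a l m] cell_sq(4)[of b l m] a b Near0 by simp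
      hence "(b\<^sup>2 + a\<^sup>2 - 2) * Q \<le> 0" using Q by (intro mult_nonpos_nonneg)
      moreover have "b + a \<le> 0" using a b Near0 by simp
      ultimately have "0 \<le> (b + a) * ((b\<^sup>2 + a\<^sup>2 - 2) * Q)" by (intro mult_nonpos_nonpos)
      hence "0 \<le> fam v b - fam v a" unfolding eq by (rule mult_nonneg_nonneg[OF ba])
      thus ?thesis using Near0 by simp
    qed
  qed
qed

lemma fam_hull:
  fixes v a b x :: real
  assumes v: "\<bar>v\<bar> \<le> 2" and ab: "a \<in> cell l" "b \<in> cell l" "\<bar>fam v a\<bar> \<le> 2" "\<bar>fam v b\<bar> \<le> 2"
    and x: "min a b \<le> x" "x \<le> max a b"
  shows "min (fam v a) (fam v b) \<le> fam v x" "fam v x \<le> max (fam v a) (fam v b)"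
proof -
  define a' b' where "a' = min a b" and "b' = max a b"
  have "a' \<in> cell l \<inter> piece (center l)" "b' \<in> cell l \<inter> piece (center l)"
    using cell_piece[OF v ab(1,3)] cell_piece[OF v ab(2,4)] ab by (auto simp: a'_def b'_def min_def max_def)
  note p = this between_in_cell_piece[OF this, of x]
  have "if l = NearMinus then fam v x \<le> fam v a' else fam v a' \<le> fam v x"
    "if l = NearMinus then fam v b' \<le> fam v x else fam v x \<le> fam v b'"
    using fam_mono_cell[OF v, of a' l x] fam_mono_cell[OF v, of x l b'] p x
    unfolding a'_def[symmetric] b'_def[symmetric] by blast+
  moreover have "fam v a' \<in> {fam v a, fam v b}" "fam v b' \<in> {fam v a, fam v b}"
    by (auto simp: a'_def b'_def min_def max_def)
  ultimately show "min (fam v a) (fam v b) \<le> fam v x" "fam v x \<le> max (fam v a) (fam v b)"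
    by (auto split: if_splits simp: min_le_iff_disj le_max_iff_disj)
qed

text \<open>The words are prefixes of each other, so this is one infinite itinerary.\<close>

locale recurrent_word_orbit =
  fixes v :: real
  assumes v: "1 \<le> v" "v \<le> 2"
    and cells: "\<And>k i. i < length (word k) \<Longrightarrow> (fam v ^^ i) v \<in> cell (word k ! i)"
begin

abbreviation w :: "nat \<Rightarrow> real" where "w i \<equiv> (fam v ^^ i) v"

lemma v_abs: "norm v \<le> 2" "\<bar>v\<bar> \<le> 2" using v by auto

lemma w_bound: "\<bar>w i\<bar> \<le> 2"
  using cells[OF length_word] by (rule cell_bound)

lemma w_piece:
  assumes "i < length (word k)"
  shows "w i \<in> piece (center (word k ! i))"
  using cell_piece[OF v_abs(2) cells[OF assms]] w_bound[of "Suc i"] by simp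

lemma visit_1:
  assumes "i < length (word k)" "word k ! i = Near1 m"
  shows "Suc i < length (word k)" "word k ! Suc i = Near0 m"
proof -
  have "word k = take i (word k) @ word k ! i # drop (Suc i) (word k)" using id_take_nth_drop[OF assms(1)] .
  hence "admissible k (Near1 m # drop (Suc i) (word k))" using admissible_word[of k] admissible_suffix assms(2) by metis
  then obtain zs where zs: "drop (Suc i) (word k) = Near0 m # zs" by auto
  thus *: "Suc i < length (word k)" by (metis drop_all linorder_not_le list.distinct(1))
  show "word k ! Suc i = Near0 m" using zs * by (metis hd_drop_conv_nth list.sel(1))
qed

lemma visit_0:
  assumes "i < length (word k)" "word k ! i = Near0 m"
  shows "w m \<in> cell NearPlus" "w (Suc i + m) \<in> cell NearMinus"
proof -
  have "word k = take i (word k) @ word k ! i # drop (Suc i) (word k)" using id_take_nth_drop[OF assms(1)] .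
  hence "admissible k (Near0 m # drop (Suc i) (word k))" using admissible_word[of k] admissible_suffix assms(2) by metis
  then obtain j zs where j: "j < k" "m = length (word j)" "drop (Suc i) (word k) = word j @ NearMinus # zs"
    unfolding admissible.simps by blast
  obtain zs' where zs': "word k = word j @ NearPlus # zs'" using word_prefix_less[OF j(1)] by blast
  have "m < length (word k)" "word k ! m = NearPlus" using j(2) zs' by simp_all
  thus "w m \<in> cell NearPlus" using cells[of m k] by simp
  have l: "length (drop (Suc i) (word k)) = m + 1 + length zs" using j by simp
  hence "Suc i + m < length (word k)" by simp
  moreover have "word k ! (Suc i + m) = drop (Suc i) (word k) ! m" using l by simp
  hence "word k ! (Suc i + m) = NearMinus" using j by simp
  ultimately show "w (Suc i + m) \<in> cell NearMinus" using cells[of "Suc i + m" k] by simp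
qed

lemma iter_w: "(fam v ^^ j) (w i) = w (i + j)"
  by (simp add: funpow_add add.commute[of i j])

text \<open>After leaving the fold and making \<open>m\<close> more steps the orbit is near \<open>-\<surd>2\<close>, whereas \<open>v\<close> is near \<open>\<surd>2\<close>
  after \<open>m\<close> steps. Two points that separate within \<open>m\<close> steps are at least \<open>lip\<close> to the power \<open>-m\<close> apart, and their distance is of order \<open>lam\<close>
  times the square of the distance of the visit to 0.\<close>

lemma depth_0:
  assumes "i < length (word k)" "word k ! i = Near0 m"
  shows "1 \<le> 1000 ^ (9 * m + 9) * \<bar>w i\<bar>"
proof -
  have p: "w i \<in> piece 0" using w_piece[OF assms(1)] assms(2) by simp
  have "1 \<le> norm (w (Suc i + m) - w m)" using visit_0[OF assms] by auto
  also have "\<dots> \<le> lip ^ m * norm (w (Suc i) - v)"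
    using iter_lipschitz[OF v_abs(1), of m "w (Suc i)" v] w_bound unfolding iter_w real_norm_def by blast
  also have "\<dots> \<le> lip ^ m * (4 * lam * (norm (w i))\<^sup>2)"
    using fam_near_0_upper[OF v_abs(1) p] lip_ge_1 by (intro mult_left_mono) auto
  also have "\<dots> \<le> 1000 ^ (18 * m) * (1000 ^ 18 * (norm (w i))\<^sup>2)"
    unfolding lip_def power_mult by (intro mult_left_mono mult_right_mono) (auto simp: lam_def)
  also have "\<dots> = (1000 ^ (9 * m + 9) * \<bar>w i\<bar>)\<^sup>2"
  proof -
    have "(1000 :: real) ^ (18 * m) * 1000 ^ 18 = (1000 ^ (9 * m + 9))\<^sup>2"
      unfolding power_mult[symmetric] power_add[symmetric] by simp
    thus ?thesis by (simp add: power_mult_distrib)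
  qed
  finally have "1\<^sup>2 \<le> (1000 ^ (9 * m + 9) * \<bar>w i\<bar>)\<^sup>2" by simp
  thus ?thesis by (rule power2_le_imp_le) simp
qed

lemma depth_1:
  assumes "i < length (word k)" "word k ! i = Near1 m"
  shows "1 \<le> 1000 ^ (9 * m + 13) * norm ((w i)\<^sup>2 - 1)"
proof -
  have p: "w i \<in> piece 1" using w_piece[OF assms(1)] assms(2) by simp
  define d where "d = norm ((w i)\<^sup>2 - 1)"
  have d: "d \<ge> 0" by (simp add: d_def)
  have "1 \<le> 1000 ^ (9 * m + 9) * \<bar>w (Suc i)\<bar>" by (rule depth_0[OF visit_1[OF assms]])
  also have "\<dots> \<le> 1000 ^ (9 * m + 9) * (11/10 * lam * d\<^sup>2)"
    using fam_near_1(1)[OF v_abs(1) p] by (intro mult_left_mono) (auto simp: d_def)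
  also have "\<dots> \<le> 1000 ^ (9 * m + 9) * (1000 ^ 17 * d\<^sup>2)"
    by (intro mult_left_mono mult_right_mono) (auto simp: lam_def)
  also have "\<dots> = 1000 ^ (9 * m + 26) * d\<^sup>2" by (simp add: power_add)
  also have "\<dots> \<le> 1000 ^ ((9 * m + 13) * 2) * d\<^sup>2" by (intro mult_right_mono power_increasing) auto
  also have "\<dots> = (1000 ^ (9 * m + 13) * d)\<^sup>2" by (simp only: power_mult_distrib power_mult)
  finally have "1\<^sup>2 \<le> (1000 ^ (9 * m + 13) * d)\<^sup>2" by simp
  thus ?thesis unfolding d_def by (rule power2_le_imp_le) simp
qed

text \<open>Near \<open>\<plusminus>\<surd>2\<close> nothing is lost. At the folds the depth estimates apply, with some powers of 1000 to spare for
  the factor of \<^const>\<open>crit_dist\<close> that is near 1.\<close>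

lemma crit_dist_lower:
  assumes "i < length (word k)"
  shows "1 / 1000 ^ loss (word k ! i) \<le> crit_dist (w i)"
proof -
  note p = w_piece[OF assms]
  have big: "1 \<le> crit_dist (w i)" if "center (word k ! i) = 2"
  proof -
    have "7/5 * (9/10) \<le> norm (w i) * norm ((w i)\<^sup>2 - 1)"
      using piece_size(8,10)[of "w i"] p that by (intro mult_mono) auto
    thus ?thesis by (simp add: crit_dist_def)
  qed
  show ?thesis
  proof (cases "word k ! i")
    case NearPlus
    thus ?thesis using big by simp
  next
    case NearMinus
    thus ?thesis using big by simp
  next
    case (Near1 m)
    define d where "d = norm ((w i)\<^sup>2 - 1)"
    have 1: "1 \<le> 1000 ^ (9 * m + 13) * d" using depth_1[OF assms Near1] by (simp add: d_def)
    have "d \<le> 1000 * (9/10 * d)" by (simp add: d_def)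
    also have "9/10 * d \<le> crit_dist (w i)"
      unfolding crit_dist_def d_def using piece_size(6)[of "w i"] p Near1 by (intro mult_right_mono) auto
    finally have "1000 ^ (9 * m + 13) * d \<le> 1000 ^ (9 * m + 13) * (1000 * crit_dist (w i))"
      by (intro mult_left_mono) auto
    also have "\<dots> = 1000 ^ (9 * m + 13 + 1) * crit_dist (w i)"
      by (simp only: power_add power_one_right mult.assoc)
    also have "9 * m + 13 + 1 = 9 * m + 14" by simp
    finally show ?thesis using 1 Near1 by (simp add: pos_divide_le_eq mult.commute)
  next
    case (Near0 m)
    have 1: "1 \<le> 1000 ^ (9 * m + 9) * \<bar>w i\<bar>" by (rule depth_0[OF assms Near0])
    have "\<bar>w i\<bar> \<le> 1000 ^ 5 * (9/10 * \<bar>w i\<bar>)" by simp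
    also have "\<bar>w i\<bar> * (9/10) \<le> crit_dist (w i)"
      unfolding crit_dist_def real_norm_def[of "w i"] using piece_size(2)[of "w i"] p Near0
      by (intro mult_left_mono) auto
    hence "1000 ^ 5 * (9/10 * \<bar>w i\<bar>) \<le> 1000 ^ 5 * crit_dist (w i)"
      by (intro mult_left_mono) auto
    finally have "1000 ^ (9 * m + 9) * \<bar>w i\<bar> \<le> 1000 ^ (9 * m + 9) * (1000 ^ 5 * crit_dist (w i))"
      by (intro mult_left_mono) auto
    also have "\<dots> = 1000 ^ (9 * m + 9 + 5) * crit_dist (w i)"
      by (simp only: power_add mult.assoc)
    also have "9 * m + 9 + 5 = 9 * m + 14" by simp
    finally show ?thesis using 1 Near0 by (simp add: pos_divide_le_eq mult.commute)
  qed
qed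

lemma loss_prefix:
  assumes "n \<le> length (word k)"
  shows "(\<Sum>i<n. loss (word k ! i)) \<le> n"
proof -
  have "(\<Sum>i<n. loss (word k ! i)) = sum_list (map loss (take n (word k)))"
    using assms by (simp add: sum_list_sum_nth atLeast0LessThan)
  thus ?thesis using loss_bounded_word[of k] unfolding loss_bounded_def by simp
qed

text \<open>The total loss up to time \<open>n\<close> is at most \<open>n\<close>, against a gain of \<open>16 * n\<close> from the factors \<open>lam\<close>.\<close>

lemma w_growth: "1000 ^ (8 * n) \<le> (\<Prod>i<n. lam * crit_dist (w i))"
proof -
  have len: "n \<le> length (word n)" using length_word[of n] by simp
  define L where "L i = loss (word n ! i)" for i
  have "(1000::real) ^ (8 * n) * 1000 ^ (\<Sum>i<n. L i) \<le> 1000 ^ (8 * n) * 1000 ^ n"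
    using loss_prefix[OF len] by (intro mult_left_mono power_increasing) (auto simp: L_def)
  also have "\<dots> \<le> 1000 ^ (16 * n)" unfolding power_add[symmetric] by (intro power_increasing) auto
  finally have "(1000::real) ^ (8 * n) * 1000 ^ (\<Sum>i<n. L i) \<le> 1000 ^ (16 * n)" .
  hence "(1000::real) ^ (8 * n) \<le> 1000 ^ (16 * n) / 1000 ^ (\<Sum>i<n. L i)" by (simp add: pos_le_divide_eq)
  also have "\<dots> = (\<Prod>i<n. lam * (1 / 1000 ^ L i))"
    by (simp add: prod_dividef power_sum lam_def power_mult)
  also have "\<dots> \<le> (\<Prod>i<n. lam * crit_dist (w i))"
    using crit_dist_lower[of _ n] len lam_pos by (intro prod_mono conjI mult_left_mono) (auto simp: L_def)
  finally show ?thesis .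
qed

lemma w_depth: "1 / 1000 ^ (n + 1) \<le> crit_dist (w n)"
proof -
  have len: "Suc n \<le> length (word n)" using length_word[of n] by simp
  have "loss (word n ! n) \<le> (\<Sum>i<Suc n. loss (word n ! i))" by simp
  also have "\<dots> \<le> n + 1" using loss_prefix[OF len] by simp
  finally have "(1000::real) ^ loss (word n ! n) \<le> 1000 ^ (n + 1)" by (intro power_increasing) auto
  hence "1 / 1000 ^ (n + 1) \<le> (1::real) / 1000 ^ loss (word n ! n)" by (intro divide_left_mono) auto
  thus ?thesis using crit_dist_lower[of n n] len by simp
qed

sublocale slow_critical_orbit "complex_of_real v"
proof
  fix n
  show "norm ((fam (complex_of_real v) ^^ n) (complex_of_real v)) \<le> 2"
    using w_bound by (simp add: iter_of_real)
  show "1 / 1000 ^ (n + 1) \<le> crit_dist ((fam (complex_of_real v) ^^ n) (complex_of_real v))"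
    using w_depth[of n] by (simp add: iter_of_real crit_dist_of_real)
  show "1000 ^ (8 * n) \<le> (\<Prod>i<n. lam * crit_dist ((fam (complex_of_real v) ^^ i) (complex_of_real v)))"
    using w_growth[of n] by (simp add: iter_of_real crit_dist_of_real)
qed

text \<open>The interval between the two points keeps the common itinerary, so \<open>shrink\<close> applies to it.\<close>

lemma common_itinerary_close:
  assumes "\<And>i. i < m \<Longrightarrow> \<exists>l. (fam v ^^ i) a \<in> cell l \<and> (fam v ^^ i) b \<in> cell l"
    and ab: "\<And>i. i \<le> m \<Longrightarrow> \<bar>(fam v ^^ i) a\<bar> \<le> 2" "\<And>i. i \<le> m \<Longrightarrow> \<bar>(fam v ^^ i) b\<bar> \<le> 2"
  shows "\<bar>a - b\<bar> \<le> 16 * (1/2) ^ m"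
proof -
  have hull: "min ((fam v ^^ i) a) ((fam v ^^ i) b) \<le> (fam v ^^ i) x \<and>
      (fam v ^^ i) x \<le> max ((fam v ^^ i) a) ((fam v ^^ i) b)"
    if "i \<le> m" "min a b \<le> x" "x \<le> max a b" for i x
    using that(1)
  proof (induction i)
    case (Suc i)
    obtain l where l: "(fam v ^^ i) a \<in> cell l" "(fam v ^^ i) b \<in> cell l" using assms(1)[of i] Suc by auto
    show ?case
      using fam_hull[OF v_abs(2) l, of "(fam v ^^ i) x"] ab[of "Suc i"] Suc by simp
  qed (use that in simp)
  define X where "X = complex_of_real ` {min a b..max a b}"
  have "norm (complex_of_real a - complex_of_real b) \<le> 16 * (1/2) ^ m"
  proof (rule shrink)
    show "connected X" unfolding X_def
      by (intro connected_continuous_image continuous_intros) simp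
    show "norm ((fam (complex_of_real v) ^^ i) z) \<le> 2" if i: "i \<le> m" and z: "z \<in> X" for i z
    proof -
      obtain x where x: "z = complex_of_real x" "min a b \<le> x" "x \<le> max a b" using z by (auto simp: X_def)
      have "\<bar>(fam v ^^ i) x\<bar> \<le> 2" using hull[OF i x(2,3)] ab[OF i] by (auto simp: abs_le_iff)
      thus ?thesis by (simp add: x(1) iter_of_real)
    qed
  qed (auto simp: X_def)
  thus ?thesis by (simp add: of_real_diff[symmetric] del: of_real_diff)
qed

text \<open>The time of the last visit to 1 before the final copy of \<^term>\<open>word k\<close> in \<^term>\<open>word (Suc k)\<close>.\<close>

definition visit :: "nat \<Rightarrow> nat" where "visit k = length (word k) + 1 + (18 * length (word k) + 29)"

lemma word_at_visit:
  "word (Suc k) ! visit k = Near1 (length (word k))"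
  "word (Suc k) ! Suc (visit k) = Near0 (length (word k))"
  "i < length (word k) \<Longrightarrow> word (Suc k) ! (visit k + 2 + i) = word k ! i"
  "visit k + 2 + length (word k) < length (word (Suc k))"
  by (simp_all add: visit_def nth_append nth_Cons')

text \<open>Two steps after this time the orbit repeats the beginning of the itinerary of \<open>v\<close>, so it is close to
  \<open>v\<close>. Through the two folds this bounds the fourth power of the distance to 1 before.\<close>

lemma visit_close: "\<bar>w (visit k) - 1\<bar> ^ 4 \<le> 16 * (1/2) ^ k"
proof -
  define m n where "m = length (word k)" and "n = visit k"
  note W = word_at_visit[where k = k, folded m_def n_def]
  have km: "k \<le> m" using length_word[of k] by (simp add: m_def)
  have "\<bar>w (n + 2) - v\<bar> \<le> 16 * (1/2) ^ m"
  proof (rule common_itinerary_close)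
    show "\<exists>l. (fam v ^^ i) (w (n + 2)) \<in> cell l \<and> w i \<in> cell l" if "i < m" for i
    proof (intro exI conjI)
      show "w i \<in> cell (word k ! i)" using cells[of i k] that by (simp add: m_def)
      show "(fam v ^^ i) (w (n + 2)) \<in> cell (word k ! i)"
        unfolding iter_w using cells[of "n + 2 + i" "Suc k"] W(3)[OF that] W(4) that by simp
    qed
    show "\<bar>(fam v ^^ i) (w (n + 2))\<bar> \<le> 2" for i unfolding iter_w by (rule w_bound)
  qed (rule w_bound)
  also have "\<dots> \<le> 16 * (1/2) ^ k" using km by (intro mult_left_mono power_decreasing) auto
  finally have 1: "\<bar>w (n + 2) - v\<bar> \<le> 16 * (1/2) ^ k" .
  have n: "n < length (word (Suc k))" "Suc n < length (word (Suc k))" using W(4) by linarith+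
  have p1: "w n \<in> piece 1" using w_piece[OF n(1)] unfolding W(1) by simp
  have p0: "w (Suc n) \<in> piece 0" using w_piece[OF n(2)] unfolding W(2) by simp
  define d where "d = \<bar>(w n)\<^sup>2 - 1\<bar>"
  have "w n \<in> cell (Near1 m)" using cells[OF n(1)] unfolding W(1) .
  hence wn: "1/2 \<le> w n" by simp
  have "\<bar>w n - 1\<bar> * 1 \<le> \<bar>w n - 1\<bar> * \<bar>w n + 1\<bar>" using wn by (intro mult_left_mono) auto
  also have "\<dots> = d" by (simp add: d_def abs_mult[symmetric] power2_eq_square algebra_simps)
  finally have "\<bar>w n - 1\<bar> \<le> d" by simp
  hence "\<bar>w n - 1\<bar> ^ 4 \<le> d ^ 4" by (intro power_mono) auto
  also have "\<dots> = (1 * d\<^sup>2)\<^sup>2" by simp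
  also have "\<dots> \<le> \<bar>w (Suc n)\<bar>\<^sup>2"
  proof (rule power_mono)
    have "1 * d\<^sup>2 \<le> 9/10 * lam * d\<^sup>2" using lam_ge by (intro mult_right_mono) auto
    also have "\<dots> \<le> \<bar>w (Suc n)\<bar>" using fam_near_1(2)[OF v_abs(1) p1] by (simp add: d_def)
    finally show "1 * d\<^sup>2 \<le> \<bar>w (Suc n)\<bar>" .
  qed simp
  also have "\<dots> \<le> 9/10 * lam * \<bar>w (Suc n)\<bar>\<^sup>2"
    using lam_ge mult_right_mono[of 1 "9/10 * lam" "\<bar>w (Suc n)\<bar>\<^sup>2"] by simp
  also have "\<dots> \<le> \<bar>w (n + 2) - v\<bar>"
    using fam_near_0[OF v_abs(1) p0] by (simp add: numeral_2_eq_2)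
  finally show ?thesis using 1 by (simp add: n_def)
qed

lemma one_recurrent: "recurrent (sphere_map (fam_poly (complex_of_real v))) (Fin 1)"
  unfolding recurrent_def omega_limit_def
proof (intro CollectI allI impI)
  fix U :: "riemann_sphere set" assume U: "open U \<and> Fin 1 \<in> U"
  let ?f = "sphere_map (fam_poly (complex_of_real v))"
  obtain e where e: "e > 0" "\<And>y. dist y (Fin 1) < e \<Longrightarrow> y \<in> U"
    using U unfolding open_dist by blast
  have F: "(?f ^^ (n + 2)) (Fin 1) = Fin (complex_of_real (w n))" for n
  proof -
    have "(fam (complex_of_real v) ^^ (n + 2)) 1 = (fam (complex_of_real v) ^^ n) (complex_of_real v)"
      by (simp only: numeral_2_eq_2 add_Suc_right add_0_right funpow_Suc_right comp_apply fam_simps)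
    thus ?thesis by (simp only: sphere_iter_Fin iter_of_real)
  qed
  show "\<exists>\<^sub>F n in sequentially. (?f ^^ n) (Fin 1) \<in> U"
    unfolding frequently_sequentially
  proof
    fix N
    define q where "q = (e / 4) ^ 4 / 16"
    have q: "q > 0" using e by (simp add: q_def)
    obtain k0 where k0: "(1/2) ^ k0 < q" using real_arch_pow_inv[OF q, of "1/2"] by auto
    define k where "k = max N k0"
    have "(1/2::real) ^ k \<le> (1/2) ^ k0" by (intro power_decreasing) (auto simp: k_def)
    hence "16 * (1/2) ^ k < (e / 4) ^ 4" using k0 unfolding q_def by linarith
    hence "\<bar>w (visit k) - 1\<bar> ^ 4 < (e / 4) ^ 4" using visit_close[of k] by linarith
    hence "\<bar>w (visit k) - 1\<bar> < e / 4" by (rule power_less_imp_less_base) (use e in simp)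
    hence "norm (complex_of_real (w (visit k)) - 1) < e / 4"
      by (metis norm_of_real of_real_1 of_real_diff)
    hence "dist (Fin (complex_of_real (w (visit k)))) (Fin 1) < e"
      using dist_Fin_le[of "complex_of_real (w (visit k))" 1] by simp
    hence "(?f ^^ (visit k + 2)) (Fin 1) \<in> U" unfolding F by (rule e(2))
    moreover have "N \<le> visit k + 2" using length_word[of k] by (simp add: visit_def k_def)
    ultimately show "\<exists>n\<ge>N. (?f ^^ n) (Fin 1) \<in> U" by blast
  qed
qed

end

theorem theoremA:
  shows "\<exists>p :: complex poly. degree p \<ge> 2 \<and>
    exp_shrink (sphere_map p) \<and> \<not> recurrent_collet_eckmann p"
proof -
  obtain v :: real where "1 \<le> v" "v \<le> 2"
    "\<And>k i. i < length (word k) \<Longrightarrow> (fam v ^^ i) v \<in> cell (word k ! i)"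
    by (rule real_orbit_of_all_words) blast
  then interpret recurrent_word_orbit v by unfold_locales
  define p where "p = fam_poly (complex_of_real v)"
  have "degree p \<ge> 2" unfolding p_def by (rule degree_fam_poly[OF v_bound])
  moreover have "exp_shrink (sphere_map p)" unfolding p_def by (rule exp_shrink_fam)
  moreover have "\<not> recurrent_collet_eckmann p"
  proof
    assume "recurrent_collet_eckmann p"
    moreover have "critical_point p 1"
      unfolding critical_point_def p_def poly_fam_poly by (rule fam_deriv_critical)
    ultimately have "collet_eckmann p 1"
      using one_in_julia one_recurrent unfolding recurrent_collet_eckmann_def p_def by blast
    thus False using one_not_collet_eckmann unfolding p_def by blast
  qed
  ultimately show ?thesis by blast
qed

end
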